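(* Let $k$ and $m$ be positive integers and let $\lambda/\mu$ be a skew partition. If $\lambda_i-\mu_i$ is divisible by $m$ for all $i\ge 1$, then there exists an action of a cyclic group $C_m$ of order $m$ on the set $\mathrm{SSYT}_{km}(\lambda/\mu)$ such that the triple $$\left(\mathrm{SSYT}_{km}(\lambda/\mu),\ C_m,\ s_{\lambda/\mu}(1,q,\ldots,q^{km-1})\right)$$ exhibits the cyclic sieving phenomenon.
   Context: A partition $\lambda=(\lambda_1,\lambda_2,\ldots)$ is a weakly decreasing sequence of nonnegative integers with finitely many nonzero terms, identified with its Young diagram. A skew partition $\lambda/\mu$ is a pair of partitions $(\lambda,\mu)$ with $\lambda_i\ge\mu_i$ for all $i$. For a positive integer $N$, $\mathrm{SSYT}_N(\lambda/\mu)$ is the set of semistandard Young tableaux of skew shape $\lambda/\mu$ with entries in $\{1,\ldots,N\}$ (rows weakly increasing, columns strictly increasing), and $s_{\lambda/\mu}(x_1,\ldots,x_N)=\sum_{T\in \mathrm{SSYT}_N(\lambda/\mu)}\prod_{i=1}^N x_i^{\#\{i\text{'s in }T\}}$ is the skew Schur polynomial; $s_{\lambda/\mu}(1,q,\ldots,q^{N-1})$ is its principal specialization $x_i=q^{i-1}$. Cyclic sieving phenomenon: let $X$ be a finite set on which a finite cyclic group $C$ acts and let $X(q)$ be a polynomial in $q$ with nonnegative integer coefficients. For $d\in\mathbb{Z}_{>0}$ let $\omega_d$ be a primitive $d$th root of unity. The triple $(X,C,X(q))$ exhibits the cyclic sieving phenomenon if $\#X^c=X(\omega_{\mathrm{o}(c)})$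 for all $c\in C$, where $X^c$ is the set of points of $X$ fixed by $c$ and $\mathrm{o}(c)$ is the order of $c$ in $C$. *)

theory Defs
  imports
    "HOL-Library.FuncSet"
    "HOL-Algebra.Group_Action"
    "HOL-Algebra.Elementary_Groups"
    "HOL-Algebra.Multiplicative_Group"
    "HOL-Computational_Algebra.Polynomial"
    Complex_Main
begin

text \<open>Rows are indexed from 0: the value at \<open>i\<close> is the part with index \<open>i + 1\<close>.\<close>

definition partition :: "(nat \<Rightarrow> nat) \<Rightarrow> bool" where
  "partition lam \<longleftrightarrow> antimono lam \<and> finite {i. lam i \<noteq> 0}"

definition skew_partition :: "(nat \<Rightarrow> nat) \<Rightarrow> (nat \<Rightarrow> nat) \<Rightarrow> bool" where
  "skew_partition lam mu \<longleftrightarrow> partition lam \<and> partition mu \<and> (\<forall>i. mu i \<le> lam i)"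

text \<open>Cells are pairs (row, column), in English (matrix) convention, both indexed from 0.\<close>

definition skew_diagram :: "(nat \<Rightarrow> nat) \<Rightarrow> (nat \<Rightarrow> nat) \<Rightarrow> (nat \<times> nat) set" where
  "skew_diagram lam mu = {(i, j). mu i \<le> j \<and> j < lam i}"

text \<open>Tableaux are extensional functions, so that distinct elements of \<open>SSYT\<close> really are
  distinct fillings of the diagram.\<close>

definition SSYT :: "nat \<Rightarrow> (nat \<Rightarrow> nat) \<Rightarrow> (nat \<Rightarrow> nat) \<Rightarrow> (nat \<times> nat \<Rightarrow> nat) set" where
  "SSYT N lam mu =
    {T \<in> skew_diagram lam mu \<rightarrow>\<^sub>E {1..N}.
      (\<forall>i j j'. (i, j) \<in> skew_diagram lam mu \<longrightarrow> (i, j') \<in> skew_diagram lam mu \<longrightarrow>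
         j < j' \<longrightarrow> T (i, j) \<le> T (i, j')) \<and>
      (\<forall>i i' j. (i, j) \<in> skew_diagram lam mu \<longrightarrow> (i', j) \<in> skew_diagram lam mu \<longrightarrow>
         i < i' \<longrightarrow> T (i, j) < T (i', j))}"

text \<open>The skew Schur polynomial in \<open>N\<close> variables, given through its values at
  \<open>x 1, \<dots>, x N\<close> in an arbitrary commutative semiring.\<close>

definition skew_schur ::
    "nat \<Rightarrow> (nat \<Rightarrow> nat) \<Rightarrow> (nat \<Rightarrow> nat) \<Rightarrow> (nat \<Rightarrow> 'a) \<Rightarrow> 'a::comm_semiring_1" where
  "skew_schur N lam mu x =
    (\<Sum>T\<in>SSYT N lam mu. \<Prod>i=1..N. x i ^ card {c \<in> skew_diagram lam mu. T c = i})"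

definition principal_specialization ::
    "nat \<Rightarrow> (nat \<Rightarrow> nat) \<Rightarrow> (nat \<Rightarrow> nat) \<Rightarrow> nat poly" where
  "principal_specialization N lam mu =
    skew_schur N lam mu (\<lambda>i. Polynomial.monom 1 (i - 1))"

definition primitive_root_of_unity :: "nat \<Rightarrow> complex \<Rightarrow> bool" where
  "primitive_root_of_unity d w \<longleftrightarrow> d > 0 \<and> w ^ d = 1 \<and> (\<forall>j. 0 < j \<and> j < d \<longrightarrow> w ^ j \<noteq> 1)"

text \<open>Nonnegativity of the coefficients is carried by the type \<open>nat poly\<close>; the action
  \<open>act\<close> is a homomorphism from \<open>C\<close> to the group of permutations of \<open>X\<close>.\<close>

definition cyclic_sieving ::
    "'x set \<Rightarrow> 'c monoid \<Rightarrow> ('c \<Rightarrow> 'x \<Rightarrow> 'x) \<Rightarrow> nat poly \<Rightarrow> bool" where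
  "cyclic_sieving X C act f \<longleftrightarrow>
    finite X \<and> group C \<and> cyclic_group C \<and> finite (carrier C) \<and> group_action C X act \<and>
    (\<forall>c\<in>carrier C. \<forall>w. primitive_root_of_unity (group.ord C c) w \<longrightarrow>
       of_nat (card {x \<in> X. act c x = x}) = poly (map_poly of_nat f) w)"

lemma finite_skew_diagram:
  assumes "skew_partition lam mu"
  shows "finite (skew_diagram lam mu)"
proof (rule finite_subset)
  show "skew_diagram lam mu \<subseteq> (SIGMA i:{i. lam i \<noteq> 0}. {..<lam i})"
    by (auto simp: skew_diagram_def)
  show "finite (SIGMA i:{i. lam i \<noteq> 0}. {..<lam i})"
    using assms by (auto simp: skew_partition_def partition_def)
qed

lemma finite_SSYT:
  assumes "skew_partition lam mu"
  shows "finite (SSYT N lam mu)"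
proof (rule finite_subset)
  show "SSYT N lam mu \<subseteq> skew_diagram lam mu \<rightarrow>\<^sub>E {1..N}"
    by (auto simp: SSYT_def)
  show "finite (skew_diagram lam mu \<rightarrow>\<^sub>E {1..N})"
    by (intro finite_PiE finite_skew_diagram assms) auto
qed

end

theory Submission
  imports
    Defs
    "HOL-Combinatorics.Permutations"
    "HOL-Computational_Algebra.Polynomial_FPS"
    "HOL-Computational_Algebra.Primes"
begin

text \<open>Write \<open>N = k m\<close>. Row \<open>i\<close> of the two shapes becomes a pair of particles at \<open>a i = mu i - i\<close> and
\<open>b i = lam i - i\<close>, and a tableau becomes a chain of \<open>N\<close> interlacing particle configurations from
\<open>a\<close> to \<open>b\<close>; the entry \<open>l + 1\<close> is counted by the total displacement in step \<open>l\<close>. The Jacobi-Trudi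
identity (\<open>chain_sum_eq_leibniz\<close>) turns the generating function into a determinant of complete
homogeneous polynomials \<open>h\<close> evaluated at the index \<open>b i - a j\<close>.

Let \<open>w\<close> be a primitive \<open>d\<close>-th root of unity, \<open>d\<close> dividing \<open>m\<close>, and \<open>j = m / d\<close>. At \<open>1, w, w^2, ...\<close>
the polynomial of index \<open>n\<close> vanishes unless \<open>d\<close> divides \<open>n\<close>, so the determinant splits along residues
modulo \<open>d\<close>. Since \<open>lam i - mu i\<close> is divisible by \<open>d\<close>, one and the same permutation sorts the rows and
the columns by residue, hence no sign appears and the value is the number \<open>g j\<close> of chains with \<open>k j\<close>
steps in a quotient problem (\<open>quotient_leibniz\<close>).

A cyclic action with these fixed point numbers exists as soon as the numbers \<open>e j\<close> determined by
\<open>g j = (\<Sum>i dvd j. e i)\<close> are nonnegative and \<open>e j\<close> is divisible by \<open>j\<close>: take \<open>e j / j\<close> cycles of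
length \<open>j\<close>. Divisibility is a Fourier inversion, because the values \<open>g\<close> come from a polynomial
with integer coefficients. Nonnegativity holds by induction if, for each \<open>j\<close>, either \<open>g\<close> is constant
on the divisors of \<open>j\<close>, or the sum of \<open>g (j / p)\<close> over the primes \<open>p\<close> dividing \<open>j\<close> is at most \<open>g j\<close>.

To get this, let \<open>X\<close> be the set of chains counted by \<open>g j\<close>, with \<open>K = k j\<close> steps. The number
\<open>g (j / p)\<close> is the value of the generating function of \<open>X\<close> at a primitive \<open>p\<close>-th root of unity. Cut
chains into blocks of \<open>p\<close> steps. The weighted sum over all ways to fill one block between given
configurations is \<open>-1\<close>, \<open>0\<close> or \<open>1\<close>, and if it is not \<open>0\<close> then the block can be filled with equal step
sizes. So \<open>g (j / p)\<close> is at most the number of chains in \<open>X\<close> whose step sizes are constant on blocks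
of length \<open>p\<close> (\<open>norm_chain_sum_root\<close>). Such chains are rare. The Bender-Knuth involutions make the
distribution of step sizes symmetric, so that among the chains with nonconstant step sizes a
fraction of at most \<open>2 / (p^2 + 2)\<close> is constant on blocks; and if \<open>X\<close> has two elements or more,
moving one particle by one shows that the number of chains with constant step sizes is at most
\<open>2 / K\<close> times the number of the others. If \<open>j\<close> has at least two prime divisors, these bounds add up
to what is needed; for a single prime the inequality is plain inclusion. If \<open>X\<close> has at most one
element, then its generating function has absolute value \<open>card X\<close> at all roots of unity, and \<open>g\<close>
is constant on the divisors of \<open>j\<close>.\<close>

section \<open>Chains of interlacing configurations\<close>

text \<open>Configurations of \<open>L\<close> particles are functions on all of \<open>nat\<close> of which only the values below \<open>L\<close> matter;
interlacing keeps the other values fixed, which makes the sets of chains below finite without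
restricting functions to a domain.\<close>

definition decreasing :: "nat \<Rightarrow> (nat \<Rightarrow> int) \<Rightarrow> bool" where
  "decreasing L a \<longleftrightarrow> (\<forall>i. Suc i < L \<longrightarrow> a (Suc i) < a i)"

definition interlaces :: "nat \<Rightarrow> (nat \<Rightarrow> int) \<Rightarrow> (nat \<Rightarrow> int) \<Rightarrow> bool" where
  "interlaces L a c \<longleftrightarrow>
    (\<forall>i<L. a i \<le> c i) \<and> (\<forall>i. Suc i < L \<longrightarrow> c (Suc i) < a i) \<and> (\<forall>i\<ge>L. c i = a i)"

text \<open>Chains are constant after their last step for the same reason: equality of chains is equality of
functions, and cutting a chain is composition with a shift.\<close>

definition ichains :: "nat \<Rightarrow> nat \<Rightarrow> (nat \<Rightarrow> int) \<Rightarrow> (nat \<Rightarrow> int) \<Rightarrow> (nat \<Rightarrow> nat \<Rightarrow> int) set" where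
  "ichains L N a b =
    {T. T 0 = a \<and> (\<forall>l\<ge>N. T l = b) \<and> (\<forall>l<N. interlaces L (T l) (T (Suc l)))}"

definition increment :: "nat \<Rightarrow> (nat \<Rightarrow> nat \<Rightarrow> int) \<Rightarrow> nat \<Rightarrow> nat" where
  "increment L T l = nat (\<Sum>i<L. T (Suc l) i - T l i)"

definition chain_sum ::
    "nat \<Rightarrow> nat \<Rightarrow> (nat \<Rightarrow> int) \<Rightarrow> (nat \<Rightarrow> int) \<Rightarrow> (nat \<Rightarrow> complex) \<Rightarrow> complex" where
  "chain_sum L N a b x = (\<Sum>T\<in>ichains L N a b. \<Prod>l<N. x l ^ increment L T l)"

lemma decreasing_less:
  assumes "decreasing L a" "i < j" "j < L"
  shows "a j < a i"
  using assms(2,3)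
proof (induction j)
  case (Suc j)
  then have "a (Suc j) < a j" using assms(1) by (auto simp: decreasing_def)
  with Suc show ?case by (cases "i = j") auto
qed simp

lemma decreasing_interlaces:
  assumes "decreasing L a" "interlaces L a c"
  shows "decreasing L c"
  unfolding decreasing_def
proof (intro allI impI)
  fix i assume "Suc i < L"
  with assms(2) have "c (Suc i) < a i" "a i \<le> c i" by (auto simp: interlaces_def)
  then show "c (Suc i) < c i" by simp
qed

lemma ichains_mono:
  assumes T: "T \<in> ichains L N a b" and "l \<le> l'"
  shows "T l i \<le> T l' i"
proof (rule lift_Suc_mono_le[where f="\<lambda>l. T l i"])
  fix n
  show "T n i \<le> T (Suc n) i"
  proof (cases "n < N")
    case True
    then have "interlaces L (T n) (T (Suc n))" using T by (auto simp: ichains_def)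
    then show ?thesis by (cases "i < L") (auto simp: interlaces_def)
  next
    case False
    then show ?thesis using T by (auto simp: ichains_def)
  qed
qed fact

lemma ichains_outside:
  assumes T: "T \<in> ichains L N a b" and "L \<le> i"
  shows "T l i = a i"
proof (induction l)
  case (Suc l)
  show ?case
  proof (cases "l < N")
    case True
    then have "interlaces L (T l) (T (Suc l))" using T by (auto simp: ichains_def)
    then show ?thesis using Suc assms(2) by (auto simp: interlaces_def)
  next
    case False
    then show ?thesis using T Suc by (auto simp: ichains_def)
  qed
qed (use T in \<open>auto simp: ichains_def\<close>)

lemma ichains_bounds:
  assumes T: "T \<in> ichains L N a b"
  shows "a i \<le> T l i" "T l i \<le> b i"
proof -
  show "a i \<le> T l i" using ichains_mono[OF T, of 0 l i] T by (auto simp: ichains_def)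
  show "T l i \<le> b i"
    using ichains_mono[OF T, of l "max l N" i] T by (auto simp: ichains_def)
qed

lemma ichains_outside':
  assumes "T \<in> ichains L N a b" "L \<le> i"
  shows "b i = a i"
proof -
  have "T N i = b i" using assms(1) by (auto simp: ichains_def)
  with ichains_outside[OF assms, of N] show ?thesis by simp
qed

definition box :: "nat \<Rightarrow> (nat \<Rightarrow> int) \<Rightarrow> (nat \<Rightarrow> int) \<Rightarrow> (nat \<Rightarrow> int) set" where
  "box L a b = {c. (\<forall>i<L. a i \<le> c i \<and> c i \<le> b i) \<and> (\<forall>i\<ge>L. c i = a i)}"

lemma finite_box: "finite (box L a b)"
proof (rule finite_subset)
  show "box L a b \<subseteq> (\<lambda>f i. if i < L then f i else a i) ` (\<Pi>\<^sub>E i\<in>{..<L}. {a i..b i})"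
  proof
    fix c assume c: "c \<in> box L a b"
    have "c = (\<lambda>i. if i < L then (restrict c {..<L}) i else a i)"
      using c by (auto simp: box_def fun_eq_iff not_less)
    moreover have "restrict c {..<L} \<in> (\<Pi>\<^sub>E i\<in>{..<L}. {a i..b i})"
      using c by (auto simp: box_def)
    ultimately show "c \<in> (\<lambda>f i. if i < L then f i else a i) ` (\<Pi>\<^sub>E i\<in>{..<L}. {a i..b i})"
      by blast
  qed
qed (auto intro!: finite_PiE)

lemma ichains_in_box: "T \<in> ichains L N a b \<Longrightarrow> T l \<in> box L a b"
  using ichains_bounds ichains_outside by (auto simp: box_def)

lemma finite_ichains: "finite (ichains L N a b)"
proof (rule finite_subset)
  show "ichains L N a b \<subseteq>
      (\<lambda>f l. if l < N then f l else b) ` (\<Pi>\<^sub>E l\<in>{..<N}. box L a b)"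
  proof
    fix T assume T: "T \<in> ichains L N a b"
    have "T = (\<lambda>l. if l < N then (restrict T {..<N}) l else b)"
      using T by (auto simp: ichains_def fun_eq_iff not_less)
    moreover have "restrict T {..<N} \<in> (\<Pi>\<^sub>E l\<in>{..<N}. box L a b)"
      using ichains_in_box[OF T] by auto
    ultimately show "T \<in> (\<lambda>f l. if l < N then f l else b) ` (\<Pi>\<^sub>E l\<in>{..<N}. box L a b)"
      by blast
  qed
qed (auto intro!: finite_PiE finite_box)

lemma int_increment:
  assumes "T \<in> ichains L N a b"
  shows "int (increment L T l) = (\<Sum>i<L. T (Suc l) i - T l i)"
  using ichains_mono[OF assms, of l "Suc l"] by (simp add: increment_def sum_nonneg)

lemma increment_beyond: "T \<in> ichains L N a b \<Longrightarrow> N \<le> l \<Longrightarrow> increment L T l = 0"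
  by (simp add: increment_def ichains_def)

lemma sum_increment:
  assumes "T \<in> ichains L N a b"
  shows "int (\<Sum>l<N. increment L T l) = (\<Sum>i<L. b i - a i)"
proof -
  have "int (\<Sum>l<N. increment L T l) = (\<Sum>l<N. (\<Sum>i<L. T (Suc l) i) - (\<Sum>i<L. T l i))"
    by (simp add: int_increment[OF assms] sum_subtractf)
  also have "\<dots> = (\<Sum>i<L. T N i) - (\<Sum>i<L. T 0 i)"
    by (rule sum_lessThan_telescope)
  also have "\<dots> = (\<Sum>i<L. b i - a i)"
    using assms by (simp add: ichains_def sum_subtractf)
  finally show ?thesis .
qed

definition glue :: "nat \<Rightarrow> (nat \<Rightarrow> nat \<Rightarrow> int) \<times> (nat \<Rightarrow> nat \<Rightarrow> int) \<Rightarrow> nat \<Rightarrow> nat \<Rightarrow> int" where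
  "glue M p l = (if l < M then fst p l else snd p (l - M))"

text \<open>A chain with \<open>M + N\<close> steps is cut at its configuration after \<open>M\<close> steps, so that sums over chains multiply
like transfer matrices.\<close>

lemma bij_glue:
  "bij_betw (\<lambda>(c, p). glue M p)
     (SIGMA c:box L a b. ichains L M a c \<times> ichains L N c b) (ichains L (M + N) a b)"
proof (rule bij_betw_byWitness[where f'="\<lambda>T. (T M, (\<lambda>l. T (min l M)), (\<lambda>l. T (l + M)))"])
  show "\<forall>z\<in>SIGMA c:box L a b. ichains L M a c \<times> ichains L N c b.
    (\<lambda>T. (T M, (\<lambda>l. T (min l M)), (\<lambda>l. T (l + M)))) ((\<lambda>(c, p). glue M p) z) = z"
    by (auto simp: glue_def ichains_def fun_eq_iff min_def)
  show "\<forall>T\<in>ichains L (M + N) a b.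
    (\<lambda>(c, p). glue M p) (T M, (\<lambda>l. T (min l M)), (\<lambda>l. T (l + M))) = T"
    by (auto simp: glue_def fun_eq_iff min_def)
  show "(\<lambda>T. (T M, (\<lambda>l. T (min l M)), (\<lambda>l. T (l + M)))) ` ichains L (M + N) a b
     \<subseteq> (SIGMA c:box L a b. ichains L M a c \<times> ichains L N c b)"
  proof (rule image_subsetI)
    fix T assume T: "T \<in> ichains L (M + N) a b"
    then show "(T M, (\<lambda>l. T (min l M)), (\<lambda>l. T (l + M)))
        \<in> (SIGMA c:box L a b. ichains L M a c \<times> ichains L N c b)"
      using ichains_in_box[OF T] by (auto simp: ichains_def min_def)
  qed
  show "(\<lambda>(c, p). glue M p) ` (SIGMA c:box L a b. ichains L M a c \<times> ichains L N c b)
    \<subseteq> ichains L (M + N) a b"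
  proof clarify
    fix c T U assume c: "c \<in> box L a b" and T: "T \<in> ichains L M a c" and U: "U \<in> ichains L N c b"
    have "interlaces L (glue M (T, U) l) (glue M (T, U) (Suc l))" if l: "l < M + N" for l
    proof -
      consider "Suc l < M" | "Suc l = M" | "M \<le> l" by linarith
      then show ?thesis
      proof cases
        case 2
        then have "T (Suc l) = c" "U 0 = c" "interlaces L (T l) (T (Suc l))"
          using T U by (auto simp: ichains_def)
        then show ?thesis using 2 by (simp add: glue_def)
      next
        case 3
        then have "interlaces L (U (l - M)) (U (Suc (l - M)))"
          using U l by (auto simp: ichains_def)
        with 3 show ?thesis by (simp add: glue_def Suc_diff_le)
      qed (use T in \<open>auto simp: glue_def ichains_def\<close>)
    qed
    moreover have "glue M (T, U) 0 = a"
      using T U by (cases "M = 0") (auto simp: glue_def ichains_def)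
    ultimately show "glue M (T, U) \<in> ichains L (M + N) a b"
      using U by (auto simp: ichains_def glue_def)
  qed
qed

lemma increment_glue:
  assumes "T \<in> ichains L M a c" "U \<in> ichains L N c b"
  shows "increment L (glue M (T, U)) l = (if l < M then increment L T l else increment L U (l - M))"
proof -
  consider "Suc l < M" | "Suc l = M" | "M \<le> l" by linarith
  then show ?thesis
  proof cases
    case 2
    then have "T (Suc l) = c" "U 0 = c" using assms by (auto simp: ichains_def)
    then show ?thesis using 2 by (simp add: glue_def increment_def)
  qed (auto simp: glue_def increment_def Suc_diff_le)
qed

lemma sum_ichains_split:
  fixes F :: "(nat \<Rightarrow> nat \<Rightarrow> int) \<Rightarrow> 'a::comm_monoid_add"
  shows "(\<Sum>T\<in>ichains L (M + N) a b. F T) =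
    (\<Sum>c\<in>box L a b. \<Sum>T\<in>ichains L M a c. \<Sum>U\<in>ichains L N c b. F (glue M (T, U)))"
proof -
  have "(\<Sum>T\<in>ichains L (M + N) a b. F T) =
     (\<Sum>z\<in>(SIGMA c:box L a b. ichains L M a c \<times> ichains L N c b). F ((\<lambda>(c, p). glue M p) z))"
    by (rule sum.reindex_bij_betw[OF bij_glue, symmetric])
  also have "\<dots> = (\<Sum>c\<in>box L a b. \<Sum>p\<in>ichains L M a c \<times> ichains L N c b. F (glue M p))"
    by (subst sum.Sigma) (auto simp: finite_box finite_ichains case_prod_beta)
  finally show ?thesis by (simp add: sum.cartesian_product case_prod_beta)
qed

lemma chain_sum_split:
  "chain_sum L (M + N) a b x =
    (\<Sum>c\<in>box L a b. chain_sum L M a c x * chain_sum L N c b (\<lambda>l. x (M + l)))"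
  unfolding chain_sum_def sum_ichains_split sum_product
proof (intro sum.cong refl)
  fix c T U assume TU: "T \<in> ichains L M a c" "U \<in> ichains L N c b"
  have "(\<Prod>l<M + N. x l ^ increment L (glue M (T, U)) l)
    = (\<Prod>l<M. x l ^ increment L T l) * (\<Prod>l<N. x (M + l) ^ increment L U l)"
  proof -
    have "(\<Prod>l<M + N. f l) = (\<Prod>l<M. f l) * (\<Prod>l<N. f (M + l))" for f :: "nat \<Rightarrow> complex"
      by (induction N) (auto simp: algebra_simps)
    then show ?thesis by (simp add: increment_glue[OF TU])
  qed
  then show "(\<Prod>l<M + N. x l ^ increment L (glue M (T, U)) l)
    = (\<Prod>l<M. x l ^ increment L T l) * (\<Prod>l<N. x (M + l) ^ increment L U l)" .
qed

lemma ichains_0: "ichains L 0 a b = (if a = b then {\<lambda>_. a} else {})"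
  by (auto simp: ichains_def)

lemma ichains_1: "ichains L (Suc 0) a c = (if interlaces L a c then {case_nat a (\<lambda>_. c)} else {})"
proof -
  have "T \<in> ichains L (Suc 0) a c \<longleftrightarrow> interlaces L a c \<and> T = case_nat a (\<lambda>_. c)" for T
  proof -
    have "T = case_nat a (\<lambda>_. c) \<longleftrightarrow> T 0 = a \<and> (\<forall>l\<ge>Suc 0. T l = c)"
      by (auto simp: fun_eq_iff[of T] Suc_le_eq gr0_conv_Suc split: nat.splits)
    then show ?thesis by (auto simp: ichains_def)
  qed
  then show ?thesis by auto
qed

lemma chain_sum_1:
  "chain_sum L (Suc 0) a c x = (if interlaces L a c then x 0 ^ nat (\<Sum>i<L. c i - a i) else 0)"
  by (simp add: chain_sum_def ichains_1 increment_def)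

abbreviation swap :: "nat \<Rightarrow> nat \<Rightarrow> nat \<Rightarrow> nat" where
  "swap \<equiv> Transposition.transpose"

section \<open>The Jacobi-Trudi determinant\<close>

definition complete_fps :: "nat \<Rightarrow> (nat \<Rightarrow> complex) \<Rightarrow> complex fps" where
  "complete_fps N x = (\<Prod>l<N. Abs_fps (\<lambda>n. x l ^ n))"

text \<open>The complete homogeneous symmetric polynomial of degree \<open>n\<close> in \<open>x 0, ..., x (N - 1)\<close>, zero for negative
\<open>n\<close> as in the Jacobi-Trudi matrix.\<close>

definition complete_hom :: "nat \<Rightarrow> (nat \<Rightarrow> complex) \<Rightarrow> int \<Rightarrow> complex" where
  "complete_hom N x n = (if n < 0 then 0 else fps_nth (complete_fps N x) (nat n))"

text \<open>The determinant of the leading \<open>L\<close> by \<open>L\<close> block. Matrices indexed by \<open>nat\<close> let rows and columns be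
reindexed by arbitrary permutations of \<open>{..<L}\<close>.\<close>

definition leibniz :: "nat \<Rightarrow> (nat \<Rightarrow> nat \<Rightarrow> complex) \<Rightarrow> complex" where
  "leibniz L M = (\<Sum>\<pi> | \<pi> permutes {..<L}. of_int (sign \<pi>) * (\<Prod>j<L. M (\<pi> j) j))"

lemma leibniz_cong:
  "(\<And>i j. i < L \<Longrightarrow> j < L \<Longrightarrow> M i j = M' i j) \<Longrightarrow> leibniz L M = leibniz L M'"
  unfolding leibniz_def
  by (intro sum.cong refl arg_cong2[of _ _ _ _ "(*)"] prod.cong)
     (auto dest: permutes_in_image)

lemma leibniz_columns:
  assumes \<tau>: "\<tau> permutes {..<L}"
  shows "leibniz L (\<lambda>i j. M i (\<tau> j)) = of_int (sign \<tau>) * leibniz L M"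
proof -
  have "leibniz L (\<lambda>i j. M i (\<tau> j)) =
    (\<Sum>\<pi> | \<pi> permutes {..<L}. of_int (sign (\<pi> \<circ> \<tau>)) * (\<Prod>j<L. M ((\<pi> \<circ> \<tau>) j) (\<tau> j)))"
    unfolding leibniz_def by (rule sum_permutations_compose_right[OF \<tau>])
  also have "\<dots> = (\<Sum>\<pi> | \<pi> permutes {..<L}. of_int (sign \<tau>) *
      (of_int (sign \<pi>) * (\<Prod>j<L. M (\<pi> j) j)))"
  proof (intro sum.cong refl, clarify)
    fix \<pi> assume \<pi>: "\<pi> permutes {..<L}"
    have "(\<Prod>j<L. M ((\<pi> \<circ> \<tau>) j) (\<tau> j)) = (\<Prod>j<L. M (\<pi> j) j)"
      using prod.permute[OF \<tau>, of "\<lambda>j. M (\<pi> j) j"] by (simp add: o_def)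
    moreover have "sign (\<pi> \<circ> \<tau>) = sign \<pi> * sign \<tau>"
      using \<pi> \<tau> by (intro sign_compose) (auto simp: permutation_permutes)
    ultimately show "of_int (sign (\<pi> \<circ> \<tau>)) * (\<Prod>j<L. M ((\<pi> \<circ> \<tau>) j) (\<tau> j)) =
       of_int (sign \<tau>) * (of_int (sign \<pi>) * (\<Prod>j<L. M (\<pi> j) j))" by simp
  qed
  finally show ?thesis by (simp add: leibniz_def sum_distrib_left)
qed

lemma leibniz_rows:
  assumes \<tau>: "\<tau> permutes {..<L}"
  shows "leibniz L (\<lambda>i j. M (\<tau> i) j) = of_int (sign \<tau>) * leibniz L M"
proof -
  have "leibniz L M =
    (\<Sum>\<pi> | \<pi> permutes {..<L}. of_int (sign (\<tau> \<circ> \<pi>)) * (\<Prod>j<L. M ((\<tau> \<circ> \<pi>) j) j))"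
    unfolding leibniz_def by (rule setum_permutations_compose_left[OF \<tau>])
  also have "\<dots> = (\<Sum>\<pi> | \<pi> permutes {..<L}. of_int (sign \<tau>) *
      (of_int (sign \<pi>) * (\<Prod>j<L. M (\<tau> (\<pi> j)) j)))"
  proof (intro sum.cong refl, clarify)
    fix \<pi> assume \<pi>: "\<pi> permutes {..<L}"
    have "sign (\<tau> \<circ> \<pi>) = sign \<tau> * sign \<pi>"
      using \<pi> \<tau> by (intro sign_compose) (auto simp: permutation_permutes)
    then show "of_int (sign (\<tau> \<circ> \<pi>)) * (\<Prod>j<L. M ((\<tau> \<circ> \<pi>) j) j) =
       of_int (sign \<tau>) * (of_int (sign \<pi>) * (\<Prod>j<L. M (\<tau> (\<pi> j)) j))" by simp
  qed
  finally have "leibniz L M = of_int (sign \<tau>) * leibniz L (\<lambda>i j. M (\<tau> i) j)"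
    by (simp add: leibniz_def sum_distrib_left)
  moreover have "of_int (sign \<tau>) * of_int (sign \<tau>) = (1::complex)"
    by (simp flip: of_int_mult)
  ultimately show ?thesis by (simp flip: mult.assoc)
qed

lemma complete_hom_neg: "n < 0 \<Longrightarrow> complete_hom N x n = 0"
  by (simp add: complete_hom_def)

lemma complete_hom_0: "complete_hom 0 x n = (if n = 0 then 1 else 0)"
  by (auto simp: complete_hom_def complete_fps_def)

lemma complete_hom_Suc:
  assumes "b \<le> B"
  shows "complete_hom (Suc N) x (b - a) =
    (\<Sum>c\<in>{a..B}. x 0 ^ nat (c - a) * complete_hom N (\<lambda>l. x (Suc l)) (b - c))"
proof (cases "a \<le> b")
  let ?x = "\<lambda>l. x (Suc l)"
  case True
  have "complete_fps (Suc N) x = Abs_fps (\<lambda>n. x 0 ^ n) * complete_fps N ?x"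
    unfolding complete_fps_def by (rule prod.lessThan_Suc_shift)
  then have "complete_hom (Suc N) x (b - a) =
     (\<Sum>i=0..nat (b - a). x 0 ^ i * fps_nth (complete_fps N ?x) (nat (b - a) - i))"
    using True by (simp add: complete_hom_def fps_mult_nth)
  also have "\<dots> = (\<Sum>i=0..nat (b - a). x 0 ^ i * complete_hom N ?x (b - (a + int i)))"
  proof (intro sum.cong refl)
    fix i assume "i \<in> {0..nat (b - a)}"
    then have "i \<le> nat (b - a)" by simp
    then have "int i \<le> b - a" using True by linarith
    then have "a + int i \<le> b" "nat (b - (a + int i)) = nat (b - a) - i" by linarith+
    then show "x 0 ^ i * fps_nth (complete_fps N ?x) (nat (b - a) - i) =
        x 0 ^ i * complete_hom N ?x (b - (a + int i))"
      by (simp add: complete_hom_def)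
  qed
  also have "\<dots> = (\<Sum>c\<in>{a..b}. x 0 ^ nat (c - a) * complete_hom N ?x (b - c))"
    by (rule sum.reindex_bij_witness[of _ "\<lambda>c. nat (c - a)" "\<lambda>i. a + int i"])
       (use True in \<open>auto simp: le_nat_iff\<close>)
  also have "\<dots> = (\<Sum>c\<in>{a..B}. x 0 ^ nat (c - a) * complete_hom N ?x (b - c))"
    using assms by (intro sum.mono_neutral_left) (auto simp: complete_hom_neg)
  finally show ?thesis .
next
  case False
  then show ?thesis by (auto simp: complete_hom_neg intro!: sum.neutral[symmetric])
qed

lemma sum_signed_involution:
  fixes F :: "'a \<Rightarrow> complex"
  assumes "\<And>f. f \<in> A \<Longrightarrow> s f \<in> A" "\<And>f. f \<in> A \<Longrightarrow> s (s f) = f" "\<And>f. f \<in> A \<Longrightarrow> F (s f) = - F f"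
  shows "sum F A = 0"
proof -
  have "sum F A = (\<Sum>f\<in>A. F (s f))"
    by (rule sum.reindex_bij_witness[of _ s s]) (use assms in auto)
  also have "\<dots> = - sum F A" using assms by (simp add: sum_negf)
  finally show ?thesis by simp
qed

text \<open>Expanding the determinant column by column in the first variable gives one term for each function
\<open>f\<close> with \<open>f j \<ge> a j\<close>, and the functions that interlace \<open>a\<close> are the wanted ones. The others cancel:
exchange the values of \<open>f\<close> at \<open>j\<close> and \<open>j + 1\<close>, where \<open>j\<close> is the largest index with \<open>a j \<le> f (j + 1)\<close>.
The largest is needed, because the exchange can only create new violations at smaller indices, and
so it is an involution.\<close>

lemma sum_crossing_columns:
  assumes a: "decreasing L a"
  shows "(\<Sum>f | f \<in> (\<Pi>\<^sub>E j\<in>{..<L}. {a j..B}) \<and> (\<exists>j. Suc j < L \<and> a j \<le> f (Suc j)).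
    z ^ nat (\<Sum>j<L. f j - a j) * leibniz L (\<lambda>i j. h i (f j))) = 0"
    (is "sum ?F ?Bad = 0")
proof -
  define J where "J f = Max {j. Suc j < L \<and> a j \<le> f (Suc j)}" for f
  define s where "s f = f \<circ> swap (J f) (Suc (J f))" for f :: "nat \<Rightarrow> int"
  have J: "Suc (J f) < L \<and> a (J f) \<le> f (Suc (J f))"
          "\<And>j. Suc j < L \<Longrightarrow> a j \<le> f (Suc j) \<Longrightarrow> j \<le> J f" if "f \<in> ?Bad" for f
  proof -
    have fin: "finite {j. Suc j < L \<and> a j \<le> f (Suc j)}"
      by (rule finite_subset[of _ "{..<L}"]) auto
    have "J f \<in> {j. Suc j < L \<and> a j \<le> f (Suc j)}"
      unfolding J_def using that by (intro Max_in fin) auto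
    then show "Suc (J f) < L \<and> a (J f) \<le> f (Suc (J f))" by simp
    show "j \<le> J f" if "Suc j < L" "a j \<le> f (Suc j)" for j
      unfolding J_def using that by (intro Max_ge fin) auto
  qed
  have perm: "swap (J f) (Suc (J f)) permutes {..<L}" if "f \<in> ?Bad" for f
    using J(1)[OF that] by (intro permutes_swap_id) auto
  have sbad: "s f \<in> ?Bad" and Js: "J (s f) = J f" if f: "f \<in> ?Bad" for f
  proof -
    note Jf = J(1)[OF f]
    have le: "a j \<le> f j" "f j \<le> B" if "j < L" for j using f that by (auto simp: PiE_iff)
    have "a (Suc (J f)) < a (J f)" using a Jf by (auto simp: decreasing_def)
    then have "a (Suc (J f)) \<le> f (J f)" using le(1)[of "J f"] Jf by simp
    then have "s f \<in> (\<Pi>\<^sub>E j\<in>{..<L}. {a j..B})"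
      using f Jf le by (auto simp: s_def PiE_iff extensional_def transpose_def)
    moreover have b: "a (J f) \<le> s f (Suc (J f))"
      using le(1)[of "J f"] Jf by (auto simp: s_def)
    ultimately show bad: "s f \<in> ?Bad" using Jf by auto
    show "J (s f) = J f"
    proof (rule antisym)
      show "J f \<le> J (s f)" using J(2)[OF bad] Jf b by auto
      show "J (s f) \<le> J f"
      proof (rule ccontr)
        assume "\<not> J (s f) \<le> J f"
        then have "s f (Suc (J (s f))) = f (Suc (J (s f)))"
          by (simp add: s_def transpose_def)
        then show False using J(1)[OF bad] J(2)[OF f, of "J (s f)"] \<open>\<not> J (s f) \<le> J f\<close> by auto
      qed
    qed
  qed
  show ?thesis
  proof (rule sum_signed_involution[where s=s])
    fix f assume f: "f \<in> ?Bad"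
    show "s f \<in> ?Bad" by (rule sbad[OF f])
    show "s (s f) = f"
      unfolding s_def[of "s f"] Js[OF f] by (simp add: s_def o_assoc[symmetric])
    have "(\<Sum>j<L. s f j - a j) = (\<Sum>j<L. f j - a j)"
      using sum.permute[OF perm[OF f], of f] by (simp add: s_def sum_subtractf o_def)
    moreover have "leibniz L (\<lambda>i j. h i (s f j)) = - leibniz L (\<lambda>i j. h i (f j))"
      using leibniz_columns[OF perm[OF f], of "\<lambda>i j. h i (f j)"]
      by (simp add: s_def o_def sign_swap_id)
    ultimately show "?F (s f) = - ?F f" by simp
  qed
qed

lemma permutes_decreasing_id:
  assumes "\<pi> permutes {..<L}" "decreasing L a" "decreasing L b" "\<And>j. j < L \<Longrightarrow> b (\<pi> j) = a j"
  shows "\<pi> = id"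
proof (rule permutes_natset_ge)
  show "\<pi> permutes {..<L}" by fact
  have mono: "\<pi> i < \<pi> j" if "i < j" "j < L" for i j
  proof (rule ccontr)
    assume "\<not> \<pi> i < \<pi> j"
    moreover have "\<pi> i \<noteq> \<pi> j" using permutes_inj[OF assms(1)] that by (auto simp: inj_def)
    ultimately have "\<pi> j < \<pi> i" by simp
    moreover have "\<pi> i < L" using permutes_in_image[OF assms(1), of i] that by simp
    ultimately have "b (\<pi> i) < b (\<pi> j)" using decreasing_less[OF assms(3)] by blast
    then show False using decreasing_less[OF assms(2), of i j] assms(4)[of i] assms(4)[of j] that by simp
  qed
  show "\<forall>i\<in>{..<L}. i \<le> \<pi> i"
  proof
    fix i assume "i \<in> {..<L}"
    then have "i < L" by simp
    then show "i \<le> \<pi> i"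
    proof (induction i)
      case (Suc i)
      then show ?case using mono[of i "Suc i"] by simp
    qed simp
  qed
qed

text \<open>The induction removes the first step of the chain, that is, the variable \<open>x 0\<close>.\<close>

theorem chain_sum_eq_leibniz:
  assumes "decreasing L a" "decreasing L b" "\<And>i. L \<le> i \<Longrightarrow> b i = a i"
  shows "chain_sum L N a b x = leibniz L (\<lambda>i j. complete_hom N x (b i - a j))"
  using assms
proof (induction N arbitrary: a x)
  case 0
  have "chain_sum L 0 a b x = (if a = b then 1 else 0)"
    by (simp add: chain_sum_def ichains_0)
  also have "(if a = b then 1 else 0) = leibniz L (\<lambda>i j. complete_hom 0 x (b i - a j))"
  proof -
    have "leibniz L (\<lambda>i j. complete_hom 0 x (b i - a j))
      = (\<Sum>\<pi> | \<pi> permutes {..<L}. if \<pi> = id then (if a = b then 1 else 0) else 0)"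
      unfolding leibniz_def
    proof (intro sum.cong refl, clarify)
      fix \<pi> assume \<pi>: "\<pi> permutes {..<L}"
      show "of_int (sign \<pi>) * (\<Prod>j<L. complete_hom 0 x (b (\<pi> j) - a j)) =
         (if \<pi> = id then (if a = b then 1 else 0) else 0)"
      proof (cases "\<forall>j<L. b (\<pi> j) = a j")
        case True
        then have id: "\<pi> = id" using permutes_decreasing_id[OF \<pi> 0(1,2)] by auto
        moreover have "a = b"
        proof
          show "a i = b i" for i using True id 0(3)[of i] by (cases "i < L") auto
        qed
        ultimately show ?thesis by (simp add: complete_hom_0)
      next
        case False
        then have "(\<Prod>j<L. complete_hom 0 x (b (\<pi> j) - a j)) = 0"
          by (auto simp: complete_hom_0)
        then show ?thesis using False by auto
      qed
    qed
    also have "\<dots> = (if a = b then 1 else 0)"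
      by (simp add: finite_permutations permutes_id)
    finally show ?thesis by simp
  qed
  finally show ?case .
next
  case (Suc N)
  define B where "B = Max (insert 0 (b ` {..<L}))"
  have B: "b i \<le> B" if "i < L" for i using that by (auto simp: B_def)
  let ?x = "\<lambda>l. x (Suc l)"
  let ?P = "\<Pi>\<^sub>E j\<in>{..<L}. {a j..B}"
  let ?F = "\<lambda>f. x 0 ^ nat (\<Sum>j<L. f j - a j) * leibniz L (\<lambda>i j. complete_hom N ?x (b i - f j))"
  have fin: "finite ?P" by (intro finite_PiE) auto
  have "leibniz L (\<lambda>i j. complete_hom (Suc N) x (b i - a j)) =
    (\<Sum>\<pi> | \<pi> permutes {..<L}. of_int (sign \<pi>) *
       (\<Prod>j<L. \<Sum>c\<in>{a j..B}. x 0 ^ nat (c - a j) * complete_hom N ?x (b (\<pi> j) - c)))"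
    unfolding leibniz_def
    by (intro sum.cong refl arg_cong2[of _ _ _ _ "(*)"] prod.cong complete_hom_Suc B)
       (auto dest: permutes_in_image)
  also have "\<dots> = (\<Sum>\<pi> | \<pi> permutes {..<L}. \<Sum>f\<in>?P. of_int (sign \<pi>) *
       (\<Prod>j<L. x 0 ^ nat (f j - a j) * complete_hom N ?x (b (\<pi> j) - f j)))"
    by (subst prod_sum_PiE) (auto simp: sum_distrib_left)
  also have "\<dots> = (\<Sum>f\<in>?P. \<Sum>\<pi> | \<pi> permutes {..<L}. of_int (sign \<pi>) *
       (\<Prod>j<L. x 0 ^ nat (f j - a j) * complete_hom N ?x (b (\<pi> j) - f j)))"
    by (rule sum.swap)
  also have "\<dots> = sum ?F ?P"
  proof (intro sum.cong refl)
    fix f assume f: "f \<in> ?P"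
    have "(\<Prod>j<L. x 0 ^ nat (f j - a j)) = x 0 ^ (\<Sum>j<L. nat (f j - a j))"
      by (simp add: power_sum)
    also have "(\<Sum>j<L. nat (f j - a j)) = nat (\<Sum>j<L. f j - a j)"
    proof -
      have "int (\<Sum>j<L. nat (f j - a j)) = (\<Sum>j<L. f j - a j)"
        using f by (auto simp: PiE_iff intro!: sum.cong)
      then show ?thesis by linarith
    qed
    finally show "(\<Sum>\<pi> | \<pi> permutes {..<L}. of_int (sign \<pi>) *
       (\<Prod>j<L. x 0 ^ nat (f j - a j) * complete_hom N ?x (b (\<pi> j) - f j))) = ?F f"
      by (simp add: leibniz_def prod.distrib sum_distrib_left mult_ac)
  qed
  also have "\<dots> = (\<Sum>f | f \<in> ?P \<and> \<not> (\<exists>j. Suc j < L \<and> a j \<le> f (Suc j)). ?F f) +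
      (\<Sum>f | f \<in> ?P \<and> (\<exists>j. Suc j < L \<and> a j \<le> f (Suc j)). ?F f)"
    by (subst sum.union_disjoint[symmetric]) (auto simp: fin intro!: sum.cong)
  also have "(\<Sum>f | f \<in> ?P \<and> (\<exists>j. Suc j < L \<and> a j \<le> f (Suc j)). ?F f) = 0"
    by (rule sum_crossing_columns[OF Suc.prems(1)])
  also have "(\<Sum>f | f \<in> ?P \<and> \<not> (\<exists>j. Suc j < L \<and> a j \<le> f (Suc j)). ?F f) =
     (\<Sum>c | interlaces L a c \<and> (\<forall>i<L. c i \<le> B). ?F c)"
  proof (rule sum.reindex_bij_witness[of _ "\<lambda>c. restrict c {..<L}"
          "\<lambda>f i. if i < L then f i else a i"])
    fix f assume f: "f \<in> {f. f \<in> ?P \<and> \<not> (\<exists>j. Suc j < L \<and> a j \<le> f (Suc j))}"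
    show "restrict (\<lambda>i. if i < L then f i else a i) {..<L} = f"
      using f by (auto simp: fun_eq_iff PiE_iff extensional_def)
    show "(\<lambda>i. if i < L then f i else a i) \<in> {c. interlaces L a c \<and> (\<forall>i<L. c i \<le> B)}"
      using f by (force simp: interlaces_def PiE_iff)
    have "leibniz L (\<lambda>i j. complete_hom N ?x (b i - (if j < L then f j else a j)))
      = leibniz L (\<lambda>i j. complete_hom N ?x (b i - f j))" by (rule leibniz_cong) simp
    then show "?F (\<lambda>i. if i < L then f i else a i) = ?F f" by simp
  next
    fix c assume c: "c \<in> {c. interlaces L a c \<and> (\<forall>i<L. c i \<le> B)}"
    show "(\<lambda>i. if i < L then restrict c {..<L} i else a i) = c"
      using c by (auto simp: fun_eq_iff interlaces_def)
    show "restrict c {..<L} \<in> {f. f \<in> ?P \<and> \<not> (\<exists>j. Suc j < L \<and> a j \<le> f (Suc j))}"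
      using c by (auto simp: interlaces_def not_le)
  qed
  also have "\<dots> = (\<Sum>c | interlaces L a c \<and> (\<forall>i<L. c i \<le> B).
      x 0 ^ nat (\<Sum>j<L. c j - a j) * chain_sum L N c b ?x)"
  proof (intro sum.cong refl)
    fix c assume "c \<in> {c. interlaces L a c \<and> (\<forall>i<L. c i \<le> B)}"
    then have "decreasing L c" "\<And>i. L \<le> i \<Longrightarrow> b i = c i"
      using decreasing_interlaces[OF Suc.prems(1)] Suc.prems(3) by (auto simp: interlaces_def)
    then show "?F c = x 0 ^ nat (\<Sum>j<L. c j - a j) * chain_sum L N c b ?x"
      by (simp add: Suc.IH[OF _ Suc.prems(2)])
  qed
  also have "\<dots> = (\<Sum>c\<in>box L a b. chain_sum L (Suc 0) a c x * chain_sum L N c b ?x)"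
  proof -
    have "(\<Sum>c\<in>box L a b. chain_sum L (Suc 0) a c x * chain_sum L N c b ?x) =
      (\<Sum>c\<in>box L a b \<inter> {c. interlaces L a c}.
         x 0 ^ nat (\<Sum>j<L. c j - a j) * chain_sum L N c b ?x)"
      unfolding chain_sum_1 by (subst sum.inter_restrict) (auto simp: finite_box intro!: sum.cong)
    also have "\<dots> = (\<Sum>c | interlaces L a c \<and> (\<forall>i<L. c i \<le> B).
      x 0 ^ nat (\<Sum>j<L. c j - a j) * chain_sum L N c b ?x)"
    proof (rule sum.mono_neutral_left)
      show "finite {c. interlaces L a c \<and> (\<forall>i<L. c i \<le> B)}"
        by (rule finite_subset[OF _ finite_box[of L a "\<lambda>_. B"]]) (auto simp: box_def interlaces_def)
      show "box L a b \<inter> {c. interlaces L a c} \<subseteq> {c. interlaces L a c \<and> (\<forall>i<L. c i \<le> B)}"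
        using B by (force simp: box_def)
      show "\<forall>c\<in>{c. interlaces L a c \<and> (\<forall>i<L. c i \<le> B)} - box L a b \<inter> {c. interlaces L a c}.
         x 0 ^ nat (\<Sum>j<L. c j - a j) * chain_sum L N c b ?x = 0"
      proof
        fix c assume c: "c \<in> {c. interlaces L a c \<and> (\<forall>i<L. c i \<le> B)} - box L a b \<inter> {c. interlaces L a c}"
        then have "\<exists>i. \<not> c i \<le> b i" unfolding box_def interlaces_def by blast
        then obtain i where i: "\<not> c i \<le> b i" by blast
        have "T \<notin> ichains L N c b" for T
        proof
          assume "T \<in> ichains L N c b"
          from ichains_bounds[OF this] i show False using order_trans by blast
        qed
        then have "ichains L N c b = {}" by blast
        then show "x 0 ^ nat (\<Sum>j<L. c j - a j) * chain_sum L N c b ?x = 0"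
          by (simp add: chain_sum_def)
      qed
    qed
    finally show ?thesis by simp
  qed
  also have "\<dots> = chain_sum L (Suc N) a b x"
    using chain_sum_split[of L "Suc 0" N a b x] by simp
  finally show ?case by simp
qed

section \<open>Complete homogeneous polynomials at roots of unity\<close>

lemma primitive_root_power_inj:
  assumes "primitive_root_of_unity d w"
  shows "inj_on (\<lambda>l. w ^ l) {..<d}"
proof (rule inj_onI)
  have "i = j" if "i \<le> j" "j < d" "w ^ i = w ^ j" for i j
  proof (rule ccontr)
    assume "i \<noteq> j"
    have "w \<noteq> 0" using assms by (auto simp: primitive_root_of_unity_def power_0_left)
    moreover have "w ^ j = w ^ i * w ^ (j - i)"
      using that(1) by (metis le_add_diff_inverse power_add)
    ultimately have "w ^ (j - i) = 1" using that by simp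
    then show False using assms that \<open>i \<noteq> j\<close> by (auto simp: primitive_root_of_unity_def)
  qed
  then show "i = j" if "i \<in> {..<d}" "j \<in> {..<d}" "w ^ i = w ^ j" for i j
    using that by (metis lessThan_iff nat_le_linear)
qed

lemma prod_one_minus_roots_of_unity:
  assumes w: "primitive_root_of_unity d w"
  shows "(\<Prod>l<d. [:1, - (w ^ l):]) = 1 - Polynomial.monom 1 d"
proof (rule poly_eqI_degree[where A = "insert 0 ((\<lambda>l. w ^ l) ` {..<d})"])
  have d: "d > 0" "w ^ d = 1" using w by (auto simp: primitive_root_of_unity_def)
  have nz: "w ^ l \<noteq> 0" for l using d by (auto simp: power_0_left)
  show "poly (\<Prod>l<d. [:1, - (w ^ l):]) z = poly (1 - Polynomial.monom 1 d) z"
    if "z \<in> insert 0 ((\<lambda>l. w ^ l) ` {..<d})" for z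
  proof (cases "z = 0")
    case True
    then show ?thesis using d by (simp add: poly_prod poly_monom power_0_left)
  next
    case False
    then obtain l where l: "l < d" "z = w ^ l" using \<open>z \<in> _\<close> by auto
    have "(w ^ l) ^ d = 1" using d by (metis power_mult mult.commute power_one)
    moreover have "(\<Prod>i<d. 1 - w ^ l * w ^ i) = 0"
    proof (rule prod_zero)
      have "(if l = 0 then 0 else d - l) < d" "w ^ l * w ^ (if l = 0 then 0 else d - l) = 1"
        using l d by (auto simp flip: power_add)
      then show "\<exists>i\<in>{..<d}. 1 - w ^ l * w ^ i = 0" by force
    qed simp
    ultimately show ?thesis using l by (simp add: poly_prod poly_monom)
  qed
  have "0 \<notin> (\<lambda>l. w ^ l) ` {..<d}" using nz by (metis imageE)
  then have c: "card (insert 0 ((\<lambda>l. w ^ l) ` {..<d})) = Suc d"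
    using card_image[OF primitive_root_power_inj[OF w]] by simp
  have "degree [:1, - (w ^ l):] \<le> 1" for l by simp
  then have "sum (degree \<circ> (\<lambda>l. [:1, - (w ^ l):])) {..<d} \<le> (\<Sum>l<d. 1)"
    unfolding o_def by (intro sum_mono)
  then have "degree (\<Prod>l<d. [:1, - (w ^ l):]) \<le> d"
    using degree_prod_sum_le[of "{..<d}" "\<lambda>l. [:1, - (w ^ l):]"] by simp
  then show "degree (\<Prod>l<d. [:1, - (w ^ l):]) < card (insert 0 ((\<lambda>l. w ^ l) ` {..<d}))"
    using c by simp
  have "degree (1 - Polynomial.monom 1 d :: complex poly) \<le> d"
    by (intro degree_diff_le) (auto simp: degree_monom_le)
  then show "degree (1 - Polynomial.monom 1 d :: complex poly) < card (insert 0 ((\<lambda>l. w ^ l) ` {..<d}))"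
    using c by simp
qed

lemma geometric_fps_inverse:
  "Abs_fps (\<lambda>n. c ^ n) = inverse (1 - fps_const c * fps_X :: complex fps)"
proof -
  have "Abs_fps (\<lambda>n. c ^ n) * (1 - fps_const c * fps_X) = 1"
  proof (rule fps_ext)
    fix n show "fps_nth (Abs_fps (\<lambda>n. c ^ n) * (1 - fps_const c * fps_X)) n = fps_nth 1 n"
      by (cases n) (auto simp: right_diff_distrib mult.assoc[symmetric])
  qed
  then show ?thesis by (subst (asm) mult.commute) (rule fps_inverse_unique[symmetric])
qed

lemma complete_fps_root:
  assumes w: "primitive_root_of_unity d w" and "d dvd N"
  shows "complete_fps N (\<lambda>l. w ^ l) = inverse (1 - fps_X ^ d) ^ (N div d)"
proof -
  have d: "d > 0" "w ^ d = 1" using w by (auto simp: primitive_root_of_unity_def)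
  have "(\<Prod>l<d. 1 - fps_const (w ^ l) * fps_X) = fps_of_poly (\<Prod>l<d. [:1, - (w ^ l):])"
    by (simp add: fps_of_poly_prod fps_of_poly_pCons fps_const_neg[symmetric] del: fps_const_neg)
       
  also have "\<dots> = 1 - fps_X ^ d"
    by (simp add: prod_one_minus_roots_of_unity[OF w] fps_of_poly_monom)
  finally have one: "(\<Prod>l<d. Abs_fps (\<lambda>n. (w ^ l) ^ n)) = inverse (1 - fps_X ^ d)"
    by (simp add: geometric_fps_inverse inverse_prod_fps[symmetric] flip: fps_const_power del: fps_const_power)
  have "complete_fps (d * q) (\<lambda>l. w ^ l) = inverse (1 - fps_X ^ d) ^ q" for q
  proof (induction q)
    case (Suc q)
    have "(\<Prod>l<d * Suc q. f l) = (\<Prod>l<d*q. f l) * (\<Prod>l<d. f (d * q + l))"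
      for f :: "nat \<Rightarrow> complex fps"
    proof -
      have "(\<Prod>l<M + N. f l) = (\<Prod>l<M. f l) * (\<Prod>l<N. f (M + l))" for M N
        by (induction N) (auto simp: algebra_simps)
      from this[of "d * q" d] show ?thesis by (simp add: add.commute)
    qed
    moreover have "w ^ (d * q + l) = w ^ l" for l using d by (simp add: power_add power_mult)
    ultimately show ?case using Suc one by (simp add: complete_fps_def mult.commute)
  qed (simp add: complete_fps_def)
  with assms(2) d show ?thesis by (metis dvd_mult_div_cancel)
qed

lemma complete_fps_one: "complete_fps N (\<lambda>_. 1) = inverse (1 - fps_X) ^ N"
  by (simp add: complete_fps_def fps_inverse_gp' [symmetric])

text \<open>The generating series is \<open>1 / (1 - X^d)^(N / d)\<close>, the image of \<open>1 / (1 - X)^(N / d)\<close> under the substitution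
of \<open>X^d\<close> for \<open>X\<close>.\<close>

lemma complete_hom_root:
  assumes w: "primitive_root_of_unity d w" and N: "d dvd N"
  shows "complete_hom N (\<lambda>l. w ^ l) n =
    (if int d dvd n then complete_hom (N div d) (\<lambda>_. 1) (n div int d) else 0)"
proof (cases "n < 0")
  case True
  then have "n div int d < 0" using w by (auto simp: primitive_root_of_unity_def div_neg_pos_less0)
  with True show ?thesis by (simp add: complete_hom_def)
next
  case False
  have d: "d > 0" using w by (auto simp: primitive_root_of_unity_def)
  have X0: "fps_nth (fps_X ^ d :: complex fps) 0 = 0" using d by simp
  have "complete_fps N (\<lambda>l. w ^ l) = fps_compose (complete_fps (N div d) (\<lambda>_. 1)) (fps_X ^ d)"
    by (simp add: complete_fps_root[OF assms] complete_fps_one fps_compose_power[OF X0, symmetric]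
        fps_inverse_compose[OF X0] fps_compose_sub_distrib fps_X_fps_compose_startby0[OF X0])
  then have comp: "fps_nth (complete_fps N (\<lambda>l. w ^ l)) m =
    (\<Sum>i=0..m. fps_nth (complete_fps (N div d) (\<lambda>_. 1)) i * (if m = d * i then 1 else 0))" for m
    by (simp add: fps_compose_nth flip: power_mult)
  have nth: "fps_nth (complete_fps N (\<lambda>l. w ^ l)) m =
    (if d dvd m then fps_nth (complete_fps (N div d) (\<lambda>_. 1)) (m div d) else 0)" for m
  proof (cases "d dvd m")
    case True
    then obtain q where q: "m = d * q" by auto
    have "(\<Sum>i=0..m. fps_nth (complete_fps (N div d) (\<lambda>_. 1)) i * (if m = d * i then 1 else 0))
      = (\<Sum>i=0..m. if i = q then fps_nth (complete_fps (N div d) (\<lambda>_. 1)) i else 0)"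
      using d q by (intro sum.cong) auto
    also have "\<dots> = fps_nth (complete_fps (N div d) (\<lambda>_. 1)) q"
      using d q by (subst sum.delta) auto
    finally show ?thesis using comp[of m] d q by simp
  next
    case False
    then show ?thesis unfolding comp by (auto intro!: sum.neutral)
  qed
  obtain m where m: "n = int m" using False by (metis nonneg_int_cases not_less)
  have "int d dvd n \<longleftrightarrow> d dvd m" "nat (n div int d) = m div d" "\<not> n div int d < 0"
    using m by (auto simp flip: zdiv_int)
  then show ?thesis using nth[of m] m by (simp add: complete_hom_def)
qed

lemma primitive_root_exists:
  assumes "d > 0"
  obtains w where "primitive_root_of_unity d w"
proof
  show "primitive_root_of_unity d (cis (2 * pi / real d))"
    unfolding primitive_root_of_unity_def
  proof (intro conjI allI impI)
    show "cis (2 * pi / real d) ^ d = 1" using assms by (simp add: DeMoivre)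
    fix j assume j: "0 < j \<and> j < d"
    show "cis (2 * pi / real d) ^ j \<noteq> 1"
    proof
      assume "cis (2 * pi / real d) ^ j = 1"
      then have "cis (real j * (2 * pi / real d)) = 1" by (simp add: DeMoivre)
      then have "cos (real j * (2 * pi / real d)) = 1" by (simp add: complex_eq_iff)
      then obtain n :: int where "real j * (2 * pi / real d) = of_int n * 2 * pi"
        by (auto simp: cos_one_2pi_int)
      then have "real j = of_int n * real d" using assms by (simp add: field_simps)
      then have "int j = n * int d" by (metis of_int_eq_iff of_int_mult of_int_of_nat_eq)
      then have "int d dvd int j" by simp
      then have "d dvd j" by simp
      with j show False by (auto dest: dvd_imp_le)
    qed
  qed (use assms in auto)
qed

section \<open>Splitting the determinant along residue classes\<close>

lemma ex_sorting_permutation: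
  fixes c :: "nat \<Rightarrow> int"
  assumes "inj_on c {..<L}"
  obtains \<sigma> where "\<sigma> permutes {..<L}" "decreasing L (\<lambda>i. c (\<sigma> i))"
proof -
  define r where "r i = (if i < L then card {k. k < L \<and> c i < c k} else i)" for i
  have less: "r i < r j" if "c j < c i" "i < L" "j < L" for i j
  proof -
    have "{k. k < L \<and> c i < c k} \<subset> {k. k < L \<and> c j < c k}" using that by force
    then show ?thesis using that by (auto simp: r_def intro!: psubset_card_mono)
  qed
  have inj: "inj_on r {..<L}"
  proof (rule inj_onI)
    fix i j assume ij: "i \<in> {..<L}" "j \<in> {..<L}" "r i = r j"
    then have "c i = c j" using less[of i j] less[of j i] by fastforce
    then show "i = j" using ij assms by (auto dest: inj_onD)
  qed
  have "r i < L" if "i < L" for i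
  proof -
    have "{k. k < L \<and> c i < c k} \<subset> {..<L}" using that by auto
    then have "card {k. k < L \<and> c i < c k} < card {..<L}" by (intro psubset_card_mono) auto
    then show ?thesis using that by (simp add: r_def)
  qed
  then have "r ` {..<L} \<subseteq> {..<L}" by auto
  then have "bij_betw r {..<L} {..<L}"
    using inj by (simp add: bij_betw_def endo_inj_surj)
  then have r: "r permutes {..<L}" by (rule bij_imp_permutes) (simp add: r_def)
  show ?thesis
  proof (rule that)
    show p: "inv_into UNIV r permutes {..<L}" by (rule permutes_inv[OF r])
    show "decreasing L (\<lambda>i. c (inv_into UNIV r i))"
      unfolding decreasing_def
    proof (intro allI impI)
      fix i assume i: "Suc i < L"
      have L: "inv_into UNIV r i < L" "inv_into UNIV r (Suc i) < L" using i permutes_in_image[OF p] by auto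
      have ri: "r (inv_into UNIV r i) = i" "r (inv_into UNIV r (Suc i)) = Suc i"
        using permutes_inverses(1)[OF r] by auto
      then have "c (inv_into UNIV r i) \<noteq> c (inv_into UNIV r (Suc i))"
        using assms L by (metis inj_onD lessThan_iff n_not_Suc_n)
      moreover have "\<not> c (inv_into UNIV r i) < c (inv_into UNIV r (Suc i))" using less[OF _ L(2) L(1)] ri by auto
      ultimately show "c (inv_into UNIV r (Suc i)) < c (inv_into UNIV r i)" by simp
    qed
  qed
qed

text \<open>The key places the residue classes far apart on one line, in the order of their residues, and divides
distances inside a class by \<open>d\<close>. In this way a family of configurations, one for each residue
class, is again a single configuration, and no products of chain sets are needed.\<close>

lemma ex_residue_key:
  fixes S :: "int set" and d :: int
  assumes "finite S" "d > 0"
  obtains key :: "int \<Rightarrow> int" where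
    "\<And>x y. x \<in> S \<Longrightarrow> y \<in> S \<Longrightarrow> x mod d < y mod d \<Longrightarrow> key x < key y"
    "\<And>x y. x mod d = y mod d \<Longrightarrow> key y - key x = (y - x) div d"
    "\<And>x y. x mod d = y mod d \<Longrightarrow> x < y \<Longrightarrow> key x < key y"
proof
  \<comment> \<open>Larger than the difference of any two quotients, so that the residue dominates the key.\<close>
  define B where "B = 2 * Max (insert 0 ((\<lambda>x. \<bar>x div d\<bar>) ` S)) + 1"
  have B: "\<bar>x div d\<bar> * 2 < B" if "x \<in> S" for x
  proof -
    have "\<bar>x div d\<bar> \<le> Max (insert 0 ((\<lambda>x. \<bar>x div d\<bar>) ` S))"
      using assms that by (intro Max_ge) auto
    then show ?thesis by (simp add: B_def)
  qed
  let ?key = "\<lambda>x. x div d + B * (x mod d)"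
  show "?key x < ?key y" if "x \<in> S" "y \<in> S" "x mod d < y mod d" for x y
  proof -
    have "B * 1 \<le> B * (y mod d - x mod d)"
      using that B[of x] by (intro mult_left_mono) auto
    then show ?thesis using B[OF that(1)] B[OF that(2)] by (simp add: algebra_simps)
  qed
  show eq: "?key y - ?key x = (y - x) div d" if "x mod d = y mod d" for x y
  proof -
    have "d dvd y - x" using that by (metis mod_eq_dvd_iff)
    then have "y div d = (x + (y - x)) div d" by simp
    also have "\<dots> = x div d + (y - x) div d"
      using \<open>d dvd y - x\<close> by (rule div_plus_div_distrib_dvd_right)
    finally show ?thesis using that by simp
  qed
  show "?key x < ?key y" if "x mod d = y mod d" "x < y" for x y
  proof -
    have "d dvd y - x" using that by (metis mod_eq_dvd_iff)
    then have "(y - x) div d > 0" using that assms by (simp add: pos_imp_zdiv_pos_iff zdvd_imp_le)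
    with eq[OF that(1)] show ?thesis by linarith
  qed
qed

definition dilate :: "int \<Rightarrow> (int \<Rightarrow> complex) \<Rightarrow> int \<Rightarrow> complex" where
  "dilate d v n = (if d dvd n then v (n div d) else 0)"

text \<open>The two determinants agree term by term. A permutation that respects residues gives equal terms. Any
other one has a vanishing factor on the left; on the right, since the residues of \<open>a\<close> and \<open>b\<close> have
the same sum, some particle has to go to a smaller residue, hence to a far smaller key, and
\<open>v\<close> vanishes there.\<close>

lemma leibniz_dilate_key:
  fixes d :: int
  assumes \<rho>: "\<rho> permutes {..<L}" "\<And>j. j < L \<Longrightarrow> b (\<rho> j) mod d = a j mod d"
    and key1: "\<And>x y. x \<in> a ` {..<L} \<union> b ` {..<L} \<Longrightarrow> y \<in> a ` {..<L} \<union> b ` {..<L} \<Longrightarrow>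
       x mod d < y mod d \<Longrightarrow> key x < key y"
    and key2: "\<And>x y. x mod d = y mod d \<Longrightarrow> key y - key x = (y - x) div d"
    and v: "\<And>n. n < 0 \<Longrightarrow> v n = 0"
  shows "leibniz L (\<lambda>i j. dilate d v (b i - a j)) = leibniz L (\<lambda>i j. v (key (b i) - key (a j)))"
  unfolding leibniz_def
proof (intro sum.cong refl, clarify)
  fix \<pi> assume \<pi>: "\<pi> permutes {..<L}"
  have in_L: "\<pi> j < L" if "j < L" for j using permutes_in_image[OF \<pi>] that by auto
  have "(\<Prod>j<L. dilate d v (b (\<pi> j) - a j)) = (\<Prod>j<L. v (key (b (\<pi> j)) - key (a j)))"
  proof (cases "\<forall>j<L. b (\<pi> j) mod d = a j mod d")
    case True
    then have "d dvd b (\<pi> j) - a j" "key (b (\<pi> j)) - key (a j) = (b (\<pi> j) - a j) div d" if "j < L" for j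
      using that key2[of "a j" "b (\<pi> j)"] by (auto simp: mod_eq_dvd_iff[symmetric])
    then show ?thesis by (intro prod.cong refl) (auto simp: dilate_def)
  next
    case False
    then obtain j where j: "j < L" "b (\<pi> j) mod d \<noteq> a j mod d" by auto
    have s: "(\<Sum>j<L. b (\<pi> j) mod d) = (\<Sum>j<L. a j mod d)"
    proof -
      have "(\<Sum>j<L. b (\<pi> j) mod d) = (\<Sum>j<L. b j mod d)"
        using sum.permute[OF \<pi>, of "\<lambda>j. b j mod d"] by (simp add: o_def)
      also have "\<dots> = (\<Sum>j<L. b (\<rho> j) mod d)"
        using sum.permute[OF \<rho>(1), of "\<lambda>j. b j mod d"] by (simp add: o_def)
      finally show ?thesis using \<rho>(2) by simp
    qed
    \<comment> \<open>Both sides of \<open>s\<close> sum the same residues, so a difference at \<open>j\<close> forces a decrease somewhere.\<close>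
    have "\<exists>k<L. b (\<pi> k) mod d < a k mod d"
    proof (rule ccontr)
      assume "\<not> ?thesis"
      then have le: "a k mod d \<le> b (\<pi> k) mod d" if "k < L" for k using that by force
      then have "a j mod d < b (\<pi> j) mod d" using j by (simp add: order_less_le)
      then have "(\<Sum>j<L. a j mod d) < (\<Sum>j<L. b (\<pi> j) mod d)"
        using j le by (intro sum_strict_mono_ex1) auto
      with s show False by simp
    qed
    then obtain k where k: "k < L" "b (\<pi> k) mod d < a k mod d" by auto
    then have "key (b (\<pi> k)) < key (a k)" using in_L by (intro key1) auto
    then have "v (key (b (\<pi> k)) - key (a k)) = 0" by (intro v) simp
    then have "(\<Prod>j<L. v (key (b (\<pi> j)) - key (a j))) = 0" using k by (intro prod_zero) auto
    moreover have "(\<Prod>j<L. dilate d v (b (\<pi> j) - a j)) = 0"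
      using j by (intro prod_zero) (auto simp: dilate_def mod_eq_dvd_iff intro!: bexI[of _ j])
    ultimately show ?thesis by (simp only:)
  qed
  then show "of_int (sign \<pi>) * (\<Prod>j<L. dilate d v (b (\<pi> j) - a j)) =
    of_int (sign \<pi>) * (\<Prod>j<L. v (key (b (\<pi> j)) - key (a j)))" by simp
qed

lemma leibniz_sorted:
  assumes "\<sigma> permutes {..<L}" "\<tau> permutes {..<L}"
  shows "leibniz L (\<lambda>i j. h (\<tau> i) (\<sigma> j)) = of_int (sign \<tau> * sign \<sigma>) * leibniz L h"
  using leibniz_rows[OF assms(2), of "\<lambda>i j. h i (\<sigma> j)"] leibniz_columns[OF assms(1), of h]
  by simp

lemma key_inj:
  fixes d :: int
  assumes a: "decreasing L a"
    and key1: "\<And>x y. x \<in> a ` {..<L} \<Longrightarrow> y \<in> a ` {..<L} \<Longrightarrow> x mod d < y mod d \<Longrightarrow> key x < (key y :: int)"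
    and key3: "\<And>x y. x mod d = y mod d \<Longrightarrow> x < y \<Longrightarrow> key x < key y"
  shows "inj_on (\<lambda>i. key (a i)) {..<L}"
proof (rule inj_onI)
  fix i j assume ij: "i \<in> {..<L}" "j \<in> {..<L}" "key (a i) = key (a j)"
  then have "a i mod d = a j mod d" using key1[of "a i" "a j"] key1[of "a j" "a i"] by fastforce
  then have "a i = a j" using ij key3[of "a i" "a j"] key3[of "a j" "a i"] by fastforce
  then show "i = j" using ij decreasing_less[OF a, of i j] decreasing_less[OF a, of j i]
    by (metis lessThan_iff less_irrefl linorder_neqE_nat)
qed

text \<open>Particle \<open>i\<close> stays in its residue class, so the permutation that sorts the keys of \<open>a\<close> also sorts
those of \<open>b\<close>, and its sign enters twice. The quotient is independent of \<open>v\<close>: it serves for all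
numbers of variables and, taking \<open>v\<close> itself to be a dilation, for all multiples of \<open>d\<close>.\<close>

lemma quotient_leibniz:
  fixes d :: int
  assumes a: "decreasing L a" and b: "decreasing L b" and d: "d > 0"
    and dvd: "\<And>i. i < L \<Longrightarrow> d dvd b i - a i"
  obtains \<alpha> \<beta> where "decreasing L \<alpha>" "decreasing L \<beta>" "\<And>i. L \<le> i \<Longrightarrow> \<beta> i = \<alpha> i"
    "\<And>v. (\<And>n. n < 0 \<Longrightarrow> v n = 0) \<Longrightarrow>
      leibniz L (\<lambda>i j. dilate d v (b i - a j)) = leibniz L (\<lambda>i j. v (\<beta> i - \<alpha> j))"
proof -
  let ?S = "a ` {..<L} \<union> b ` {..<L}"
  obtain key :: "int \<Rightarrow> int" where
    key1: "\<And>x y. x \<in> ?S \<Longrightarrow> y \<in> ?S \<Longrightarrow> x mod d < y mod d \<Longrightarrow> key x < key y" and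
    key2: "\<And>x y. x mod d = y mod d \<Longrightarrow> key y - key x = (y - x) div d" and
    key3: "\<And>x y. x mod d = y mod d \<Longrightarrow> x < y \<Longrightarrow> key x < key y"
    using ex_residue_key[of ?S d] d by blast
  have inj: "inj_on (\<lambda>i. key (a i)) {..<L}" by (rule key_inj[OF a key1 key3]) auto
  obtain \<sigma> where \<sigma>: "\<sigma> permutes {..<L}" and dec: "decreasing L (\<lambda>i. key (a (\<sigma> i)))"
    using ex_sorting_permutation[OF inj] by blast
  have in_L: "\<sigma> i < L" if "i < L" for i using permutes_in_image[OF \<sigma>] that by auto
  have mod: "b i mod d = a i mod d" if "i < L" for i using dvd[OF that] by (simp add: mod_eq_dvd_iff)
  have dec': "decreasing L (\<lambda>i. key (b (\<sigma> i)))"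
    unfolding decreasing_def
  proof (intro allI impI)
    fix i assume i: "Suc i < L"
    define x y where "x = \<sigma> i" and "y = \<sigma> (Suc i)"
    have xy: "x < L" "y < L" using in_L i by (auto simp: x_def y_def)
    have less: "key (a y) < key (a x)" using dec i by (auto simp: decreasing_def x_def y_def)
    show "key (b (\<sigma> (Suc i))) < key (b (\<sigma> i))"
    proof (cases "a y mod d = a x mod d")
      case True
      then have "\<not> a x \<le> a y" using less key3[of "a x" "a y"] by (cases "a x = a y") auto
      then have "x < y" using decreasing_less[OF a, of y x] xy by (cases x y rule: linorder_cases) auto
      then have "b y < b x" using decreasing_less[OF b] xy by auto
      then show ?thesis using True mod xy by (auto simp: x_def y_def intro!: key3)
    next
      case False
      then have "a y mod d < a x mod d" using less key1[of "a x" "a y"] xy by fastforce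
      then show ?thesis using mod xy by (auto simp: x_def y_def intro!: key1)
    qed
  qed
  define \<alpha> where "\<alpha> i = (if i < L then key (a (\<sigma> i)) else 0)" for i
  define \<beta> where "\<beta> i = (if i < L then key (b (\<sigma> i)) else 0)" for i
  show ?thesis
  proof (rule that)
    show "decreasing L \<alpha>" "decreasing L \<beta>" using dec dec' by (auto simp: decreasing_def \<alpha>_def \<beta>_def)
    show "\<beta> i = \<alpha> i" if "L \<le> i" for i using that by (simp add: \<alpha>_def \<beta>_def)
    fix v :: "int \<Rightarrow> complex" assume v: "\<And>n. n < 0 \<Longrightarrow> v n = 0"
    have "leibniz L (\<lambda>i j. v (\<beta> i - \<alpha> j)) = leibniz L (\<lambda>i j. v (key (b (\<sigma> i)) - key (a (\<sigma> j))))"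
      by (rule leibniz_cong) (simp add: \<alpha>_def \<beta>_def)
    also have "\<dots> = leibniz L (\<lambda>i j. v (key (b i) - key (a j)))"
      using leibniz_sorted[OF \<sigma> \<sigma>, of "\<lambda>i j. v (key (b i) - key (a j))"] by simp
    also have "\<dots> = leibniz L (\<lambda>i j. dilate d v (b i - a j))"
      by (rule leibniz_dilate_key[symmetric, where \<rho> = id])
         (use mod key1 key2 v in \<open>auto simp: permutes_id\<close>)
    finally show "leibniz L (\<lambda>i j. dilate d v (b i - a j)) = leibniz L (\<lambda>i j. v (\<beta> i - \<alpha> j))" by simp
  qed
qed

text \<open>Without the congruence the rows and columns are sorted by different permutations, and a sign survives.
With one variable the sorted determinant only decides whether two configurations interlace.\<close>

lemma ribbon_leibniz:
  fixes d :: int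
  assumes a: "decreasing L a" and b: "decreasing L b" and d: "d > 0"
  obtains e :: int where "e \<in> {-1, 0, 1}" "e \<noteq> 0 \<Longrightarrow> d dvd (\<Sum>i<L. b i - a i)"
    "leibniz L (\<lambda>i j. dilate d (complete_hom 1 (\<lambda>_. 1)) (b i - a j)) = of_int e"
proof (cases "\<exists>\<rho>. \<rho> permutes {..<L} \<and> (\<forall>j<L. b (\<rho> j) mod d = a j mod d)")
  case False
  have "leibniz L (\<lambda>i j. dilate d (complete_hom 1 (\<lambda>_. 1)) (b i - a j)) = 0"
    unfolding leibniz_def
  proof (intro sum.neutral ballI, clarify)
    fix \<pi> assume "\<pi> permutes {..<L}"
    then obtain j where j: "j < L" "b (\<pi> j) mod d \<noteq> a j mod d" using False by auto
    have "(\<Prod>j<L. dilate d (complete_hom 1 (\<lambda>_. 1)) (b (\<pi> j) - a j)) = 0"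
      using j by (intro prod_zero) (auto simp: dilate_def mod_eq_dvd_iff intro!: bexI[of _ j])
    then show "of_int (sign \<pi>) * (\<Prod>j<L. dilate d (complete_hom 1 (\<lambda>_. 1)) (b (\<pi> j) - a j)) = 0"
      by simp
  qed
  then show ?thesis using that[of 0] by simp
next
  case True
  then obtain \<rho> where \<rho>: "\<rho> permutes {..<L}" "\<And>j. j < L \<Longrightarrow> b (\<rho> j) mod d = a j mod d" by auto
  let ?S = "a ` {..<L} \<union> b ` {..<L}"
  obtain key :: "int \<Rightarrow> int" where
    key1: "\<And>x y. x \<in> ?S \<Longrightarrow> y \<in> ?S \<Longrightarrow> x mod d < y mod d \<Longrightarrow> key x < key y" and
    key2: "\<And>x y. x mod d = y mod d \<Longrightarrow> key y - key x = (y - x) div d" and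
    key3: "\<And>x y. x mod d = y mod d \<Longrightarrow> x < y \<Longrightarrow> key x < key y"
    using ex_residue_key[of ?S d] d by blast
  have inja: "inj_on (\<lambda>i. key (a i)) {..<L}" by (rule key_inj[OF a key1 key3]) auto
  have injb: "inj_on (\<lambda>i. key (b i)) {..<L}" by (rule key_inj[OF b key1 key3]) auto
  obtain \<sigma> where \<sigma>: "\<sigma> permutes {..<L}" and deca: "decreasing L (\<lambda>i. key (a (\<sigma> i)))"
    using ex_sorting_permutation[OF inja] by blast
  obtain \<tau> where \<tau>: "\<tau> permutes {..<L}" and decb: "decreasing L (\<lambda>i. key (b (\<tau> i)))"
    using ex_sorting_permutation[OF injb] by blast
  define \<alpha> where "\<alpha> i = (if i < L then key (a (\<sigma> i)) else 0)" for i
  define \<beta> where "\<beta> i = (if i < L then key (b (\<tau> i)) else 0)" for i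
  let ?v = "complete_hom 1 (\<lambda>_. 1)"
  have "leibniz L (\<lambda>i j. dilate d ?v (b i - a j)) = leibniz L (\<lambda>i j. ?v (key (b i) - key (a j)))"
    by (rule leibniz_dilate_key[where \<rho> = \<rho>])
       (use \<rho> key1 key2 in \<open>auto simp: complete_hom_neg\<close>)
  moreover have "leibniz L (\<lambda>i j. ?v (\<beta> i - \<alpha> j)) =
    of_int (sign \<tau> * sign \<sigma>) * leibniz L (\<lambda>i j. ?v (key (b i) - key (a j)))"
    by (subst leibniz_sorted[OF \<sigma> \<tau>, of "\<lambda>i j. ?v (key (b i) - key (a j))", symmetric])
       (rule leibniz_cong, simp add: \<alpha>_def \<beta>_def)
  moreover have "leibniz L (\<lambda>i j. ?v (\<beta> i - \<alpha> j)) = chain_sum L 1 \<alpha> \<beta> (\<lambda>_. 1)"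
    using deca decb by (intro chain_sum_eq_leibniz[symmetric]) (auto simp: decreasing_def \<alpha>_def \<beta>_def)
  moreover have "chain_sum L 1 \<alpha> \<beta> (\<lambda>_. 1) = of_int (if interlaces L \<alpha> \<beta> then 1 else 0)"
    by (simp add: chain_sum_1)
  moreover have "sign \<tau> * sign \<sigma> * (sign \<tau> * sign \<sigma>) = 1"
    by (simp add: mult_ac)
  then have "of_int (sign \<tau> * sign \<sigma>) * of_int (sign \<tau> * sign \<sigma>) = (1::complex)"
    by (metis of_int_1 of_int_mult)
  ultimately have "leibniz L (\<lambda>i j. dilate d ?v (b i - a j)) =
     of_int (sign \<tau> * sign \<sigma>) * of_int (if interlaces L \<alpha> \<beta> then 1 else 0)"
    by (metis mult.assoc mult_1)
  also have "\<dots> = of_int (sign \<tau> * sign \<sigma> * (if interlaces L \<alpha> \<beta> then 1 else 0))" by simp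
  finally have eq: "leibniz L (\<lambda>i j. dilate d ?v (b i - a j)) =
     of_int (sign \<tau> * sign \<sigma> * (if interlaces L \<alpha> \<beta> then 1 else 0))" .
  have "(\<Sum>i<L. b i) = (\<Sum>i<L. b (\<rho> i))"
    using sum.permute[OF \<rho>(1), of b] by (simp add: o_def)
  then have "(\<Sum>i<L. b i - a i) = (\<Sum>i<L. b (\<rho> i) - a i)" by (simp add: sum_subtractf)
  moreover have "d dvd (\<Sum>i<L. b (\<rho> i) - a i)"
    using \<rho>(2) by (intro dvd_sum) (auto simp: mod_eq_dvd_iff)
  ultimately have "d dvd (\<Sum>i<L. b i - a i)" by simp
  moreover have "sign \<tau> * sign \<sigma> * (if interlaces L \<alpha> \<beta> then 1 else 0) \<in> {-1, 0, 1}"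
    by (cases \<tau> rule: sign_cases; cases \<sigma> rule: sign_cases) auto
  ultimately show ?thesis using eq that by blast
qed

section \<open>Bender-Knuth involutions\<close>

text \<open>If the configurations before and after are kept, the particles of the configuration in between move
independently, each in its own interval from \<open>site_min\<close> to \<open>site_max\<close>.\<close>

definition site_min :: "nat \<Rightarrow> (nat \<Rightarrow> int) \<Rightarrow> (nat \<Rightarrow> int) \<Rightarrow> nat \<Rightarrow> int" where
  "site_min L A C i = (if Suc i < L then max (A i) (C (Suc i) + 1) else A i)"

definition site_max :: "(nat \<Rightarrow> int) \<Rightarrow> (nat \<Rightarrow> int) \<Rightarrow> nat \<Rightarrow> int" where
  "site_max A C i = (case i of 0 \<Rightarrow> C i | Suc k \<Rightarrow> min (C i) (A k - 1))"

lemma between_iff: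
  "interlaces L A M \<and> interlaces L M C \<longleftrightarrow>
    (\<forall>i<L. site_min L A C i \<le> M i \<and> M i \<le> site_max A C i) \<and>
    (\<forall>i\<ge>L. M i = A i \<and> C i = A i)" (is "?l \<longleftrightarrow> ?r")
proof
  assume l: ?l
  show ?r
  proof (intro conjI allI impI)
    fix i assume "i < L"
    with l show "site_min L A C i \<le> M i" by (auto simp: site_min_def interlaces_def)
    show "M i \<le> site_max A C i"
      using l \<open>i < L\<close> by (cases i) (auto simp: site_max_def interlaces_def)
  qed (use l in \<open>auto simp: interlaces_def\<close>)
next
  assume r: ?r
  show ?l
    unfolding interlaces_def
  proof (intro conjI allI impI)
    fix i assume "i < L"
    then have "site_min L A C i \<le> M i" "M i \<le> site_max A C i" using r by auto
    then show "A i \<le> M i" "M i \<le> C i"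
      by (auto simp: site_min_def site_max_def split: if_splits nat.splits)
  next
    fix i assume i: "Suc i < L"
    then have "site_min L A C i \<le> M i" "M (Suc i) \<le> site_max A C (Suc i)" using r by auto
    with i show "M (Suc i) < A i" "C (Suc i) < M i" by (auto simp: site_min_def site_max_def)
  qed (use r in auto)
qed

text \<open>The bounds pair up: \<open>max (A i) (C (i + 1) + 1) + min (C (i + 1)) (A i - 1) = A i + C (i + 1)\<close>.\<close>

lemma sum_site_bounds:
  "(\<Sum>i<L. site_min L A C i + site_max A C i) = (\<Sum>i<L. A i + C i)"
proof (cases L)
  case (Suc n)
  have "(\<Sum>i<L. site_min L A C i) = (\<Sum>i<n. max (A i) (C (Suc i) + 1)) + A n"
    using Suc by (simp add: site_min_def)
  moreover have "(\<Sum>i<L. site_max A C i) = C 0 + (\<Sum>i<n. min (C (Suc i)) (A i - 1))"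
    unfolding Suc by (subst sum.lessThan_Suc_shift) (simp add: site_max_def)
  moreover have "(\<Sum>i<n. max (A i) (C (Suc i) + 1)) + (\<Sum>i<n. min (C (Suc i)) (A i - 1)) =
      (\<Sum>i<n. A i + C (Suc i))"
    unfolding sum.distrib[symmetric] by (intro sum.cong refl) auto
  moreover have "(\<Sum>i<L. A i + C i) = (\<Sum>i<n. A i + C (Suc i)) + A n + C 0"
  proof -
    have "(\<Sum>i<L. C i) = C 0 + (\<Sum>i<n. C (Suc i))" unfolding Suc by (rule sum.lessThan_Suc_shift)
    moreover have "(\<Sum>i<L. A i) = (\<Sum>i<n. A i) + A n" unfolding Suc by simp
    ultimately show ?thesis by (simp add: sum.distrib)
  qed
  ultimately show ?thesis by (simp add: sum.distrib)
qed simp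

lemma ichains_site_bounds:
  assumes "T \<in> ichains L N a b" "Suc l < N" "i < L"
  shows "site_min L (T l) (T (Suc (Suc l))) i \<le> T (Suc l) i"
    "T (Suc l) i \<le> site_max (T l) (T (Suc (Suc l))) i"
proof -
  have "interlaces L (T l) (T (Suc l)) \<and> interlaces L (T (Suc l)) (T (Suc (Suc l)))"
    using assms by (auto simp: ichains_def)
  then show "site_min L (T l) (T (Suc (Suc l))) i \<le> T (Suc l) i"
    "T (Suc l) i \<le> site_max (T l) (T (Suc (Suc l))) i"
    using assms(3) unfolding between_iff by auto
qed

lemma ichains_update:
  assumes T: "T \<in> ichains L N a b" and l: "Suc l < N"
    and M: "\<And>i. i < L \<Longrightarrow> site_min L (T l) (T (Suc (Suc l))) i \<le> M i"
      "\<And>i. i < L \<Longrightarrow> M i \<le> site_max (T l) (T (Suc (Suc l))) i"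
      "\<And>i. L \<le> i \<Longrightarrow> M i = T (Suc l) i"
  shows "T(Suc l := M) \<in> ichains L N a b"
proof -
  have "M i = T l i \<and> T (Suc (Suc l)) i = T l i" if "L \<le> i" for i
    using M(3)[OF that] ichains_outside[OF T that] by simp
  then have "interlaces L (T l) M \<and> interlaces L M (T (Suc (Suc l)))"
    unfolding between_iff using M(1,2) by auto
  then have "interlaces L ((T(Suc l := M)) k) ((T(Suc l := M)) (Suc k))" if "k < N" for k
    using T that by (auto simp: ichains_def)
  then show ?thesis using T l by (auto simp: ichains_def)
qed

lemma increment_update:
  assumes "k \<noteq> l" "k \<noteq> Suc l"
  shows "increment L (T(Suc l := M)) k = increment L T k"
  using assms by (simp add: increment_def)

lemma int_increment_update:
  assumes "T(Suc l := M) \<in> ichains L N a b"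
  shows "int (increment L (T(Suc l := M)) l) = (\<Sum>i<L. M i - T l i)"
    "int (increment L (T(Suc l := M)) (Suc l)) = (\<Sum>i<L. T (Suc (Suc l)) i - M i)"
  using int_increment[OF assms] by simp_all

definition permutable :: "nat \<Rightarrow> nat \<Rightarrow> (nat \<Rightarrow> int) \<Rightarrow> (nat \<Rightarrow> int) \<Rightarrow> (nat \<Rightarrow> nat) \<Rightarrow> bool" where
  "permutable L N a b \<pi> \<longleftrightarrow> (\<exists>\<Phi>. bij_betw \<Phi> (ichains L N a b) (ichains L N a b) \<and>
     (\<forall>T\<in>ichains L N a b. increment L (\<Phi> T) = increment L T \<circ> \<pi>))"

lemma permutable_id: "permutable L N a b id"
  unfolding permutable_def by (intro exI[of _ id]) simp

lemma permutable_comp: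
  assumes "permutable L N a b \<pi>" "permutable L N a b \<sigma>"
  shows "permutable L N a b (\<pi> \<circ> \<sigma>)"
proof -
  obtain \<Phi> \<Psi> where
    \<Phi>: "bij_betw \<Phi> (ichains L N a b) (ichains L N a b)"
      "\<And>T. T \<in> ichains L N a b \<Longrightarrow> increment L (\<Phi> T) = increment L T \<circ> \<pi>" and
    \<Psi>: "bij_betw \<Psi> (ichains L N a b) (ichains L N a b)"
      "\<And>T. T \<in> ichains L N a b \<Longrightarrow> increment L (\<Psi> T) = increment L T \<circ> \<sigma>"
    using assms unfolding permutable_def by blast
  show ?thesis
    unfolding permutable_def
  proof (intro exI[of _ "\<Psi> \<circ> \<Phi>"] conjI ballI)
    show "bij_betw (\<Psi> \<circ> \<Phi>) (ichains L N a b) (ichains L N a b)"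
      using \<Phi> \<Psi> bij_betw_trans by blast
    fix T assume T: "T \<in> ichains L N a b"
    then have "\<Phi> T \<in> ichains L N a b" using \<Phi> bij_betwE by blast
    then show "increment L ((\<Psi> \<circ> \<Phi>) T) = increment L T \<circ> (\<pi> \<circ> \<sigma>)"
      by (simp add: \<Psi>(2) \<Phi>(2)[OF T] o_assoc)
  qed
qed

text \<open>Reflecting every particle in its interval exchanges the sizes of the two adjacent steps, by
\<open>sum_site_bounds\<close>.\<close>

lemma bender_knuth:
  assumes l: "Suc l < N"
  shows "permutable L N a b (swap l (Suc l))"
proof -
  define R where "R T = (\<lambda>i. if i < L
     then site_min L (T l) (T (Suc (Suc l))) i + site_max (T l) (T (Suc (Suc l))) i - T (Suc l) i
     else T (Suc l) i)" for T :: "nat \<Rightarrow> nat \<Rightarrow> int"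
  define \<Phi> where "\<Phi> T = T(Suc l := R T)" for T
  have inX: "\<Phi> T \<in> ichains L N a b" if T: "T \<in> ichains L N a b" for T
    unfolding \<Phi>_def using ichains_site_bounds[OF T l]
    by (intro ichains_update[OF T l]) (auto simp: R_def)
  have inv: "\<Phi> (\<Phi> T) = T" for T
    by (auto simp: \<Phi>_def R_def fun_eq_iff)
  have inc: "increment L (\<Phi> T) = increment L T \<circ> swap l (Suc l)"
    if T: "T \<in> ichains L N a b" for T
  proof -
    have X: "T(Suc l := R T) \<in> ichains L N a b" using inX[OF T] by (simp add: \<Phi>_def)
    have s: "(\<Sum>i<L. R T i) =
      (\<Sum>i<L. T l i) + (\<Sum>i<L. T (Suc (Suc l)) i) - (\<Sum>i<L. T (Suc l) i)"
      using sum_site_bounds[of L "T l" "T (Suc (Suc l))"]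
      by (simp add: R_def sum_subtractf sum.distrib)
    have "int (increment L (\<Phi> T) l) = int (increment L T (Suc l))"
      using int_increment_update(1)[OF X] int_increment[OF T, of "Suc l"] s
      by (simp add: \<Phi>_def sum_subtractf)
    moreover have "int (increment L (\<Phi> T) (Suc l)) = int (increment L T l)"
      using int_increment_update(2)[OF X] int_increment[OF T, of "l"] s
      by (simp add: \<Phi>_def sum_subtractf)
    moreover have "increment L (\<Phi> T) k = increment L T k" if "k \<noteq> l" "k \<noteq> Suc l" for k
      unfolding \<Phi>_def by (rule increment_update[OF that])
    ultimately show ?thesis by (auto simp: fun_eq_iff transpose_def)
  qed
  have "bij_betw \<Phi> (ichains L N a b) (ichains L N a b)"
    by (rule bij_betw_byWitness[where f' = \<Phi>]) (use inX inv in auto)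
  with inc show ?thesis unfolding permutable_def by blast
qed

lemma permutable_transpose:
  assumes "u < N" "v < N"
  shows "permutable L N a b (swap u v)"
proof -
  have less: "permutable L N a b (swap u v)" if "u < v" "v < N" for u v
    using that
  proof (induction v)
    case (Suc v)
    show ?case
    proof (cases "u = v")
      case True
      then show ?thesis using bender_knuth Suc.prems by simp
    next
      case False
      have "swap u (Suc v) = swap v (Suc v) \<circ>
          swap u v \<circ> swap v (Suc v)"
        using False Suc.prems by (auto simp: fun_eq_iff transpose_def)
      moreover have "permutable L N a b (swap u v)" using Suc False by auto
      moreover have "permutable L N a b (swap v (Suc v))"
        using bender_knuth Suc.prems by simp
      ultimately show ?thesis using permutable_comp by metis
    qed
  qed simp
  show ?thesis
  proof (cases u v rule: linorder_cases)
    case equal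
    then show ?thesis using permutable_id by simp
  next
    case greater
    then show ?thesis using less[of v u] assms by (simp add: transpose_commute)
  qed (use less assms in auto)
qed

lemma increment_permute:
  assumes "\<pi> permutes {..<N}"
  shows "permutable L N a b \<pi>"
  using assms finite_lessThan[of N]
proof (induction \<pi> rule: permutes_induct)
  case id
  then show ?case by (rule permutable_id)
next
  case (swap u v p)
  then show ?case by (intro permutable_comp permutable_transpose) auto
qed

lemma card_increment_permute:
  assumes "\<pi> permutes {..<N}"
  shows "card {T \<in> ichains L N a b. increment L T = \<nu> \<circ> \<pi>} =
    card {T \<in> ichains L N a b. increment L T = \<nu>}"
proof -
  obtain \<Phi> where
    \<Phi>: "bij_betw \<Phi> (ichains L N a b) (ichains L N a b)"
      "\<And>T. T \<in> ichains L N a b \<Longrightarrow> increment L (\<Phi> T) = increment L T \<circ> \<pi>"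
    using increment_permute[OF assms] unfolding permutable_def by blast
  have "bij_betw \<Phi> {T \<in> ichains L N a b. increment L T = \<nu>} {T \<in> ichains L N a b. increment L T = \<nu> \<circ> \<pi>}"
  proof (rule bij_betw_subset[OF \<Phi>(1)])
    show "\<Phi> ` {T \<in> ichains L N a b. increment L T = \<nu>} = {T \<in> ichains L N a b. increment L T = \<nu> \<circ> \<pi>}"
    proof (intro equalityI subsetI)
      fix U assume "U \<in> \<Phi> ` {T \<in> ichains L N a b. increment L T = \<nu>}"
      then show "U \<in> {T \<in> ichains L N a b. increment L T = \<nu> \<circ> \<pi>}"
        using \<Phi>(2) bij_betwE[OF \<Phi>(1)] by auto
    next
      fix U assume U: "U \<in> {T \<in> ichains L N a b. increment L T = \<nu> \<circ> \<pi>}"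
      then obtain T where T: "T \<in> ichains L N a b" "U = \<Phi> T"
        using \<Phi>(1) by (auto simp: bij_betw_def)
      then have eq: "increment L T \<circ> \<pi> = \<nu> \<circ> \<pi>" using \<Phi>(2)[of T] U by simp
      have "increment L T = \<nu>"
      proof
        fix k
        obtain j where "k = \<pi> j" using permutes_surj[OF assms] by (rule surjE)
        then show "increment L T k = \<nu> k" using fun_cong[OF eq, of j] by simp
      qed
      then show "U \<in> \<Phi> ` {T \<in> ichains L N a b. increment L T = \<nu>}" using T by blast
    qed
  qed auto
  then show ?thesis by (rule bij_betw_same_card[symmetric])
qed

lemma ex_permutation_pair:
  assumes "u < N" "v < N" "u \<noteq> v"
  obtains \<pi> where "\<pi> permutes {..<N}" "\<pi> 0 = u" "\<pi> (Suc 0) = (v::nat)"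
proof
  \<comment> \<open>The preimage of \<open>v\<close> under the exchange of \<open>0\<close> and \<open>u\<close>.\<close>
  let ?w = "swap 0 u v"
  have N: "Suc 0 < N" "0 < N" using assms by auto
  have w: "?w < N" "?w \<noteq> 0" using assms by (auto simp: transpose_def)
  show "swap 0 u \<circ> swap (Suc 0) ?w permutes {..<N}"
    using assms N w by (intro permutes_compose permutes_swap_id) auto
  show "(swap 0 u \<circ> swap (Suc 0) ?w) 0 = u"
    using w by (simp add: transpose_apply_other)
  show "(swap 0 u \<circ> swap (Suc 0) ?w) (Suc 0) = v"
    by simp
qed

section \<open>Local moves\<close>

text \<open>Chains are ordered pointwise. Where a chain takes its minimal value, that value is forced by one of
two neighbouring sites, and following these neighbours leads to the fixed ends of the chain; hence
a chain that is minimal at every site lies below every other chain. Dually for maximal values.\<close>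

lemma rigid_chain_unique:
  assumes T: "T \<in> ichains L N a b" and U: "U \<in> ichains L N a b"
    and rigid: "\<And>l i. Suc l < N \<Longrightarrow> i < L \<Longrightarrow>
      \<not> site_min L (T l) (T (Suc (Suc l))) i < site_max (T l) (T (Suc (Suc l))) i"
  shows "T = U"
proof -
  have ends: "T 0 = U 0" "\<And>l. l \<ge> N \<Longrightarrow> T l = U l" using T U by (auto simp: ichains_def)
  have eq: "T (Suc l) i = site_min L (T l) (T (Suc (Suc l))) i"
    "T (Suc l) i = site_max (T l) (T (Suc (Suc l))) i" if "Suc l < N" "i < L" for l i
    using rigid[OF that] ichains_site_bounds[OF T that] by auto
  have step: "interlaces L (U l) (U (Suc l))" if "l < N" for l using U that by (auto simp: ichains_def)
  have lower: "T l i \<le> U l i" if "l \<le> N" "i < L" for l i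
    using that
  proof (induction "l + 2 * (L - i)" arbitrary: l i rule: less_induct)
    case less
    show ?case
    proof (cases "l = 0 \<or> l = N")
      case True
      then show ?thesis using ends by auto
    next
      case False
      then obtain k where k: "l = Suc k" "Suc k < N" using less.prems by (cases l) auto
      note U1 = step[of k] and U2 = step[of "Suc k"]
      consider "T l i = T k i" | "Suc i < L" "T l i = T (Suc (Suc k)) (Suc i) + 1"
        using eq(1)[OF k(2) less.prems(2)] k by (auto simp: site_min_def max_def split: if_splits)
      then show ?thesis
      proof cases
        case 1
        have "T k i \<le> U k i" using less k by simp
        also have "\<dots> \<le> U l i" using U1 k less.prems by (auto simp: interlaces_def)
        finally show ?thesis using 1 by simp
      next
        case 2
        have "T (Suc (Suc k)) (Suc i) \<le> U (Suc (Suc k)) (Suc i)" using less k 2 by simp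
        also have "\<dots> < U l i" using U2 k 2 by (auto simp: interlaces_def)
        finally show ?thesis using 2 by simp
      qed
    qed
  qed
  have upper: "U l i \<le> T l i" if "l \<le> N" "i < L" for l i
    using that
  proof (induction "N - l + 2 * i" arbitrary: l i rule: less_induct)
    case less
    show ?case
    proof (cases "l = 0 \<or> l = N")
      case True
      then show ?thesis using ends by auto
    next
      case False
      then obtain k where k: "l = Suc k" "Suc k < N" using less.prems by (cases l) auto
      note U1 = step[of k] and U2 = step[of "Suc k"]
      consider "T l i = T (Suc (Suc k)) i" | j where "i = Suc j" "T l i = T k j - 1"
        using eq(2)[OF k(2) less.prems(2)] k by (auto simp: site_max_def min_def split: if_splits nat.splits)
      then show ?thesis
      proof cases
        case 1
        have "U l i \<le> U (Suc (Suc k)) i" using U2 k less.prems by (auto simp: interlaces_def)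
        also have "\<dots> \<le> T (Suc (Suc k)) i" using less k by simp
        finally show ?thesis using 1 by simp
      next
        case 2
        have "U l i < U k j" using U1 k 2 less.prems by (auto simp: interlaces_def)
        also have "U k j \<le> T k j" using less k 2 by simp
        finally show ?thesis using 2 by simp
      qed
    qed
  qed
  show ?thesis
  proof (intro ext)
    fix l i
    consider "L \<le> i" | "N \<le> l" | "i < L" "l \<le> N" by linarith
    then show "T l i = U l i"
    proof cases
      case 1
      then show ?thesis using ichains_outside[OF T 1] ichains_outside[OF U 1] by simp
    next
      case 3
      then show ?thesis using lower upper by (intro antisym)
    qed (use ends in auto)
  qed
qed

lemma flexible_site:
  assumes T: "T \<in> ichains L N a b" and "card (ichains L N a b) \<ge> 2"
  obtains l i where "Suc l < N" "i < L"
    "site_min L (T l) (T (Suc (Suc l))) i < site_max (T l) (T (Suc (Suc l))) i"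
proof -
  have "\<exists>U\<in>ichains L N a b. U \<noteq> T"
  proof (rule ccontr)
    assume "\<not> ?thesis"
    then have "ichains L N a b \<subseteq> {T}" by auto
    then have "card (ichains L N a b) \<le> card {T}" by (intro card_mono) auto
    with assms(2) show False by simp
  qed
  then show ?thesis using rigid_chain_unique[OF T] that by metis
qed

text \<open>Take a chain with the smallest sum of squares of its increments. If two increments differed by two or
more, they could be made adjacent by \<open>increment_permute\<close>; the larger one coming first, some particle
between the two steps is then above the midpoint of its interval, and lowering it by one decreases
the sum of squares. So the increments differ by at most one, and the divisibility leaves only equal
ones.\<close>

lemma ex_balanced_chain:
  assumes ne: "ichains L N a b \<noteq> {}" and N: "N > 0" and dvd: "int N dvd (\<Sum>i<L. b i - a i)"
  obtains T c where "T \<in> ichains L N a b" "\<And>l. l < N \<Longrightarrow> increment L T l = c"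
proof -
  let ?q = "\<lambda>T. \<Sum>l<N. (increment L T l)\<^sup>2"
  obtain T0 where "T0 \<in> ichains L N a b" using ne by blast
  then obtain T where T: "T \<in> ichains L N a b" and min: "\<And>U. U \<in> ichains L N a b \<Longrightarrow> ?q T \<le> ?q U"
    using ex_has_least_nat[of "\<lambda>T. T \<in> ichains L N a b" T0 ?q] by blast
  have le: "increment L T u \<le> Suc (increment L T v)" if uv: "u < N" "v < N" for u v
  proof (rule ccontr)
    assume "\<not> ?thesis"
    then have gap: "increment L T v + 2 \<le> increment L T u" by simp
    then have "u \<noteq> v" by auto
    then obtain \<pi> where \<pi>: "\<pi> permutes {..<N}" "\<pi> 0 = u" "\<pi> (Suc 0) = v"
      using ex_permutation_pair uv by blast
    have N1: "Suc 0 < N" using uv \<open>u \<noteq> v\<close> by auto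
    obtain S where S: "S \<in> ichains L N a b" "increment L S = increment L T \<circ> \<pi>"
      using increment_permute[OF \<pi>(1)] T unfolding permutable_def by (meson bij_betwE)
    have qS: "?q S = ?q T"
      using sum.permute[OF \<pi>(1), of "\<lambda>l. (increment L T l)\<^sup>2"] S(2) by (simp add: o_def)
    have i01: "increment L S (Suc 0) + 2 \<le> increment L S 0" using gap S(2) \<pi> by simp
    let ?lo = "site_min L (S 0) (S (Suc (Suc 0)))" and ?hi = "site_max (S 0) (S (Suc (Suc 0)))"
    have "(\<Sum>i<L. ?lo i + ?hi i) < (\<Sum>i<L. 2 * S (Suc 0) i)"
    proof -
      have "int (increment L S (Suc 0)) < int (increment L S 0)" using i01 by simp
      then show ?thesis
        unfolding int_increment[OF S(1)] sum_site_bounds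
        by (simp add: sum_subtractf sum.distrib sum_distrib_left[symmetric])
    qed
    then obtain i where i: "i < L" "?lo i + ?hi i < 2 * S (Suc 0) i"
      by (metis (no_types, lifting) lessThan_iff not_le sum_mono)
    note bnd = ichains_site_bounds[OF S(1) N1]
    define M where "M = (S (Suc 0))(i := S (Suc 0) i - 1)"
    have X: "S(Suc 0 := M) \<in> ichains L N a b" (is "?S' \<in> _")
    proof (rule ichains_update[OF S(1) N1])
      fix k assume "k < L"
      then show "?lo k \<le> M k" "M k \<le> ?hi k" using bnd[of k] i by (auto simp: M_def)
    qed (use i in \<open>auto simp: M_def\<close>)
    have sM: "(\<Sum>i<L. M i) = (\<Sum>i<L. S (Suc 0) i) - 1"
      using i(1) by (simp add: M_def sum.remove[of "{..<L}" i])
    have "int (increment L ?S' 0) = int (increment L S 0) - 1"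
      using int_increment_update(1)[OF X] int_increment[OF S(1), of 0] sM by (simp add: sum_subtractf)
    moreover have "int (increment L ?S' (Suc 0)) = int (increment L S (Suc 0)) + 1"
      using int_increment_update(2)[OF X] int_increment[OF S(1), of "Suc 0"] sM by (simp add: sum_subtractf)
    ultimately have new: "increment L ?S' 0 + 1 = increment L S 0"
      "increment L ?S' (Suc 0) = increment L S (Suc 0) + 1" by linarith+
    have split: "?q Z = (increment L Z 0)\<^sup>2 + (increment L Z (Suc 0))\<^sup>2 +
        (\<Sum>l\<in>{..<N} - {0, Suc 0}. (increment L Z l)\<^sup>2)" for Z
      using N1 by (simp add: sum.remove[of "{..<N}" 0] sum.remove[of "{..<N} - {0}" "Suc 0"]
          Diff_insert2[symmetric] insert_commute)
    have rest: "(\<Sum>l\<in>{..<N} - {0, Suc 0}. (increment L ?S' l)\<^sup>2) =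
        (\<Sum>l\<in>{..<N} - {0, Suc 0}. (increment L S l)\<^sup>2)"
      by (intro sum.cong refl) (auto simp: increment_update)
    have "(increment L ?S' 0)\<^sup>2 + (increment L ?S' (Suc 0))\<^sup>2
      < (increment L S 0)\<^sup>2 + (increment L S (Suc 0))\<^sup>2"
    proof -
      have "x\<^sup>2 + (y + 1)\<^sup>2 < (x + 1)\<^sup>2 + y\<^sup>2" if "y + 2 \<le> x + 1" for x y :: nat
        using that by (simp add: power2_eq_square algebra_simps)
      from this[of "increment L S (Suc 0)" "increment L ?S' 0"] new i01 show ?thesis by simp
    qed
    then have "?q ?S' < ?q S" unfolding split[of ?S'] split[of S] rest by simp
    with qS min[OF X] show False by simp
  qed
  define m where "m = Min (increment L T ` {..<N})"
  have "m \<in> increment L T ` {..<N}" unfolding m_def using N by (intro Min_in) auto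
  then obtain u where u: "u < N" "m = increment L T u" by auto
  have ge: "m \<le> increment L T l" if "l < N" for l unfolding m_def using that by auto
  have val: "increment L T l = m + (if increment L T l = Suc m then 1 else 0)" if "l < N" for l
    using ge[OF that] le[OF that u(1)] u(2) by auto
  let ?H = "{l. l < N \<and> increment L T l = Suc m}"
  have "(\<Sum>l<N. increment L T l) = (\<Sum>l<N. m + (if increment L T l = Suc m then 1 else 0))"
    using val by (intro sum.cong) auto
  also have "\<dots> = N * m + card ?H"
    by (simp add: sum.distrib sum.If_cases lessThan_def Int_def)
  finally have s: "(\<Sum>l<N. increment L T l) = N * m + card ?H" .
  have "int N dvd int (N * m + card ?H)" using dvd sum_increment[OF T] s by simp
  then have "N dvd N * m + card ?H" by (simp only: int_dvd_int_iff)
  then have "N dvd card ?H" using dvd_add_right_iff[of N "N * m" "card ?H"] by (simp only: dvd_triv_left)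
  moreover have "card ?H < N"
  proof -
    have "u \<notin> ?H" using u(2) by simp
    then have "?H \<subset> {..<N}" using u(1) by blast
    then have "card ?H < card {..<N}" by (intro psubset_card_mono) auto
    then show ?thesis by simp
  qed
  ultimately have "card ?H = 0" by (auto dest: dvd_imp_le)
  then have "?H = {}" by simp
  then have "increment L T l = m" if "l < N" for l using val[OF that] that by auto
  with T that show ?thesis by blast
qed

section \<open>Values at roots of unity and block constant chains\<close>

lemma ichains_decreasing:
  assumes T: "T \<in> ichains L N a b" and a: "decreasing L a" and "l \<le> N"
  shows "decreasing L (T l)"
  using \<open>l \<le> N\<close>
proof (induction l)
  case 0
  then show ?case using T a by (auto simp: ichains_def)
next
  case (Suc l)
  then have "decreasing L (T l)" "interlaces L (T l) (T (Suc l))" using T by (auto simp: ichains_def)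
  then show ?case by (rule decreasing_interlaces)
qed

definition block_chains :: "nat \<Rightarrow> nat \<Rightarrow> nat \<Rightarrow> (nat \<Rightarrow> int) \<Rightarrow> (nat \<Rightarrow> int) \<Rightarrow> (nat \<Rightarrow> nat \<Rightarrow> int) set" where
  "block_chains L p N a b =
    {T \<in> ichains L N a b. \<forall>l<N. increment L T l = increment L T (p * (l div p))}"

lemma finite_block_chains: "finite (block_chains L p N a b)"
  unfolding block_chains_def using finite_ichains by auto

lemma card_block_chains_split:
  assumes p: "p > 0"
  shows "card (block_chains L p (p + N) a b) =
    (\<Sum>c\<in>box L a b. card (block_chains L p p a c) * card (block_chains L p N c b))"
proof -
  let ?P = "\<lambda>N T. \<forall>l<N. increment L T l = increment L T (p * (l div p))"
  have card: "card (block_chains L p N a b) = (\<Sum>T\<in>ichains L N a b. if ?P N T then 1 else 0)" for N a b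
    by (simp add: block_chains_def sum.If_cases finite_ichains Int_def conj_commute)
  have iff: "?P (p + N) (glue p (T, U)) \<longleftrightarrow> ?P p T \<and> ?P N U"
    if TU: "T \<in> ichains L p a c" "U \<in> ichains L N c b" for T U c
  proof
    assume l: "?P (p + N) (glue p (T, U))"
    show "?P p T \<and> ?P N U"
    proof (intro conjI allI impI)
      fix l assume "l < p"
      then show "increment L T l = increment L T (p * (l div p))"
        using l[rule_format, of l] p by (simp add: increment_glue[OF TU])
    next
      fix l assume "l < N"
      then show "increment L U l = increment L U (p * (l div p))"
        using l[rule_format, of "p + l"] p by (simp add: increment_glue[OF TU])
    qed
  next
    assume r: "?P p T \<and> ?P N U"
    show "?P (p + N) (glue p (T, U))"
    proof (intro allI impI)
      fix l assume l: "l < p + N"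
      show "increment L (glue p (T, U)) l = increment L (glue p (T, U)) (p * (l div p))"
      proof (cases "l < p")
        case True
        then have "increment L T l = increment L T (p * (l div p))" using r by blast
        with True p show ?thesis by (simp add: increment_glue[OF TU])
      next
        case False
        define k where "k = l - p"
        have k: "l = p + k" "k < N" using False l by (auto simp: k_def)
        then have "increment L U k = increment L U (p * (k div p))" using r by blast
        with k p show ?thesis by (simp add: increment_glue[OF TU])
      qed
    qed
  qed
  have conj: "(if A \<and> B then 1 else 0) = (if A then 1 else 0) * (if B then 1 else (0::nat))" for A B
    by auto
  have ind: "(if ?P (p + N) (glue p (T, U)) then 1 else 0) =
      (if ?P p T then 1 else 0) * (if ?P N U then 1 else (0::nat))"
    if "T \<in> ichains L p a c" "U \<in> ichains L N c b" for T U c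
    unfolding iff[OF that] by (rule conj)
  have "card (block_chains L p (p + N) a b) =
    (\<Sum>c\<in>box L a b. \<Sum>T\<in>ichains L p a c. \<Sum>U\<in>ichains L N c b.
       if ?P (p + N) (glue p (T, U)) then 1 else 0)"
    unfolding card sum_ichains_split ..
  also have "\<dots> = (\<Sum>c\<in>box L a b. \<Sum>T\<in>ichains L p a c. \<Sum>U\<in>ichains L N c b.
       (if ?P p T then 1 else 0) * (if ?P N U then 1 else 0))"
    by (intro sum.cong refl ind)
  also have "\<dots> = (\<Sum>c\<in>box L a b. (\<Sum>T\<in>ichains L p a c. if ?P p T then 1 else 0) *
       (\<Sum>U\<in>ichains L N c b. if ?P N U then 1 else 0))"
    unfolding sum_product ..
  also have "\<dots> = (\<Sum>c\<in>box L a b. card (block_chains L p p a c) * card (block_chains L p N c b))"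
    unfolding card ..
  finally show ?thesis .
qed

text \<open>The left side is \<open>0\<close> or \<open>1\<close> by \<open>ribbon_leibniz\<close>. If it is \<open>1\<close>, then there is a chain at all, and \<open>p\<close>
divides the total displacement, so there is a balanced chain.\<close>

lemma norm_chain_sum_block:
  assumes w: "primitive_root_of_unity p w" and a: "decreasing L a" and c: "decreasing L c"
    and out: "\<And>i. L \<le> i \<Longrightarrow> c i = a i"
  shows "cmod (chain_sum L p a c (\<lambda>l. w ^ l)) \<le> card (block_chains L p p a c)"
proof -
  have p: "p > 0" using w by (simp add: primitive_root_of_unity_def)
  then have pi: "int p > 0" by simp
  obtain e :: int where e: "e \<in> {-1, 0, 1}" "e \<noteq> 0 \<Longrightarrow> int p dvd (\<Sum>i<L. c i - a i)"
    "leibniz L (\<lambda>i j. dilate (int p) (complete_hom 1 (\<lambda>_. 1)) (c i - a j)) = of_int e"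
    using ribbon_leibniz[OF a c pi] by blast
  have "complete_hom p (\<lambda>l. w ^ l) n = dilate (int p) (complete_hom 1 (\<lambda>_. 1)) n" for n
    using complete_hom_root[OF w, of p n] p by (simp add: dilate_def)
  then have eq: "chain_sum L p a c (\<lambda>l. w ^ l) = of_int e"
    using chain_sum_eq_leibniz[OF a c out] e(3) by simp
  show ?thesis
  proof (cases "e = 0")
    case False
    then have "ichains L p a c \<noteq> {}" using eq by (auto simp: chain_sum_def)
    then obtain T k where T: "T \<in> ichains L p a c" "\<And>l. l < p \<Longrightarrow> increment L T l = k"
      using ex_balanced_chain[OF _ p] e(2) False by blast
    then have "T \<in> block_chains L p p a c" using p by (simp add: block_chains_def)
    then have "card (block_chains L p p a c) \<noteq> 0"
      using finite_block_chains[of L p p a c] by (auto simp: card_eq_0_iff)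
    then have "1 \<le> real (card (block_chains L p p a c))" by linarith
    moreover have "cmod (of_int e) = 1" using e(1) False by auto
    ultimately show ?thesis using eq by simp
  qed (use eq in simp)
qed

lemma norm_chain_sum_root:
  assumes w: "primitive_root_of_unity p w" and "p dvd N" and a: "decreasing L a" and b: "decreasing L b"
    and out: "\<And>i. L \<le> i \<Longrightarrow> b i = a i"
  shows "cmod (chain_sum L N a b (\<lambda>l. w ^ l)) \<le> card (block_chains L p N a b)"
proof -
  let ?w = "\<lambda>l. w ^ l"
  have p: "p > 0" and wp: "w ^ p = 1" using w by (auto simp: primitive_root_of_unity_def)
  obtain q where N: "N = p * q" using \<open>p dvd N\<close> by auto
  have "cmod (chain_sum L (p * q) a b ?w) \<le> card (block_chains L p (p * q) a b)"
    using a out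
  proof (induction q arbitrary: a)
    case 0
    then show ?case by (simp add: chain_sum_def ichains_0 block_chains_def)
  next
    case (Suc q)
    have shift: "w ^ (p + l) = w ^ l" for l using wp by (simp add: power_add)
    have "cmod (chain_sum L (p * Suc q) a b ?w) \<le>
      (\<Sum>c\<in>box L a b. cmod (chain_sum L p a c ?w) * cmod (chain_sum L (p * q) c b ?w))"
      using norm_sum[of "\<lambda>c. chain_sum L p a c ?w * chain_sum L (p * q) c b ?w" "box L a b"]
      by (simp add: chain_sum_split shift norm_mult)
    also have "\<dots> \<le> (\<Sum>c\<in>box L a b. real (card (block_chains L p p a c)) * real (card (block_chains L p (p * q) c b)))"
    proof (rule sum_mono)
      fix c assume c: "c \<in> box L a b"
      show "cmod (chain_sum L p a c ?w) * cmod (chain_sum L (p * q) c b ?w) \<le>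
        real (card (block_chains L p p a c)) * real (card (block_chains L p (p * q) c b))"
      proof (cases "ichains L p a c = {}")
        case True
        then show ?thesis by (simp add: chain_sum_def)
      next
        case False
        then obtain T where T: "T \<in> ichains L p a c" by blast
        then have "T p = c" by (simp add: ichains_def)
        then have dc: "decreasing L c" using ichains_decreasing[OF T Suc.prems(1), of p] by simp
        have oc: "c i = a i" if "L \<le> i" for i using c that by (simp add: box_def)
        show ?thesis
          using oc Suc.prems(2)
          by (intro mult_mono norm_chain_sum_block[OF w Suc.prems(1) dc] Suc.IH[OF dc]) auto
      qed
    qed
    also have "\<dots> = card (block_chains L p (p * Suc q) a b)"
      by (simp add: card_block_chains_split[OF p])
    finally show ?case .
  qed
  with N show ?thesis by simp
qed

definition constant_chains :: "nat \<Rightarrow> nat \<Rightarrow> (nat \<Rightarrow> int) \<Rightarrow> (nat \<Rightarrow> int) \<Rightarrow> (nat \<Rightarrow> nat \<Rightarrow> int) set" where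
  "constant_chains L N a b = {T \<in> ichains L N a b. \<forall>l<N. increment L T l = increment L T 0}"

lemma constant_chainsD:
  "T \<in> constant_chains L N a b \<Longrightarrow> l < N \<Longrightarrow> increment L T l = increment L T 0"
  unfolding constant_chains_def by blast

lemma block_chainsD:
  "T \<in> block_chains L p N a b \<Longrightarrow> l < N \<Longrightarrow> increment L T l = increment L T (p * (l div p))"
  unfolding block_chains_def by blast

lemma block_chains_subset: "block_chains L p N a b \<subseteq> ichains L N a b"
  unfolding block_chains_def by blast

lemma constant_subset_block: "constant_chains L N a b \<subseteq> block_chains L p N a b"
proof
  fix T assume T: "T \<in> constant_chains L N a b"
  have "increment L T l = increment L T (p * (l div p))" if "l < N" for l
  proof -
    have "p * (l div p) < N" using that by (metis le_less_trans times_div_less_eq_dividend)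
    then show ?thesis by (metis constant_chainsD[OF T] that)
  qed
  then show "T \<in> block_chains L p N a b"
    using T unfolding constant_chains_def block_chains_def by blast
qed

section \<open>Most chains are not block constant\<close>

text \<open>Exchanging one entry of block \<open>b\<close>, the first block that differs from its successor, with one entry of the
next block leaves exactly these two blocks nonconstant. So the position of the blocks can be read
off, and their values up to exchange; for \<open>p = 2\<close> the exchange is a real ambiguity, which the
order of the two values resolves.\<close>

lemma block_swap_recover:
  fixes \<nu> \<nu>' :: "nat \<Rightarrow> nat"
  assumes p: "p \<ge> 2"
    and x: "\<And>w. w < p \<Longrightarrow> \<nu> (p * b + w) = x" and y: "\<And>w. w < p \<Longrightarrow> \<nu> (p * Suc b + w) = y"
    and xy: "x \<noteq> y" and below: "\<And>k w. k < b \<Longrightarrow> w < p \<Longrightarrow> \<nu> (p * k + w) = \<nu> (p * k)"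
    and x': "\<And>w. w < p \<Longrightarrow> \<nu>' (p * b' + w) = x'" and y': "\<And>w. w < p \<Longrightarrow> \<nu>' (p * Suc b' + w) = y'"
    and xy': "x' \<noteq> y'" and below': "\<And>k w. k < b' \<Longrightarrow> w < p \<Longrightarrow> \<nu>' (p * k + w) = \<nu>' (p * k)"
    and tag: "x < y \<longleftrightarrow> x' < y'" and u: "u < p" "v < p" "u' < p" "v' < p"
    and eq: "\<nu> \<circ> swap (p * b + u) (p * Suc b + v) =
      \<nu>' \<circ> swap (p * b' + u') (p * Suc b' + v')"
  shows "b = b'" "u = u'" "v = v'"
proof -
  define \<mu> where "\<mu> = \<nu> \<circ> swap (p * b + u) (p * Suc b + v)"
  have \<mu>': "\<mu> = \<nu>' \<circ> swap (p * b' + u') (p * Suc b' + v')" using eq by (simp add: \<mu>_def)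
  have F1: "\<mu> (p * b + w) = (if w = u then y else x)" if "w < p" for w
    using that u x[OF that] y[OF u(2)] by (auto simp: \<mu>_def transpose_def)
  have F2: "\<mu> (p * Suc b + w) = (if w = v then x else y)" if "w < p" for w
    using that u y[OF that] x[OF u(1)] by (auto simp: \<mu>_def transpose_def)
  have G1: "\<mu> (p * b' + w) = (if w = u' then y' else x')" if "w < p" for w
    using that u x'[OF that] y'[OF u(4)] by (auto simp: \<mu>' transpose_def)
  have G2: "\<mu> (p * Suc b' + w) = (if w = v' then x' else y')" if "w < p" for w
    using that u y'[OF that] x'[OF u(3)] by (auto simp: \<mu>' transpose_def)
  have blk: "p * k + w < p * b" if "k < b" "w < p" for k w b
  proof -
    have "p * k + w < p * Suc k" using that by simp
    also have "\<dots> \<le> p * b" using that by (intro mult_le_mono2) simp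
    finally show ?thesis .
  qed
  have F3: "\<mu> (p * k + w) = \<nu> (p * k)" if "k < b" "w < p" for k w
    using blk[OF that] below[OF that] by (simp add: \<mu>_def transpose_apply_other)
  have G3: "\<mu> (p * k + w) = \<nu>' (p * k)" if "k < b'" "w < p" for k w
    using blk[OF that] below'[OF that] by (simp add: \<mu>' transpose_apply_other)
  define w where "w = (if u = 0 then 1 else 0 :: nat)"
  have w: "w < p" "w \<noteq> u" using p by (auto simp: w_def)
  define w' where "w' = (if u' = 0 then 1 else 0 :: nat)"
  have w': "w' < p" "w' \<noteq> u'" using p by (auto simp: w'_def)
  have "\<not> b < b'"
  proof
    assume "b < b'"
    then have "\<mu> (p * b + u) = \<mu> (p * b + w)" using G3 u w by simp
    then show False using F1[OF u(1)] F1[OF w(1)] w xy by simp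
  qed
  moreover have "\<not> b' < b"
  proof
    assume "b' < b"
    then have "\<mu> (p * b' + u') = \<mu> (p * b' + w')" using F3 u w' by simp
    then show False using G1[OF u(3)] G1[OF w'(1)] w' xy' by simp
  qed
  ultimately show b: "b = b'" by simp
  have "x = x'"
  proof (rule ccontr)
    assume "x \<noteq> x'"
    then have "x = y'" using F1[OF w(1)] G1[OF w(1)] w b by (auto split: if_splits)
    moreover have "y = x'" using F1[OF u(1)] G1[OF u(1)] b \<open>x = y'\<close> xy by (auto split: if_splits)
    ultimately show False using tag xy by auto
  qed
  show "u = u'" using F1[OF u(1)] G1[OF u(1)] b xy \<open>x = x'\<close> by (auto split: if_splits)
  then have "y = y'" using F1[OF u(1)] G1[OF u(1)] b by simp
  show "v = v'" using F2[OF u(2)] G2[OF u(2)] b xy \<open>y = y'\<close> by (auto split: if_splits)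
qed

text \<open>From each block constant chain with nonconstant increments, the \<open>p * p\<close> exchanges of
\<open>block_swap_recover\<close>, realized by the bijections of \<open>increment_permute\<close>, lead to chains that are not
block constant. Remembering one bit makes this injective, whence the factor \<open>2\<close>.\<close>

lemma card_block_chains_le:
  assumes p: "p \<ge> 2" and "p dvd N"
  shows "p * p * card (block_chains L p N a b - constant_chains L N a b) \<le>
    2 * card (ichains L N a b - block_chains L p N a b)"
proof -
  let ?X = "ichains L N a b" and ?S = "block_chains L p N a b" and ?K = "constant_chains L N a b"
  obtain q where N: "N = p * q" using \<open>p dvd N\<close> by auto
  define \<Phi> where "\<Phi> \<pi> = (SOME \<Phi>. bij_betw \<Phi> ?X ?X \<and> (\<forall>T\<in>?X. increment L (\<Phi> T) = increment L T \<circ> \<pi>))" for \<pi>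
  have \<Phi>: "bij_betw (\<Phi> \<pi>) ?X ?X \<and> (\<forall>T\<in>?X. increment L (\<Phi> \<pi> T) = increment L T \<circ> \<pi>)"
    if "\<pi> permutes {..<N}" for \<pi>
    using increment_permute[OF that] unfolding \<Phi>_def permutable_def by (rule someI_ex)
  define B where "B T = (LEAST k. Suc k < q \<and> increment L T (p * k) \<noteq> increment L T (p * Suc k))" for T
  define \<tau> where "\<tau> T u v = swap (p * B T + u) (p * Suc (B T) + v)" for T u v
  have block: "increment L T (p * k + w) = increment L T (p * k)" if "T \<in> ?S" "k < q" "w < p" for T k w
  proof -
    have "p * k + w < p * Suc k" using that by simp
    also have "\<dots> \<le> N" using that unfolding N by (intro mult_le_mono2) simp
    finally have "increment L T (p * k + w) = increment L T (p * ((p * k + w) div p))"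
      using block_chainsD[OF that(1)] by blast
    moreover have "(p * k + w) div p = k" using that by simp
    ultimately show ?thesis by (simp only:)
  qed
  have B: "Suc (B T) < q" "increment L T (p * B T) \<noteq> increment L T (p * Suc (B T))"
    if T: "T \<in> ?S - ?K" for T
  proof -
    have "\<exists>k. Suc k < q \<and> increment L T (p * k) \<noteq> increment L T (p * Suc k)"
    proof (rule ccontr)
      assume "\<not> ?thesis"
      then have step: "increment L T (p * Suc k) = increment L T (p * k)" if "Suc k < q" for k
        using that by metis
      have const: "increment L T (p * k) = increment L T 0" if "k < q" for k
        using that
      proof (induction k)
        case (Suc k)
        have "increment L T (p * Suc k) = increment L T (p * k)" by (rule step[OF Suc.prems])
        also have "\<dots> = increment L T 0" using Suc by simp
        finally show ?case .
      qed simp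
      have "increment L T l = increment L T 0" if "l < N" for l
      proof -
        have "l div p < q" using that unfolding N by (simp add: less_mult_imp_div_less mult.commute)
        then show ?thesis
          using block_chainsD[of T L p N a b l] that T const by (metis DiffD1)
      qed
      then have "T \<in> ?K" using T unfolding constant_chains_def block_chains_def by blast
      then show False using T by blast
    qed
    from LeastI_ex[OF this] show "Suc (B T) < q" "increment L T (p * B T) \<noteq> increment L T (p * Suc (B T))"
      unfolding B_def by auto
  qed
  have perm: "\<tau> T u v permutes {..<N}" if "T \<in> ?S - ?K" "u < p" "v < p" for T u v
  proof -
    have "p * B T + u < p * Suc (B T)" "p * Suc (B T) + v < p * Suc (Suc (B T))" using that by auto
    moreover have "p * Suc (Suc (B T)) \<le> N" unfolding N using B(1)[OF that(1)] by (intro mult_le_mono2) simp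
    ultimately show ?thesis unfolding \<tau>_def by (intro permutes_swap_id) auto
  qed
  define f where "f = (\<lambda>(T, u, v). (\<Phi> (\<tau> T u v) T, increment L T (p * B T) < increment L T (p * Suc (B T))))"
  let ?D = "(?S - ?K) \<times> {..<p} \<times> {..<p}"
  have SX: "T \<in> ?X" if "T \<in> ?S" for T using that by (simp add: block_chains_def)
  have inc: "increment L (\<Phi> (\<tau> T u v) T) = increment L T \<circ> \<tau> T u v" "\<Phi> (\<tau> T u v) T \<in> ?X"
    if "T \<in> ?S - ?K" "u < p" "v < p" for T u v
    using \<Phi>[OF perm[OF that]] SX that bij_betwE by blast+
  have "inj_on f ?D"
  proof (rule inj_onI)
    fix z z' assume z: "z \<in> ?D" and z': "z' \<in> ?D" and eq: "f z = f z'"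
    obtain T u v where zz: "z = (T, u, v)" by (cases z) auto
    obtain T' u' v' where zz': "z' = (T', u', v')" by (cases z') auto
    have T: "T \<in> ?S - ?K" "u < p" "v < p" and T': "T' \<in> ?S - ?K" "u' < p" "v' < p"
      using z z' zz zz' by auto
    have e1: "\<Phi> (\<tau> T u v) T = \<Phi> (\<tau> T' u' v') T'" and
      e2: "increment L T (p * B T) < increment L T (p * Suc (B T)) \<longleftrightarrow>
           increment L T' (p * B T') < increment L T' (p * Suc (B T'))"
      using eq by (auto simp: f_def zz zz')
    have e3: "increment L T \<circ> \<tau> T u v = increment L T' \<circ> \<tau> T' u' v'"
      using inc[OF T] inc[OF T'] e1 by simp
    have bT: "increment L T (p * B T + w) = increment L T (p * B T)"
        "increment L T (p * Suc (B T) + w) = increment L T (p * Suc (B T))"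
        "k < B T \<Longrightarrow> increment L T (p * k + w) = increment L T (p * k)" if "w < p" for w k
      using block[of T _ w] B(1)[OF T(1)] T(1) that by (auto simp del: mult_Suc_right)
    have bT': "increment L T' (p * B T' + w) = increment L T' (p * B T')"
        "increment L T' (p * Suc (B T') + w) = increment L T' (p * Suc (B T'))"
        "k < B T' \<Longrightarrow> increment L T' (p * k + w) = increment L T' (p * k)" if "w < p" for w k
      using block[of T' _ w] B(1)[OF T'(1)] T'(1) that by (auto simp del: mult_Suc_right)
    note BT = B[OF T(1)] and BT' = B[OF T'(1)]
    have "B T = B T' \<and> u = u' \<and> v = v'"
      using block_swap_recover[OF p, of "increment L T" "B T" "increment L T (p * B T)" "increment L T (p * Suc (B T))"
          "increment L T'" "B T'" "increment L T' (p * B T')" "increment L T' (p * Suc (B T'))" u v u' v']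
        bT bT' BT BT' e2 e3 T T'
      unfolding \<tau>_def by blast
    then have uv: "u = u'" "v = v'" "\<tau> T u v = \<tau> T' u' v'" by (auto simp: \<tau>_def)
    have "inj_on (\<Phi> (\<tau> T u v)) ?X" using \<Phi>[OF perm[OF T]] by (auto simp: bij_betw_def)
    then have "T = T'" using e1 uv SX T T' by (auto dest: inj_onD)
    then show "z = z'" using uv zz zz' by simp
  qed
  moreover have "f ` ?D \<subseteq> (?X - ?S) \<times> UNIV"
  proof
    fix y assume "y \<in> f ` ?D"
    then obtain T u v where T: "T \<in> ?S - ?K" "u < p" "v < p" and y: "fst y = \<Phi> (\<tau> T u v) T"
      by (auto simp: f_def)
    define w where "w = (if u = 0 then 1 else 0 :: nat)"
    have w: "w < p" "w \<noteq> u" using p by (auto simp: w_def)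
    let ?\<mu> = "increment L (fst y)"
    have Bq: "B T < q" "Suc (B T) < q" using B(1)[OF T(1)] by auto
    have "?\<mu> (p * B T + u) = increment L T (p * Suc (B T) + v)"
      using inc(1)[OF T] y by (simp add: \<tau>_def)
    also have "\<dots> = increment L T (p * Suc (B T))" using block[of T "Suc (B T)" v] T Bq by blast
    also have "\<dots> \<noteq> increment L T (p * B T)" using B(2)[OF T(1)] by simp
    also have "increment L T (p * B T) = increment L T (p * B T + w)" using block[of T "B T" w] T Bq w by auto
    also have "\<dots> = ?\<mu> (p * B T + w)"
      using inc(1)[OF T] y w by (simp add: \<tau>_def transpose_apply_other)
    finally have "?\<mu> (p * B T + u) \<noteq> ?\<mu> (p * B T + w)" .
    moreover have "?\<mu> (p * B T + u) = ?\<mu> (p * B T)" "?\<mu> (p * B T + w) = ?\<mu> (p * B T)" if "fst y \<in> ?S"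
      using block[OF that Bq(1)] T w by auto
    ultimately have "fst y \<notin> ?S" by metis
    then show "y \<in> (?X - ?S) \<times> UNIV" using inc(2)[OF T] y by (cases y) auto
  qed
  ultimately have "card ?D \<le> card ((?X - ?S) \<times> (UNIV :: bool set))"
    using card_inj_on_le[of f ?D "(?X - ?S) \<times> (UNIV :: bool set)"] finite_ichains by auto
  then show ?thesis by (simp add: card_cartesian_product mult.commute mult.left_commute)
qed

section \<open>Few chains have constant increments\<close>

text \<open>Constant increments \<open>c\<close> after one unit has been taken from step \<open>v\<close> and given to step \<open>u\<close>.\<close>

definition bumped :: "nat \<Rightarrow> nat \<Rightarrow> nat \<Rightarrow> nat \<Rightarrow> nat \<Rightarrow> nat" where
  "bumped N c u v l =
    (if l < N then if l = u then c + 1 else if l = v then c - 1 else c else 0)"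

lemma bumped_permute:
  assumes "\<pi> permutes {..<N}" "\<pi> 0 = u" "\<pi> (Suc 0) = v"
  shows "bumped N c u v \<circ> \<pi> = bumped N c 0 (Suc 0)"
proof
  fix l
  have "\<pi> l = u \<longleftrightarrow> l = 0" "\<pi> l = v \<longleftrightarrow> l = Suc 0"
    using permutes_inj[OF assms(1)] assms(2,3) by (auto dest: injD)
  moreover have "\<pi> l < N \<longleftrightarrow> l < N" using permutes_in_image[OF assms(1), of l] by simp
  ultimately show "(bumped N c u v \<circ> \<pi>) l = bumped N c 0 (Suc 0) l" by (simp add: bumped_def)
qed

lemma card_bumped:
  assumes "u < N" "v < N" "u \<noteq> v"
  shows "card {T \<in> ichains L N a b. increment L T = bumped N c u v} =
    card {T \<in> ichains L N a b. increment L T = bumped N c 0 (Suc 0)}"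
proof -
  obtain \<pi> where \<pi>: "\<pi> permutes {..<N}" "\<pi> 0 = u" "\<pi> (Suc 0) = v"
    using ex_permutation_pair[OF assms] by blast
  show ?thesis
    using card_increment_permute[OF \<pi>(1), of L a b "bumped N c u v"] bumped_permute[OF \<pi>] by simp
qed

lemma bumped_inj:
  assumes "bumped N c u v = bumped N c u' v'" "c > 0"
    "u < N" "v < N" "u \<noteq> v" "u' < N" "v' < N" "u' \<noteq> v'"
  shows "u = u' \<and> v = v'"
  using fun_cong[OF assms(1), of u] fun_cong[OF assms(1), of v] assms(2-)
  by (auto simp: bumped_def split: if_splits)

definition flexible :: "nat \<Rightarrow> (nat \<Rightarrow> nat \<Rightarrow> int) \<Rightarrow> nat \<Rightarrow> nat \<Rightarrow> bool" where
  "flexible L T l i \<longleftrightarrow> i < L \<and> site_min L (T l) (T (Suc (Suc l))) i < site_max (T l) (T (Suc (Suc l))) i"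

text \<open>Move up if possible. At the upper end of an interval of positive length the move down is possible.\<close>

definition nudge_amount :: "(nat \<Rightarrow> nat \<Rightarrow> int) \<Rightarrow> nat \<Rightarrow> nat \<Rightarrow> int" where
  "nudge_amount T l i = (if T (Suc l) i < site_max (T l) (T (Suc (Suc l))) i then 1 else - 1)"

definition nudge :: "(nat \<Rightarrow> nat \<Rightarrow> int) \<Rightarrow> nat \<Rightarrow> nat \<Rightarrow> nat \<Rightarrow> nat \<Rightarrow> int" where
  "nudge T l i = T(Suc l := (T (Suc l))(i := T (Suc l) i + nudge_amount T l i))"

lemma nudge_in_ichains:
  assumes T: "T \<in> ichains L N a b" and l: "Suc l < N" and f: "flexible L T l i"
  shows "nudge T l i \<in> ichains L N a b"
  unfolding nudge_def
proof (rule ichains_update[OF T l])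
  fix k assume "k < L"
  then show "site_min L (T l) (T (Suc (Suc l))) k \<le> ((T (Suc l))(i := T (Suc l) i + nudge_amount T l i)) k"
    "((T (Suc l))(i := T (Suc l) i + nudge_amount T l i)) k \<le> site_max (T l) (T (Suc (Suc l))) k"
    using ichains_site_bounds[OF T l, of k] f by (auto simp: flexible_def nudge_amount_def)
qed (use f in \<open>auto simp: flexible_def\<close>)

lemma increment_nudge:
  assumes T: "T \<in> ichains L N a b" and l: "Suc l < N" and f: "flexible L T l i"
    and const: "\<And>k. k < N \<Longrightarrow> increment L T k = c"
  shows "c > 0" "increment L (nudge T l i) =
    (if nudge_amount T l i = 1 then bumped N c l (Suc l) else bumped N c (Suc l) l)"
proof -
  let ?s = "nudge_amount T l i"
  let ?M = "(T (Suc l))(i := T (Suc l) i + ?s)"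
  have i: "i < L" using f by (simp add: flexible_def)
  have s: "?s = 1 \<or> ?s = -1" by (simp add: nudge_amount_def)
  note X = nudge_in_ichains[OF T l f]
  have sM: "(\<Sum>k<L. ?M k) = (\<Sum>k<L. T (Suc l) k) + ?s"
    using i by (simp add: sum.remove[of "{..<L}" i])
  have c: "int c = (\<Sum>k<L. T (Suc l) k) - (\<Sum>k<L. T l k)"
    using int_increment[OF T, of l] const[of l] l by (simp add: sum_subtractf)
  have c': "int c = (\<Sum>k<L. T (Suc (Suc l)) k) - (\<Sum>k<L. T (Suc l) k)"
    using int_increment[OF T, of "Suc l"] const[of "Suc l"] l by (simp add: sum_subtractf)
  have 1: "int (increment L (nudge T l i) l) = int c + ?s"
    using int_increment_update(1)[OF X[unfolded nudge_def]] sM c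
    by (simp add: nudge_def sum_subtractf)
  have 2: "int (increment L (nudge T l i) (Suc l)) = int c - ?s"
    using int_increment_update(2)[OF X[unfolded nudge_def]] sM c'
    by (simp add: nudge_def sum_subtractf)
  show "c > 0" using 1 2 s by auto
  then have "increment L (nudge T l i) l = (if ?s = 1 then c + 1 else c - 1)"
    "increment L (nudge T l i) (Suc l) = (if ?s = 1 then c - 1 else c + 1)"
    using 1 2 s by auto
  moreover have "increment L (nudge T l i) k = (if k < N then c else 0)" if "k \<noteq> l" "k \<noteq> Suc l" for k
    using increment_update[OF that] const[of k] increment_beyond[OF T, of k]
    by (simp add: nudge_def)
  ultimately show "increment L (nudge T l i) =
    (if ?s = 1 then bumped N c l (Suc l) else bumped N c (Suc l) l)"
    using l by (auto simp: bumped_def fun_eq_iff)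
qed

text \<open>Nudge each chain with constant increments at the first flexible particle of some configuration. The
configurations before and after are unchanged, so the particle can be found again, while the
increments show which configuration was changed and in which direction: the map is injective. Its values
have increments \<open>bumped N c u v\<close> for \<open>2 * (N - 1)\<close> pairs \<open>(u, v)\<close>. By symmetry each of the \<open>N * (N - 1)\<close>
pairs \<open>u \<noteq> v\<close> accounts for the same number \<open>\<kappa>\<close> of chains, none of which has constant increments.\<close>

lemma card_constant_chains_le:
  assumes X2: "card (ichains L N a b) \<ge> 2"
  shows "N * card (constant_chains L N a b) \<le> 2 * card (ichains L N a b - constant_chains L N a b)"
proof (cases "constant_chains L N a b = {}")
  case False
  let ?X = "ichains L N a b" and ?K = "constant_chains L N a b"
  obtain T0 where T0: "T0 \<in> ?K" using False by blast
  have KX: "T \<in> ?X" if "T \<in> ?K" for T using that unfolding constant_chains_def by blast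
  define c where "c = increment L T0 0"
  have const: "increment L T l = c" if T: "T \<in> ?K" "l < N" for T l
  proof -
    have total: "int (N * increment L U 0) = (\<Sum>i<L. b i - a i)" if "U \<in> ?K" for U
    proof -
      have "(\<Sum>l<N. increment L U l) = (\<Sum>l<N. increment L U 0)"
        using constant_chainsD[OF that] by (intro sum.cong refl) blast
      then show ?thesis using sum_increment[OF KX[OF that]] by simp
    qed
    have "int (N * increment L T 0) = int (N * increment L T0 0)"
      using total[OF T(1)] total[OF T0] by (rule trans[OF _ sym])
    then have "increment L T 0 = c" using T(2) by (simp add: c_def)
    then show ?thesis by (rule trans[OF constant_chainsD[OF T]])
  qed
  define lv where "lv T = (SOME l. Suc l < N \<and> (\<exists>i. flexible L T l i))" for T
  define st where "st T = (LEAST i. flexible L T (lv T) i)" for T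
  have flex: "Suc (lv T) < N" "flexible L T (lv T) (st T)" if "T \<in> ?K" for T
  proof -
    have "\<exists>l. Suc l < N \<and> (\<exists>i. flexible L T l i)"
      using flexible_site[OF KX[OF that] X2] unfolding flexible_def by blast
    then have *: "Suc (lv T) < N \<and> (\<exists>i. flexible L T (lv T) i)"
      unfolding lv_def by (rule someI_ex)
    then show "Suc (lv T) < N" by simp
    show "flexible L T (lv T) (st T)" unfolding st_def using * by (auto intro: LeastI)
  qed
  have N2: "Suc 0 < N" using flex(1)[OF T0] by simp
  define f where "f T = nudge T (lv T) (st T)" for T
  have fX: "f T \<in> ?X" if "T \<in> ?K" for T
    unfolding f_def using that flex KX by (intro nudge_in_ichains) auto
  have cpos: "c > 0" using increment_nudge(1)[OF KX[OF T0] flex[OF T0] const[OF T0]] .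
  have inc: "increment L (f T) = (if nudge_amount T (lv T) (st T) = 1
     then bumped N c (lv T) (Suc (lv T)) else bumped N c (Suc (lv T)) (lv T))" if "T \<in> ?K" for T
    unfolding f_def by (rule increment_nudge(2)[OF KX[OF that] flex[OF that] const[OF that]])
  have inj: "inj_on f ?K"
  proof (rule inj_onI)
    fix T U assume T: "T \<in> ?K" and U: "U \<in> ?K" and eq: "f T = f U"
    define s t where "s = nudge_amount T (lv T) (st T)" and "t = nudge_amount U (lv U) (st U)"
    have st: "s = 1 \<or> s = -1" "t = 1 \<or> t = -1" by (auto simp: s_def t_def nudge_amount_def)
    have "(if s = 1 then bumped N c (lv T) (Suc (lv T)) else bumped N c (Suc (lv T)) (lv T)) =
      (if t = 1 then bumped N c (lv U) (Suc (lv U)) else bumped N c (Suc (lv U)) (lv U))"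
      using inc[OF T] inc[OF U] eq by (simp add: s_def t_def)
    then have lv: "lv T = lv U" and s: "s = t"
      using bumped_inj[of N c _ _ _ _, OF _ cpos] flex(1)[OF T] flex(1)[OF U] st
      by (auto split: if_splits dest!: bumped_inj[OF _ cpos])
    let ?l = "lv U"
    have "T k = U k" if "k \<noteq> Suc ?l" for k
    proof -
      have "T k = f T k" using that lv by (simp add: f_def nudge_def)
      also have "\<dots> = U k" using that eq by (simp add: f_def nudge_def)
      finally show ?thesis .
    qed
    note off = this
    have "flexible L T ?l = flexible L U ?l" using off[of ?l] off[of "Suc (Suc ?l)"]
      by (intro ext) (simp add: flexible_def)
    then have stq: "st T = st U" by (simp add: st_def lv)
    have "T (Suc ?l) k = U (Suc ?l) k" for k
      using fun_cong[OF fun_cong[OF eq, of "Suc ?l"], of k] s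
      by (auto simp: f_def nudge_def lv stq s_def t_def split: if_splits)
    with off show "T = U" by (metis ext)
  qed
  let ?E = "\<lambda>u v. {T \<in> ?X. increment L T = bumped N c u v}"
  define \<kappa> where "\<kappa> = card (?E 0 (Suc 0))"
  have \<kappa>: "card (?E u v) = \<kappa>" if "u < N" "v < N" "u \<noteq> v" for u v
    unfolding \<kappa>_def by (rule card_bumped[OF that])
  have finE: "finite (?E u v)" for u v using finite_ichains by auto
  let ?P = "(\<lambda>l. (l, Suc l)) ` {..<N - 1} \<union> (\<lambda>l. (Suc l, l)) ` {..<N - 1}"
  have "card ?K = card (f ` ?K)" using card_image[OF inj] by simp
  also have "\<dots> \<le> card (\<Union>(u, v)\<in>?P. ?E u v)"
  proof (rule card_mono)
    show "finite (\<Union>(u, v)\<in>?P. ?E u v)" using finE by auto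
    show "f ` ?K \<subseteq> (\<Union>(u, v)\<in>?P. ?E u v)"
    proof
      fix y assume "y \<in> f ` ?K"
      then obtain T where T: "T \<in> ?K" "y = f T" by blast
      have "lv T < N - 1" using flex(1)[OF T(1)] by simp
      then show "y \<in> (\<Union>(u, v)\<in>?P. ?E u v)"
        using inc[OF T(1)] fX[OF T(1)] T(2) by (auto split: if_splits)
    qed
  qed
  also have "\<dots> \<le> (\<Sum>(u, v)\<in>?P. card (?E u v))"
    using card_UN_le[of ?P "\<lambda>(u, v). ?E u v"] by (simp add: case_prod_beta)
  also have "\<dots> = (\<Sum>(u, v)\<in>?P. \<kappa>)"
    by (intro sum.cong refl) (auto intro!: \<kappa>)
  also have "\<dots> = card ?P * \<kappa>" by (simp add: case_prod_beta)
  also have "\<dots> \<le> (2 * (N - 1)) * \<kappa>"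
  proof (rule mult_le_mono1)
    have "card ?P \<le> card ((\<lambda>l. (l, Suc l)) ` {..<N - 1}) + card ((\<lambda>l. (Suc l, l)) ` {..<N - 1})"
      by (rule card_Un_le)
    also have "\<dots> \<le> 2 * (N - 1)"
      using card_image_le[of "{..<N - 1}" "\<lambda>l. (l, Suc l)"] card_image_le[of "{..<N - 1}" "\<lambda>l. (Suc l, l)"]
      by simp
    finally show "card ?P \<le> 2 * (N - 1)" .
  qed
  finally have up: "card ?K \<le> 2 * (N - 1) * \<kappa>" .
  let ?Q = "(SIGMA u:{..<N}. {..<N} - {u})"
  have "N * (N - 1) * \<kappa> = (\<Sum>z\<in>?Q. \<kappa>)" by (simp add: card_SigmaI)
  also have "\<dots> = (\<Sum>(u, v)\<in>?Q. card (?E u v))"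
    by (intro sum.cong refl) (auto intro!: \<kappa>[symmetric])
  also have "\<dots> = card (\<Union>(u, v)\<in>?Q. ?E u v)"
  proof -
    have "card (\<Union>z\<in>?Q. (\<lambda>(u, v). ?E u v) z) = (\<Sum>z\<in>?Q. card ((\<lambda>(u, v). ?E u v) z))"
    proof (rule card_UN_disjoint)
      show "\<forall>z\<in>?Q. \<forall>z'\<in>?Q. z \<noteq> z' \<longrightarrow> (\<lambda>(u, v). ?E u v) z \<inter> (\<lambda>(u, v). ?E u v) z' = {}"
        by (auto dest!: bumped_inj[OF _ cpos])
    qed (use finE in auto)
    then show ?thesis by (simp add: case_prod_beta)
  qed
  also have "\<dots> \<le> card (?X - ?K)"
  proof (rule card_mono)
    show "(\<Union>(u, v)\<in>?Q. ?E u v) \<subseteq> ?X - ?K"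
    proof
      fix T assume "T \<in> (\<Union>(u, v)\<in>?Q. ?E u v)"
      then obtain u v where uv: "u < N" "v < N" "u \<noteq> v"
        and T: "T \<in> ?X" "increment L T = bumped N c u v" by auto
      show "T \<in> ?X - ?K"
      proof
        show "T \<notin> ?K"
        proof
          assume "T \<in> ?K"
          then have "increment L T u = c" using const uv by blast
          then show False using T(2) uv by (simp add: bumped_def)
        qed
      qed (use T in blast)
    qed
  qed (use finite_ichains in auto)
  finally have low: "N * (N - 1) * \<kappa> \<le> card (?X - ?K)" .
  have "N * card ?K \<le> N * (2 * (N - 1) * \<kappa>)" using up by (rule mult_le_mono2)
  also have "\<dots> = 2 * (N * (N - 1) * \<kappa>)" by (simp add: mult_ac)
  also have "\<dots> \<le> 2 * card (?X - ?K)" using low by simp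
  finally show ?thesis .
qed simp

section \<open>Summing over the prime divisors\<close>

lemma fact_le_prod:
  fixes P :: "nat set"
  assumes "finite P" "\<And>p. p \<in> P \<Longrightarrow> p \<ge> 2"
  shows "fact (card P + 1) \<le> \<Prod>P"
  using assms
proof (induction "card P" arbitrary: P)
  case (Suc n)
  define m where "m = Max P"
  have ne: "P \<noteq> {}" using Suc by auto
  have m: "m \<in> P" unfolding m_def using Suc.prems ne by (intro Max_in)
  have "P \<subseteq> {2..m}" unfolding m_def using Suc.prems by auto
  then have "card P \<le> card {2..m}" by (intro card_mono) auto
  then have ge: "card P + 1 \<le> m" using Suc by simp
  have "fact (card (P - {m}) + 1) \<le> \<Prod>(P - {m})"
    using Suc m by (intro Suc.hyps) auto
  then have "fact (card P) \<le> \<Prod>(P - {m})" using Suc m by simp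
  then have "(card P + 1) * fact (card P) \<le> m * \<Prod>(P - {m})" using ge by (intro mult_le_mono)
  also have "\<dots> = \<Prod>P" using m Suc.prems by (simp add: prod.remove)
  finally show ?case by simp
qed (auto simp: card_eq_0_iff)

lemma fact_bound: "n \<ge> 3 \<Longrightarrow> 12 * (n - 1) \<le> (fact (n + 1) :: nat)"
proof (induction n rule: dec_induct)
  case base
  then show ?case by (simp add: eval_nat_numeral fact_Suc)
next
  case (step n)
  have "12 * (Suc n - 1) \<le> 12 * (n - 1) * (n + 2)"
  proof -
    obtain k where "n = k + 3" using step.hyps le_Suc_ex by (metis add.commute)
    then show ?thesis by (simp add: algebra_simps)
  qed
  also have "\<dots> \<le> fact (n + 1) * (n + 2)" using step.IH by (intro mult_le_mono1)
  also have "\<dots> = fact (Suc n + 1)" by (simp add: fact_Suc algebra_simps)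
  finally show ?case .
qed

text \<open>The prime \<open>2\<close> contributes \<open>1 / 3\<close>. For odd \<open>n = 2 * t + 3\<close> the summand is at most \<open>2 / (n^2 - 1)\<close>, and these
telescope to at most \<open>1 / 2\<close>.\<close>

lemma sum_primes_bound:
  assumes "finite P" "\<And>p. p \<in> P \<Longrightarrow> prime (p::nat)"
  shows "(\<Sum>p\<in>P. 2 / (real p ^ 2 + 2)) \<le> 5 / 6"
proof -
  let ?g = "\<lambda>p::nat. 2 / (real p ^ 2 + 2)"
  define M where "M = Max (insert 0 P)"
  have M: "p \<le> M" if "p \<in> P" for p unfolding M_def using assms(1) that by simp
  have "P \<subseteq> insert 2 ((\<lambda>t. 2 * t + 3) ` {..<M})"
  proof
    fix p assume p: "p \<in> P"
    show "p \<in> insert 2 ((\<lambda>t. 2 * t + 3) ` {..<M})"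
    proof (cases "p = 2")
      case False
      then have "p > 2" using prime_ge_2_nat[OF assms(2)[OF p]] by simp
      then have "odd p" "p \<ge> 3" using assms(2)[OF p] prime_odd_nat by auto
      then have "p = 2 * ((p - 3) div 2) + 3" "(p - 3) div 2 < M" using M[OF p] by presburger+
      then show ?thesis by blast
    qed simp
  qed
  then have "sum ?g P \<le> sum ?g (insert 2 ((\<lambda>t. 2 * t + 3) ` {..<M}))"
    by (intro sum_mono2) auto
  also have "\<dots> \<le> ?g 2 + sum ?g ((\<lambda>t. 2 * t + 3) ` {..<M})"
    by (subst sum.insert) auto
  also have "sum ?g ((\<lambda>t. 2 * t + 3) ` {..<M}) = (\<Sum>t<M. ?g (2 * t + 3))"
    by (subst sum.reindex) (auto simp: inj_on_def)
  also have "\<dots> \<le> (\<Sum>t<M. 1 / (2 * real t + 2) - 1 / (2 * real (Suc t) + 2))"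
  proof (rule sum_mono)
    fix t
    have "1 / (2 * real t + 2) - 1 / (2 * real (Suc t) + 2) = 2 / ((2 * real t + 2) * (2 * real t + 4))"
      by (simp add: field_simps)
    moreover have "?g (2 * t + 3) \<le> 2 / ((2 * real t + 2) * (2 * real t + 4))"
      by (intro divide_left_mono) (auto simp: power2_eq_square algebra_simps intro!: add_pos_nonneg mult_pos_pos)
    ultimately show "?g (2 * t + 3) \<le> 1 / (2 * real t + 2) - 1 / (2 * real (Suc t) + 2)" by simp
  qed
  also have "\<dots> = 1 / 2 - 1 / (2 * real M + 2)"
    by (subst sum_lessThan_telescope') simp
  also have "?g 2 + (1 / 2 - 1 / (2 * real M + 2)) \<le> 5 / 6" by simp
  finally show ?thesis by simp
qed

text \<open>With two primes the left side is at most \<open>1 / 3 + 2 / 11 + 2 / 6\<close>. With three or more, the second summand is at most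
\<open>1 / 6\<close>, because a product of \<open>n\<close> distinct primes is at least \<open>(n + 1)!\<close>.\<close>

lemma primes_numeric_bound:
  assumes P: "finite P" "\<And>p. p \<in> P \<Longrightarrow> prime (p::nat)" and c: "card P \<ge> 2" and J: "\<Prod>P \<le> J"
  shows "(\<Sum>p\<in>P. 2 / (real p ^ 2 + 2)) + real (card P - 1) * (2 / real J) \<le> 1"
proof (cases "card P = 2")
  case True
  then obtain p q where pq: "P = {p, q}" "p < q"
    by (metis card_2_iff insert_commute linorder_neqE_nat)
  have p: "p \<ge> 2" using P pq prime_ge_2_nat by auto
  then have q: "q \<ge> 3" using pq by simp
  have "2 * 3 \<le> p * q" using p q by (intro mult_le_mono)
  then have "6 \<le> J" using J pq by simp
  then have "2 / real J \<le> 1 / 3" by (simp add: field_simps)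
  moreover have "2 / (real p ^ 2 + 2) \<le> 1 / 3"
  proof -
    have "(2::real) ^ 2 \<le> real p ^ 2" using p by (intro power_mono) auto
    then show ?thesis by (simp add: field_simps)
  qed
  moreover have "2 / (real q ^ 2 + 2) \<le> 2 / 11"
  proof -
    have "(3::real) ^ 2 \<le> real q ^ 2" using q by (intro power_mono) auto
    then show ?thesis by (simp add: field_simps)
  qed
  ultimately show ?thesis using pq True by simp
next
  case False
  then have "12 * (card P - 1) \<le> (fact (card P + 1) :: nat)" using c by (intro fact_bound) simp
  also have "\<dots> \<le> \<Prod>P" using P prime_ge_2_nat by (intro fact_le_prod) auto
  also note J
  finally have J': "12 * (card P - 1) \<le> J" .
  then have "J > 0" using c by simp
  have "real (12 * (card P - 1)) \<le> real J" using J' by (simp only: of_nat_le_iff)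
  then have "real (card P - 1) * (2 / real J) \<le> 1 / 6" using \<open>J > 0\<close> by (simp add: field_simps)
  then show ?thesis using sum_primes_bound[OF P] by linarith
qed

text \<open>Let \<open>n0\<close> count the chains with constant increments and \<open>n1\<close> the others. Each prime \<open>p\<close> contributes at most
\<open>n0 + 2 / (p^2 + 2) * n1\<close>. One copy of \<open>n0\<close> is harmless, the other copies are at most \<open>2 / j * n1\<close> each.\<close>

lemma sum_block_chains_le:
  assumes N: "j dvd N" "N > 0" and X2: "card (ichains L N a b) \<ge> 2"
  shows "(\<Sum>p\<in>prime_factors j. card (block_chains L p N a b)) \<le> card (ichains L N a b)"
proof -
  let ?P = "prime_factors j" and ?X = "ichains L N a b" and ?K = "constant_chains L N a b"
  let ?S = "\<lambda>p. block_chains L p N a b"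
  have j: "j > 0" using N by (auto intro: Nat.gr0I)
  have P: "finite ?P" "\<And>p. p \<in> ?P \<Longrightarrow> prime p" by auto
  have SX: "card (?S p) \<le> card ?X" for p
    using block_chains_subset finite_ichains by (rule card_mono[rotated])
  consider "?P = {}" | "card ?P = 1" | "card ?P \<ge> 2"
    using P(1) by (metis One_nat_def Suc_1 card_0_eq less_2_cases_iff linorder_not_le)
  then show ?thesis
  proof cases
    case 2
    then obtain p where "?P = {p}" by (auto simp: card_1_singleton_iff)
    then show ?thesis using SX by simp
  next
    case 3
    have KS: "?K \<subseteq> ?S p" for p by (rule constant_subset_block)
    have finS: "finite (?S p)" for p by (rule finite_block_chains)
    have finK: "finite ?K" using KS finS by (rule finite_subset)
    define n0 n1 where "n0 = real (card ?K)" and "n1 = real (card (?X - ?K))"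
    have X: "real (card ?X) = n0 + n1"
    proof -
      have "?K \<subseteq> ?X" using KS[of 0] block_chains_subset[of L 0 N a b] by blast
      then show ?thesis
        unfolding n0_def n1_def using finK card_mono[OF finite_ichains, of ?K L N a b]
        by (simp add: card_Diff_subset of_nat_diff)
    qed
    have s: "real (card (?S p)) \<le> n0 + 2 / (real p ^ 2 + 2) * n1" if p: "p \<in> ?P" for p
    proof -
      have "prime p" "p dvd j" using p by auto
      then have p2: "p \<ge> 2" "p dvd N" using N(1) prime_ge_2_nat dvd_trans by blast+
      define s where "s = real (card (?S p - ?K))"
      have Sp: "real (card (?S p)) = n0 + s"
        unfolding n0_def s_def using KS[of p] finK finS[of p]
          card_mono[OF finS[of p] KS[of p]]
        by (simp add: card_Diff_subset of_nat_diff)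
      have "real (card (?X - ?S p)) = real (card ?X) - real (card (?S p))"
        using finS[of p] block_chains_subset[of L p N a b] SX[of p]
        by (simp add: card_Diff_subset of_nat_diff)
      moreover have "real (p * p * card (?S p - ?K)) \<le> real (2 * card (?X - ?S p))"
        using card_block_chains_le[OF p2, of L a b] by (simp only: of_nat_le_iff)
      ultimately have "real p ^ 2 * s \<le> 2 * (n1 - s)"
        using X Sp by (simp add: s_def power2_eq_square)
      then have "(real p ^ 2 + 2) * s \<le> 2 * n1" by (simp add: algebra_simps)
      moreover have "real p ^ 2 + 2 > 0" by (simp add: add_nonneg_pos)
      ultimately have "s \<le> 2 * n1 / (real p ^ 2 + 2)" by (simp add: pos_le_divide_eq mult.commute)
      then show ?thesis using Sp by simp
    qed
    have "real N * n0 \<le> 2 * n1"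
    proof -
      have "real (N * card ?K) \<le> real (2 * card (?X - ?K))"
        using card_constant_chains_le[OF X2] by (simp only: of_nat_le_iff)
      then show ?thesis by (simp add: n0_def n1_def)
    qed
    moreover have "real j \<le> real N" using N by (simp add: dvd_imp_le)
    moreover have "n0 \<ge> 0" "n1 \<ge> 0" by (auto simp: n0_def n1_def)
    ultimately have "real j * n0 \<le> 2 * n1" using mult_right_mono[of "real j" "real N" n0] by linarith
    then have n0: "n0 \<le> 2 / real j * n1" using j by (simp add: field_simps)
    have "\<Prod>?P \<le> j"
    proof -
      have "\<Prod>?P dvd (\<Prod>p\<in>?P. p ^ multiplicity p j)"
        by (intro prod_dvd_prod) (auto simp: prime_factors_multiplicity)
      also have "\<dots> = j" using j by (simp add: prod_prime_factors)
      finally show ?thesis using j by (simp add: dvd_imp_le)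
    qed
    from primes_numeric_bound[OF P 3 this]
    have num: "(\<Sum>p\<in>?P. 2 / (real p ^ 2 + 2)) + real (card ?P - 1) * (2 / real j) \<le> 1" .
    have "(\<Sum>p\<in>?P. real (card (?S p))) \<le> (\<Sum>p\<in>?P. n0 + 2 / (real p ^ 2 + 2) * n1)"
      using s by (rule sum_mono)
    also have "\<dots> = real (card ?P) * n0 + (\<Sum>p\<in>?P. 2 / (real p ^ 2 + 2)) * n1"
      by (simp add: sum.distrib sum_distrib_right)
    also have "real (card ?P) * n0 = n0 + real (card ?P - 1) * n0"
      using 3 by (simp add: of_nat_diff algebra_simps)
    also have "real (card ?P - 1) * n0 \<le> real (card ?P - 1) * (2 / real j * n1)"
      using n0 by (rule mult_left_mono) simp
    finally have "(\<Sum>p\<in>?P. real (card (?S p))) \<le>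
       n0 + ((\<Sum>p\<in>?P. 2 / (real p ^ 2 + 2)) + real (card ?P - 1) * (2 / real j)) * n1"
      by (simp add: algebra_simps)
    also have "\<dots> \<le> n0 + 1 * n1"
      using num \<open>n1 \<ge> 0\<close> by (intro add_left_mono mult_right_mono)
    finally have "real (\<Sum>p\<in>?P. card (?S p)) \<le> real (card ?X)" using X by simp
    then show ?thesis by (simp only: of_nat_le_iff)
  qed simp
qed

section \<open>Cyclic actions with prescribed numbers of fixed points\<close>

text \<open>The Moebius inverse of \<open>g\<close> over divisors: the number of points in orbits of size exactly \<open>j\<close>, if \<open>g i\<close>
is the number of points fixed by the \<open>i\<close>-th power of a generator.\<close>

fun exact_count :: "(nat \<Rightarrow> nat) \<Rightarrow> nat \<Rightarrow> int" where
  "exact_count g j = int (g j) - (\<Sum>i | i dvd j \<and> i < j. exact_count g i)"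

declare exact_count.simps [simp del]

lemma finite_dvd: "j > 0 \<Longrightarrow> finite {i::nat. i dvd j \<and> P i}"
  by (rule finite_subset[of _ "{..j}"]) (auto dest: dvd_imp_le)

lemma sum_exact_count:
  assumes "j > 0"
  shows "(\<Sum>i | i dvd j. exact_count g i) = int (g j)"
proof -
  have "{i. i dvd j} = insert j {i. i dvd j \<and> i < j}"
    using assms by (auto dest: dvd_imp_le)
  moreover have "finite {i. i dvd j \<and> i < j}" using assms by (rule finite_dvd)
  ultimately show ?thesis by (simp add: exact_count.simps[of g j])
qed

lemma div_div_dvd:
  fixes d m :: nat
  assumes "d dvd m" "m > 0"
  shows "m div d dvd m" "m div (m div d) = d"
proof -
  obtain k where k: "m = d * k" using assms(1) by auto
  with assms(2) have "d > 0" "k > 0" by auto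
  with k show "m div d dvd m" "m div (m div d) = d" by simp_all
qed

lemma exact_count_const:
  assumes "j > 0" "\<And>i. i dvd j \<Longrightarrow> g i = c"
  shows "exact_count g j = (if j = 1 then int c else 0)"
  using assms
proof (induction j rule: less_induct)
  case (less j)
  have "exact_count g i = (if i = 1 then int c else 0)" if "i dvd j" "i < j" for i
    using that less.prems dvd_trans by (intro less.IH) (auto intro: Nat.gr0I)
  then have "(\<Sum>i | i dvd j \<and> i < j. exact_count g i) =
      (\<Sum>i | i dvd j \<and> i < j. if i = 1 then int c else 0)"
    by (intro sum.cong) auto
  also have "\<dots> = (if j = 1 then 0 else int c)"
    using less.prems(1) finite_dvd[OF less.prems(1), of "\<lambda>i. i < j"] by (simp add: sum.delta')
  finally show ?case using less.prems(2)[of j] by (auto simp: exact_count.simps[of g j])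
qed

text \<open>Every proper divisor of \<open>j\<close> divides \<open>j div p\<close> for some prime \<open>p\<close>. As the smaller exact counts are nonnegative
by induction, their sum is at most the sum of the \<open>g (j div p)\<close>.\<close>

lemma exact_count_nonneg:
  assumes "m > 0"
    and "\<And>j. j dvd m \<Longrightarrow> (\<forall>i. i dvd j \<longrightarrow> g i = g j) \<or> (\<Sum>p\<in>prime_factors j. g (j div p)) \<le> g j"
    and "j dvd m"
  shows "exact_count g j \<ge> 0"
  using \<open>j dvd m\<close>
proof (induction j rule: less_induct)
  case (less j)
  have j: "j > 0" using less.prems \<open>m > 0\<close> by (auto intro: Nat.gr0I)
  show ?case
  proof (cases "\<forall>i. i dvd j \<longrightarrow> g i = g j")
    case True
    then have "exact_count g j = (if j = 1 then int (g j) else 0)"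
      by (intro exact_count_const j) blast
    then show ?thesis by simp
  next
    case False
    let ?D = "{i. i dvd j \<and> i < j}"
    have nn: "exact_count g i \<ge> 0" if "i \<in> ?D" for i
      using that less.prems dvd_trans by (intro less.IH) auto
    have div: "{i. i dvd j div p} \<subseteq> ?D" if "p \<in> prime_factors j" for p
    proof -
      have p: "prime p" "p dvd j" using that by auto
      then have lt: "j div p < j" using j prime_gt_1_nat by (intro div_less_dividend)
      have pos: "j div p > 0" using p j by (simp add: dvd_imp_le div_greater_zero_iff prime_gt_0_nat)
      have dvd: "j div p dvd j" using p by (metis dvd_div_mult_self dvd_triv_left)
      show ?thesis
      proof (intro subsetI CollectI conjI)
        fix i assume "i \<in> {i. i dvd j div p}"
        then have i: "i dvd j div p" by simp
        show "i dvd j" using i dvd by (rule dvd_trans)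
        show "i < j" using dvd_imp_le[OF i pos] lt by simp
      qed
    qed
    have "(\<Sum>i\<in>?D. exact_count g i) \<le>
      (\<Sum>i\<in>?D. \<Sum>p\<in>prime_factors j. if i dvd j div p then exact_count g i else 0)"
    proof (rule sum_mono)
      fix i assume i: "i \<in> ?D"
      then obtain k where k: "j = i * k" by auto
      then have "k \<noteq> 1" using i by auto
      then obtain p where p: "prime p" "p dvd k" using prime_factor_nat by blast
      then have pj: "p \<in> prime_factors j" using k j by (auto simp: prime_factors_dvd)
      have "i dvd j div p" using p k by (auto simp: prime_gt_0_nat)
      then have "exact_count g i = (\<Sum>q\<in>{p}. if i dvd j div q then exact_count g i else 0)" by simp
      also have "\<dots> \<le> (\<Sum>q\<in>prime_factors j. if i dvd j div q then exact_count g i else 0)"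
        using pj nn[OF i] by (intro sum_mono2) auto
      finally show "exact_count g i \<le> (\<Sum>q\<in>prime_factors j. if i dvd j div q then exact_count g i else 0)" .
    qed
    also have "\<dots> = (\<Sum>p\<in>prime_factors j. \<Sum>i\<in>?D. if i dvd j div p then exact_count g i else 0)"
      by (rule sum.swap)
    also have "\<dots> = (\<Sum>p\<in>prime_factors j. int (g (j div p)))"
    proof (rule sum.cong[OF refl])
      fix p assume p: "p \<in> prime_factors j"
      have "(\<Sum>i\<in>?D. if i dvd j div p then exact_count g i else 0) =
        (\<Sum>i\<in>?D \<inter> {i. i dvd j div p}. exact_count g i)"
        using finite_dvd[OF j] by (subst sum.inter_restrict) auto
      also have "?D \<inter> {i. i dvd j div p} = {i. i dvd j div p}" using div[OF p] by blast
      also have "(\<Sum>i | i dvd j div p. exact_count g i) = int (g (j div p))"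
        using p j by (intro sum_exact_count)
          (auto simp: div_greater_zero_iff prime_factors_dvd dvd_imp_le prime_gt_0_nat)
      finally show "(\<Sum>i\<in>?D. if i dvd j div p then exact_count g i else 0) = int (g (j div p))" .
    qed
    also have "\<dots> \<le> int (g j)"
      using assms(2)[OF less.prems] False by (simp flip: of_nat_sum)
    finally show ?thesis by (simp add: exact_count.simps[of g j])
  qed
qed

lemma primitive_root_power_eq_1:
  assumes w: "primitive_root_of_unity d w"
  shows "w ^ n = 1 \<longleftrightarrow> d dvd n"
proof -
  have d: "d > 0" "w ^ d = 1" using w by (auto simp: primitive_root_of_unity_def)
  have "w ^ n = w ^ (d * (n div d) + n mod d)" by simp
  also have "\<dots> = w ^ (n mod d)" by (simp only: power_add power_mult d power_one mult_1)
  finally have "w ^ n = w ^ (n mod d)" .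
  moreover have "n mod d < d" using d by simp
  ultimately show ?thesis
    using w by (auto simp: primitive_root_of_unity_def dvd_eq_mod_eq_0)
qed

lemma primitive_root_power:
  assumes w: "primitive_root_of_unity d w"
  shows "primitive_root_of_unity (d div gcd t d) (w ^ t)"
proof -
  have d: "d > 0" using w by (simp add: primitive_root_of_unity_def)
  have eq: "(w ^ t) ^ n = 1 \<longleftrightarrow> d div gcd t d dvd n" for n
  proof -
    have "(w ^ t) ^ n = 1 \<longleftrightarrow> d dvd t * n"
      using primitive_root_power_eq_1[OF w] by (simp flip: power_mult)
    also have "\<dots> \<longleftrightarrow> d dvd gcd (t * n) (d * n)" by simp
    also have "gcd (t * n) (d * n) = gcd t d * n" by (simp add: gcd_mult_distrib_nat mult.commute)
    also have "d dvd gcd t d * n \<longleftrightarrow> d div gcd t d dvd n"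
      using d by (simp add: div_dvd_iff_mult mult.commute)
    finally show ?thesis .
  qed
  have "d div gcd t d > 0" using d by (simp add: div_greater_zero_iff dvd_imp_le)
  moreover have "(w ^ t) ^ n \<noteq> 1" if "0 < n" "n < d div gcd t d" for n
    using that eq by (auto dest: dvd_imp_le)
  ultimately show ?thesis using eq by (auto simp: primitive_root_of_unity_def)
qed

lemma sum_powers_root:
  fixes z :: complex
  assumes "z ^ M = 1"
  shows "(\<Sum>u<M. z ^ u) = (if z = 1 then of_nat M else 0)"
  using assms by (auto simp: geometric_sum)

text \<open>For a divisor \<open>j\<close> of \<open>m\<close> put \<open>c = m div j\<close> and evaluate the sum of \<open>w ^ (t * c) * f (w ^ t)\<close> over \<open>t < m\<close> twice. Expanding
\<open>f\<close> gives an integer multiple of \<open>m\<close>. Inserting the known values of \<open>f\<close> gives the sum of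
\<open>(m div i) * exact_count g i\<close> over the multiples \<open>i\<close> of \<open>j\<close> that divide \<open>m\<close>. For \<open>i > j\<close> these terms are
multiples of \<open>m\<close> by induction, so the term for \<open>i = j\<close> is one, too.\<close>

lemma dvd_exact_count:
  fixes f :: "nat poly"
  assumes m: "m > 0"
    and f: "\<And>d w. d dvd m \<Longrightarrow> primitive_root_of_unity d w \<Longrightarrow>
      poly (map_poly of_nat f) w = of_nat (g (m div d))"
    and "j dvd m"
  shows "int j dvd exact_count g j"
  using \<open>j dvd m\<close>
proof (induction "m - j" arbitrary: j rule: less_induct)
  case less
  obtain w where w: "primitive_root_of_unity m w" using primitive_root_exists[OF m] .
  have j: "j > 0" using less.prems m by (auto intro: Nat.gr0I)
  define c where "c = m div j"
  have cj: "c * j = m" using less.prems by (simp add: c_def)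
  have c: "c > 0" using cj m by (auto intro: Nat.gr0I)
  have wm: "w ^ m = 1" using w by (simp add: primitive_root_of_unity_def)
  let ?D = "{i. i dvd m}"
  have fD: "finite ?D" using finite_dvd[OF m, of "\<lambda>_. True"] by simp
  have dpos: "i > 0" if "i dvd m" for i using that m by (auto intro: Nat.gr0I)
  have val: "poly (map_poly of_nat f) (w ^ t) = (\<Sum>i\<in>?D. if i dvd t then of_int (exact_count g i) else 0)" for t
  proof -
    have gm: "gcd t m dvd m" "gcd t m > 0" using m by auto
    note dd = div_div_dvd[OF gm(1) m]
    have "poly (map_poly of_nat f) (w ^ t) = of_nat (g (gcd t m))"
      using f[OF dd(1) primitive_root_power[OF w]] dd(2) by simp
    also have "\<dots> = of_int (\<Sum>i | i dvd gcd t m. exact_count g i)"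
      using sum_exact_count[OF gm(2)] by simp
    also have "{i. i dvd gcd t m} = ?D \<inter> {i. i dvd t}" by auto
    also have "(\<Sum>i\<in>?D \<inter> {i. i dvd t}. exact_count g i) = (\<Sum>i\<in>?D. if i \<in> {i. i dvd t} then exact_count g i else 0)"
      using fD by (rule sum.inter_restrict)
    finally show ?thesis unfolding of_int_sum by (simp add: if_distrib[of of_int] cong: if_cong)
  qed
  let ?F = "\<lambda>i. if j dvd i then int (m div i) * exact_count g i else 0"
  let ?G = "\<lambda>i t. if i dvd t then of_int (exact_count g i) * w ^ (t * c) else 0 :: complex"
  let ?S = "\<Sum>t<m. w ^ (t * c) * poly (map_poly of_nat f) (w ^ t)"
  \<comment> \<open>expanding \<open>f\<close>\<close>
  define b where "b = (\<Sum>n\<le>degree f. if m dvd n + c then int (coeff f n) else 0)"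
  have cf: "coeff (map_poly of_nat f :: complex poly) n = of_nat (coeff f n)" for n
    by (simp add: coeff_map_poly)
  have deg: "degree (map_poly of_nat f :: complex poly) = degree f"
    by (rule degree_map_poly) simp
  have "?S = (\<Sum>t<m. \<Sum>n\<le>degree f. of_nat (coeff f n) * (w ^ (n + c)) ^ t)"
    unfolding poly_altdef deg cf sum_distrib_left
    by (intro sum.cong refl) (simp add: power_add power_mult_distrib mult_ac flip: power_mult)
  also have "\<dots> = (\<Sum>n\<le>degree f. of_nat (coeff f n) * (\<Sum>t<m. (w ^ (n + c)) ^ t))"
    by (subst sum.swap) (simp add: sum_distrib_left)
  also have "\<dots> = (\<Sum>n\<le>degree f. of_nat m * (if m dvd n + c then of_nat (coeff f n) else 0))"
  proof (intro sum.cong refl)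
    fix n
    have "(w ^ (n + c)) ^ m = 1" using wm by (metis power_mult mult.commute power_one)
    then show "of_nat (coeff f n) * (\<Sum>t<m. (w ^ (n + c)) ^ t) =
        of_nat m * (if m dvd n + c then of_nat (coeff f n) else 0)"
      by (simp add: sum_powers_root primitive_root_power_eq_1[OF w])
  qed
  also have "\<dots> = of_int (int m * b)"
  proof -
    have "(\<Sum>n\<le>degree f. if m dvd n + c then of_nat (coeff f n) else 0 :: complex) = of_int b"
      unfolding b_def of_int_sum by (intro sum.cong) auto
    then show ?thesis by (simp add: sum_distrib_left[symmetric])
  qed
  finally have S1: "?S = of_int (int m * b)" .
  \<comment> \<open>inserting the values of \<open>f\<close>\<close>
  have "?S = (\<Sum>t<m. \<Sum>i\<in>?D. ?G i t)"
    unfolding val sum_distrib_left by (intro sum.cong refl) auto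
  also have "\<dots> = (\<Sum>i\<in>?D. \<Sum>t<m. ?G i t)"
    by (rule sum.swap)
  also have "\<dots> = (\<Sum>i\<in>?D. if j dvd i then of_int (int (m div i) * exact_count g i) else 0)"
  proof (rule sum.cong[OF refl])
    fix i assume i: "i \<in> ?D"
    then have ip: "i > 0" "i * (m div i) = m" using dpos by auto
    have "(\<Sum>t<m. ?G i t) =
       (\<Sum>t\<in>{..<m} \<inter> {t. i dvd t}. of_int (exact_count g i) * w ^ (t * c))"
      by (subst sum.inter_restrict) auto
    also have "\<dots> = (\<Sum>u<m div i. of_int (exact_count g i) * w ^ (i * u * c))"
    proof (rule sum.reindex_bij_witness[of _ "\<lambda>u. i * u" "\<lambda>t. t div i"])
      fix u assume "u \<in> {..<m div i}"
      then have "i * u < i * (m div i)" using ip(1) by simp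
      also have "\<dots> = m" by (rule ip(2))
      finally show "i * u \<in> {..<m} \<inter> {t. i dvd t}" by simp
    qed (use ip in \<open>auto simp: less_mult_imp_div_less mult.commute dest: div_less_mono\<close>)
    also have "\<dots> = of_int (exact_count g i) * (\<Sum>u<m div i. (w ^ (i * c)) ^ u)"
      by (simp add: sum_distrib_left power_mult[symmetric] mult_ac)
    also have "(\<Sum>u<m div i. (w ^ (i * c)) ^ u) = (if w ^ (i * c) = 1 then of_nat (m div i) else 0)"
    proof (rule sum_powers_root)
      have "(w ^ (i * c)) ^ (m div i) = w ^ (i * (m div i) * c)" by (simp add: mult_ac flip: power_mult)
      then show "(w ^ (i * c)) ^ (m div i) = 1" using ip wm by (simp add: power_mult)
    qed
    also have "w ^ (i * c) = 1 \<longleftrightarrow> j dvd i"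
      unfolding primitive_root_power_eq_1[OF w] using cj c by (metis mult.commute nat_mult_dvd_cancel1)
    finally show "(\<Sum>t<m. ?G i t) =
      (if j dvd i then of_int (int (m div i) * exact_count g i) else 0)"
      by simp
  qed
  also have "\<dots> = of_int (\<Sum>i\<in>?D. ?F i)"
    unfolding of_int_sum by (intro sum.cong) auto
  finally have "of_int (int m * b) =
    (of_int (\<Sum>i\<in>?D. ?F i) :: complex)"
    using S1 by simp
  then have id: "int m * b = (\<Sum>i\<in>?D. ?F i)"
    by (simp only: of_int_eq_iff)
  also have "\<dots> = int c * exact_count g j +
     (\<Sum>i\<in>?D - {j}. ?F i)"
    using less.prems fD by (subst sum.remove[of _ j]) (auto simp: c_def)
  finally have id: "int c * exact_count g j = int m * b -
     (\<Sum>i\<in>?D - {j}. ?F i)" by linarith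
  have "int m dvd (\<Sum>i\<in>?D - {j}. ?F i)"
  proof (rule dvd_sum)
    fix i assume i: "i \<in> ?D - {j}"
    show "int m dvd (?F i)"
    proof (cases "j dvd i")
      case True
      have im: "i dvd m" "i \<noteq> j" using i by auto
      have "j \<le> i" using True dpos[OF im(1)] by (rule dvd_imp_le)
      moreover have "i \<le> m" using im(1) m by (rule dvd_imp_le)
      ultimately have "m - i < m - j" using im(2) by linarith
      then have "int i dvd exact_count g i" using im(1) by (rule less.hyps)
      then have "int (m div i) * int i dvd int (m div i) * exact_count g i" by (rule mult_dvd_mono[OF dvd_refl])
      moreover have "int (m div i) * int i = int m" using im(1) by (simp flip: of_nat_mult)
      ultimately show ?thesis using True by simp
    qed simp
  qed
  then have "int m dvd int c * exact_count g j" unfolding id by (intro dvd_diff dvd_triv_left)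
  moreover have "int m = int c * int j" using cj by (simp flip: of_nat_mult)
  ultimately have "int c * int j dvd int c * exact_count g j" by (simp only:)
  then show ?case using c by simp
qed

text \<open>Cycle number \<open>r\<close> of length \<open>j\<close> consists of the triples \<open>(j, r, s)\<close>; there are \<open>q j\<close> such cycles.\<close>

definition orbit_model :: "nat \<Rightarrow> (nat \<Rightarrow> nat) \<Rightarrow> (nat \<times> nat \<times> nat) set" where
  "orbit_model m q = {(j, r, s). j dvd m \<and> r < q j \<and> s < j}"

definition rotate_model :: "nat \<Rightarrow> nat \<times> nat \<times> nat \<Rightarrow> nat \<times> nat \<times> nat" where
  "rotate_model t = (\<lambda>(j, r, s). (j, r, (s + t) mod j))"

lemma card_orbit_model:
  assumes m: "m > 0"
  shows "finite {z \<in> orbit_model m q. P (fst z)}"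
    "card {z \<in> orbit_model m q. P (fst z)} = (\<Sum>j | j dvd m \<and> P j. q j * j)"
proof -
  have eq: "{z \<in> orbit_model m q. P (fst z)} = (SIGMA j:{j. j dvd m \<and> P j}. {..<q j} \<times> {..<j})"
    by (auto simp: orbit_model_def)
  have fin: "finite {j. j dvd m \<and> P j}" using m by (rule finite_dvd)
  show "finite {z \<in> orbit_model m q. P (fst z)}" unfolding eq using fin by auto
  show "card {z \<in> orbit_model m q. P (fst z)} = (\<Sum>j | j dvd m \<and> P j. q j * j)"
    unfolding eq using fin by (simp add: card_SigmaI)
qed

lemma rotate_model_in: "z \<in> orbit_model m q \<Longrightarrow> m > 0 \<Longrightarrow> rotate_model t z \<in> orbit_model m q"
  by (auto simp: orbit_model_def rotate_model_def)

lemma rotate_model_add: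
  "rotate_model s (rotate_model t z) = rotate_model (s + t) z"
  by (cases z) (simp add: rotate_model_def mod_simps ac_simps)

lemma rotate_model_fixed:
  assumes "z \<in> orbit_model m q"
  shows "rotate_model t z = z \<longleftrightarrow> fst z dvd t"
proof (cases z)
  case (fields j r s)
  then have s: "s < j" using assms by (simp add: orbit_model_def)
  have "(s + t) mod j = s \<longleftrightarrow> j dvd t"
  proof
    assume "(s + t) mod j = s"
    then have "(s + t) mod j = s mod j" using s by simp
    then show "j dvd t" by (metis add.commute add_diff_cancel_right' dvd_minus_mod mod_eq_dvd_iff_nat le_add2)
  next
    assume "j dvd t"
    then show "(s + t) mod j = s" using s by (auto elim!: dvdE)
  qed
  then show ?thesis using fields by (simp add: rotate_model_def)
qed

lemma rotate_model_cong:
  assumes "z \<in> orbit_model m q" "s mod m = t mod m"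
  shows "rotate_model s z = rotate_model t z"
proof (cases z)
  case (fields j r u)
  then have "j dvd m" using assms(1) by (simp add: orbit_model_def)
  then have "s mod j = t mod j" using assms(2) by (metis mod_mod_cancel)
  then have "(u + s) mod j = (u + t) mod j" by (metis mod_add_right_eq)
  then show ?thesis using fields by (simp add: rotate_model_def)
qed

theorem cyclic_sieving_from_table:
  fixes C :: "'c monoid" and f :: "nat poly"
  assumes m: "m > 0" and C: "group C" "cyclic_group C" "Coset.order C = m"
    and X: "finite X" "card X = g m"
    and f: "\<And>d w. d dvd m \<Longrightarrow> primitive_root_of_unity d w \<Longrightarrow>
      poly (map_poly of_nat f) w = of_nat (g (m div d))"
    and g: "\<And>j. j dvd m \<Longrightarrow> (\<forall>i. i dvd j \<longrightarrow> g i = g j) \<or> (\<Sum>p\<in>prime_factors j. g (j div p)) \<le> g j"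
  shows "\<exists>act. cyclic_sieving X C act f"
proof -
  interpret C: group C by fact
  define q where "q j = nat (exact_count g j) div j" for j
  let ?Y = "orbit_model m q"
  have q: "int (q j * j) = exact_count g j" if j: "j dvd m" for j
  proof -
    have "int j dvd exact_count g j" by (rule dvd_exact_count[where f = f and m = m]) (use m f j in auto)
    moreover have nn: "exact_count g j \<ge> 0" by (rule exact_count_nonneg[where m = m]) (use m g j in auto)
    ultimately have "j dvd nat (exact_count g j)" by (simp add: nat_dvd_iff int_dvd_int_iff[symmetric])
    then show ?thesis using nn by (simp add: q_def)
  qed
  have cardY: "card {z \<in> ?Y. fst z dvd t} = g (gcd t m)" for t
  proof -
    have "int (card {z \<in> ?Y. fst z dvd t}) = (\<Sum>j | j dvd m \<and> j dvd t. int (q j * j))"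
      using card_orbit_model(2)[OF m, of q "\<lambda>j. j dvd t"] by simp
    also have "\<dots> = (\<Sum>j | j dvd gcd t m. exact_count g j)"
      using q by (intro sum.cong) auto
    also have "\<dots> = int (g (gcd t m))" using m by (intro sum_exact_count) simp
    finally show ?thesis by simp
  qed
  have Y: "finite ?Y" "card ?Y = card X"
  proof -
    show "finite ?Y" using card_orbit_model(1)[OF m, of q "\<lambda>_. True"] by simp
    have "{z \<in> ?Y. fst z dvd m} = ?Y" by (auto simp: orbit_model_def)
    then show "card ?Y = card X" using cardY[of m] X by simp
  qed
  then obtain h where h: "bij_betw h X ?Y" using X(1) finite_same_card_bij by metis
  let ?k = "inv_into X h"
  have k: "bij_betw ?k ?Y X" using h by (rule bij_betw_inv_into)
  have hk: "h (?k y) = y" if "y \<in> ?Y" for y using h that by (rule bij_betw_inv_into_right)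
  have kh: "?k (h x) = x" if "x \<in> X" for x using h that by (rule bij_betw_inv_into_left)
  have hX: "h x \<in> ?Y" if "x \<in> X" for x using h that bij_betwE by blast
  have kY: "?k y \<in> X" if "y \<in> ?Y" for y using k that bij_betwE by blast
  obtain x where x: "x \<in> carrier C" "subgroup_generated C {x} = C"
    using C(2) by (auto simp: cyclic_group_def)
  have ordx: "C.ord x = m" using C.cyclic_order_is_ord[OF x(1)] x(2) C(3) by simp
  have fin: "finite (carrier C)" using C(3) m by (simp add: C.order_gt_0_iff_finite[symmetric])
  have gen: "\<exists>t::nat. x [^]\<^bsub>C\<^esub> t = c" if "c \<in> carrier C" for c
  proof -
    have "c \<in> range (\<lambda>n::int. x [^]\<^bsub>C\<^esub> n)"
      using that C.carrier_subgroup_generated_by_singleton[OF x(1)] x(2) by simp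
    then obtain n :: int where n: "c = x [^]\<^bsub>C\<^esub> n" by blast
    have "x [^]\<^bsub>C\<^esub> n = x [^]\<^bsub>C\<^esub> int (nat (n mod int m))"
      using m by (simp add: C.int_pow_eq[OF x(1)] ordx mod_eq_dvd_iff[symmetric])
    then have "x [^]\<^bsub>C\<^esub> nat (n mod int m) = c" using n by (simp only: int_pow_int)
    then show ?thesis by blast
  qed
  define e where "e c = (SOME t::nat. x [^]\<^bsub>C\<^esub> t = c)" for c
  have e: "x [^]\<^bsub>C\<^esub> e c = c" if "c \<in> carrier C" for c
    unfolding e_def using gen[OF that] by (rule someI_ex)
  have pow_eq: "s mod m = t mod m" if "x [^]\<^bsub>C\<^esub> s = x [^]\<^bsub>C\<^esub> (t::nat)" for s t
  proof -
    have "x [^]\<^bsub>C\<^esub> int s = x [^]\<^bsub>C\<^esub> int t" using that by (simp add: int_pow_int)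
    then have "int m dvd int t - int s" using C.int_pow_eq[OF x(1)] ordx by simp
    then show ?thesis by (metis mod_eq_dvd_iff of_nat_eq_iff zmod_int)
  qed
  define act where "act c = (\<lambda>z\<in>X. ?k (rotate_model (e c) (h z)))" for c
  have actX: "act c z \<in> X" if "z \<in> X" for c z
    using that kY rotate_model_in[OF hX m] by (simp add: act_def)
  have act_mult: "act (c \<otimes>\<^bsub>C\<^esub> d) z = act c (act d z)" if "c \<in> carrier C" "d \<in> carrier C" "z \<in> X" for c d z
  proof -
    have "x [^]\<^bsub>C\<^esub> (e c + e d) = x [^]\<^bsub>C\<^esub> e (c \<otimes>\<^bsub>C\<^esub> d)"
      using that e x(1) by (simp add: C.nat_pow_mult[symmetric])
    then have "(e c + e d) mod m = e (c \<otimes>\<^bsub>C\<^esub> d) mod m" by (rule pow_eq)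
    then have "rotate_model (e (c \<otimes>\<^bsub>C\<^esub> d)) (h z) = rotate_model (e c) (rotate_model (e d) (h z))"
      using rotate_model_cong[OF hX[OF that(3)]] by (metis rotate_model_add)
    then show ?thesis
      using that(3) actX[OF that(3)] hk[OF rotate_model_in[OF hX[OF that(3)] m]] by (simp add: act_def)
  qed
  have act_one: "act \<one>\<^bsub>C\<^esub> z = z" if "z \<in> X" for z
  proof -
    have "x [^]\<^bsub>C\<^esub> e \<one>\<^bsub>C\<^esub> = x [^]\<^bsub>C\<^esub> (0::nat)" using e[of "\<one>\<^bsub>C\<^esub>"] by simp
    then have "e \<one>\<^bsub>C\<^esub> mod m = 0 mod m" by (rule pow_eq)
    then have "rotate_model (e \<one>\<^bsub>C\<^esub>) (h z) = rotate_model 0 (h z)" by (rule rotate_model_cong[OF hX[OF that]])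
    also have "\<dots> = h z" using rotate_model_fixed[OF hX[OF that], of 0] by simp
    finally show ?thesis using that kh by (simp add: act_def)
  qed
  have bij: "act c \<in> Bij X" if c: "c \<in> carrier C" for c
  proof -
    have "bij_betw (act c) X X"
    proof (rule bij_betw_byWitness[where f' = "act (inv\<^bsub>C\<^esub> c)"])
      show "\<forall>z\<in>X. act (inv\<^bsub>C\<^esub> c) (act c z) = z"
        using act_mult[of "inv\<^bsub>C\<^esub> c" c] act_one c by simp
      show "\<forall>z\<in>X. act c (act (inv\<^bsub>C\<^esub> c) z) = z"
        using act_mult[of c "inv\<^bsub>C\<^esub> c"] act_one c by simp
    qed (use actX in auto)
    then show ?thesis by (simp add: Bij_def act_def)
  qed
  have "act \<in> hom C (BijGroup X)"
  proof (rule homI)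
    fix c d assume cd: "c \<in> carrier C" "d \<in> carrier C"
    show "act (c \<otimes>\<^bsub>C\<^esub> d) = act c \<otimes>\<^bsub>BijGroup X\<^esub> act d"
    proof
      fix z show "act (c \<otimes>\<^bsub>C\<^esub> d) z = (act c \<otimes>\<^bsub>BijGroup X\<^esub> act d) z"
        using cd bij act_mult[OF cd, of z] by (cases "z \<in> X") (auto simp: BijGroup_def compose_def act_def)
    qed
  qed (use bij in \<open>auto simp: BijGroup_def\<close>)
  then have action: "group_action C X act"
    using C.is_group group_BijGroup by (simp add: group_action_def group_hom_def group_hom_axioms_def)
  have fixed: "card {z \<in> X. act c z = z} = g (gcd (e c) m)" if "c \<in> carrier C" for c
  proof -
    have "act c z = z \<longleftrightarrow> fst (h z) dvd e c" if z: "z \<in> X" for z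
    proof -
      have "act c z = z \<longleftrightarrow> h (act c z) = h z" using h z actX[OF z] by (auto simp: bij_betw_def dest: inj_onD)
      also have "h (act c z) = rotate_model (e c) (h z)"
        using z hk[OF rotate_model_in[OF hX[OF z] m]] by (simp add: act_def)
      finally show ?thesis using rotate_model_fixed[OF hX[OF z]] by simp
    qed
    then have "{z \<in> X. act c z = z} = {z \<in> X. fst (h z) dvd e c}" by auto
    moreover have "bij_betw h {z \<in> X. fst (h z) dvd e c} {y \<in> ?Y. fst y dvd e c}"
    proof (rule bij_betw_subset[OF h])
      show "h ` {z \<in> X. fst (h z) dvd e c} = {y \<in> ?Y. fst y dvd e c}"
        unfolding bij_betw_imp_surj_on[OF h, symmetric] by blast
    qed blast
    ultimately show ?thesis using cardY[of "e c"] by (simp add: bij_betw_same_card)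
  qed
  have ordc: "C.ord c = m div gcd (e c) m" if "c \<in> carrier C" for c
    using C.ord_pow_gen[OF x(1), of "e c"] e[OF that] ordx m by (simp add: gcd.commute split: if_splits)
  have "cyclic_sieving X C act f"
    unfolding cyclic_sieving_def
  proof (intro conjI ballI allI impI)
    fix c w assume c: "c \<in> carrier C" and w: "primitive_root_of_unity (C.ord c) w"
    have gm: "gcd (e c) m dvd m" "gcd (e c) m > 0" using m by auto
    note dd = div_div_dvd[OF gm(1) m]
    show "of_nat (card {z \<in> X. act c z = z}) = poly (map_poly of_nat f) w"
      using f[OF dd(1), of w] w fixed[OF c] ordc[OF c] dd(2) by simp
  qed (use X C fin action in auto)
  then show ?thesis by blast
qed

section \<open>Tableaux as chains\<close>

lemma decreasing_gap:
  assumes "decreasing L a" "i \<le> j" "j < L"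
  shows "a j + int (j - i) \<le> a i"
  using assms(2,3)
proof (induction j rule: dec_induct)
  case (step j)
  then have "a (Suc j) < a j" using assms(1) by (auto simp: decreasing_def)
  with step show ?case by (simp add: Suc_diff_le)
qed simp

text \<open>The columns of row \<open>i\<close> occupied by \<open>mu\<close> together with the cells of \<open>T\<close> with entries at most \<open>l\<close>. For a
semistandard tableau this is an initial segment, whose length is the part of the intermediate shape.\<close>

definition row_part :: "(nat \<Rightarrow> nat) \<Rightarrow> (nat \<Rightarrow> nat) \<Rightarrow> (nat \<times> nat \<Rightarrow> nat) \<Rightarrow> nat \<Rightarrow> nat \<Rightarrow> nat set" where
  "row_part lam mu T l i = {j. j < lam i \<and> (j < mu i \<or> T (i, j) \<le> l)}"

definition particles :: "(nat \<Rightarrow> nat) \<Rightarrow> nat \<Rightarrow> int" where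
  "particles lam i = int (lam i) - int i"

definition tableau_chain :: "(nat \<Rightarrow> nat) \<Rightarrow> (nat \<Rightarrow> nat) \<Rightarrow> (nat \<times> nat \<Rightarrow> nat) \<Rightarrow> nat \<Rightarrow> nat \<Rightarrow> int" where
  "tableau_chain lam mu T l i = int (card (row_part lam mu T l i)) - int i"

lemma finite_row_part: "finite (row_part lam mu T l i)"
  by (simp add: row_part_def)

lemma decreasing_particles:
  assumes "antimono lam"
  shows "decreasing L (particles lam)"
  unfolding decreasing_def
proof (intro allI impI)
  fix i
  have "lam (Suc i) \<le> lam i" using assms by (auto simp: antimono_def)
  then show "particles lam (Suc i) < particles lam i" by (simp add: particles_def)
qed

context
  fixes N L :: nat and lam mu :: "nat \<Rightarrow> nat"
  assumes skew: "skew_partition lam mu" and L: "\<And>i. L \<le> i \<Longrightarrow> lam i = 0"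
begin

lemma anti_lam: "i \<le> j \<Longrightarrow> lam j \<le> lam i"
  and anti_mu: "i \<le> j \<Longrightarrow> mu j \<le> mu i"
  and mu_le: "mu i \<le> lam i"
  using skew by (auto simp: skew_partition_def partition_def antimono_def)

lemma in_diagram: "(i, j) \<in> skew_diagram lam mu \<longleftrightarrow> mu i \<le> j \<and> j < lam i"
  by (simp add: skew_diagram_def)

lemma mem_row_part_iff:
  assumes T: "T \<in> SSYT N lam mu" and D: "(i, j) \<in> skew_diagram lam mu"
  shows "j < card (row_part lam mu T l i) \<longleftrightarrow> T (i, j) \<le> l"
proof -
  let ?S = "row_part lam mu T l i"
  have down: "j' \<in> ?S" if "k \<in> ?S" "j' < k" for k j'
  proof (cases "j' < mu i")
    case True
    then show ?thesis using that by (auto simp: row_part_def)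
  next
    case False
    then have "(i, j') \<in> skew_diagram lam mu" "(i, k) \<in> skew_diagram lam mu" "T (i, k) \<le> l"
      using that by (auto simp: row_part_def in_diagram)
    moreover from this have "T (i, j') \<le> T (i, k)" using T \<open>j' < k\<close> by (auto simp: SSYT_def)
    ultimately show ?thesis by (auto simp: row_part_def in_diagram)
  qed
  have "?S = {..<card ?S}"
  proof (cases "?S = {}")
    case False
    have "Max ?S \<in> ?S" using False finite_row_part by (rule Max_in[rotated])
    then have "?S = {..Max ?S}"
      using down Max_ge[OF finite_row_part, of _ lam mu T l i] by (fastforce simp: le_less)
    then have "card ?S = Suc (Max ?S)" by (metis card_atMost)
    with \<open>?S = {..Max ?S}\<close> show ?thesis by (simp add: lessThan_Suc_atMost)
  qed simp
  then have "j < card ?S \<longleftrightarrow> j \<in> ?S" by blast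
  also have "\<dots> \<longleftrightarrow> T (i, j) \<le> l" using D by (auto simp: row_part_def in_diagram)
  finally show ?thesis .
qed

lemma tableau_chain_in:
  assumes T: "T \<in> SSYT N lam mu"
  shows "tableau_chain lam mu T \<in> ichains L N (particles mu) (particles lam)"
proof -
  have entry: "1 \<le> T (i, j)" "T (i, j) \<le> N" if "(i, j) \<in> skew_diagram lam mu" for i j
    using T that by (auto simp: SSYT_def)
  have 0: "row_part lam mu T 0 i = {..<mu i}" for i
  proof -
    have "j < mu i" if "T (i, j) = 0" "j < lam i" for j
      using entry(1)[of i j] that by (force simp: in_diagram)
    then show ?thesis using mu_le[of i] by (auto simp: row_part_def)
  qed
  have 1: "row_part lam mu T l i = {..<lam i}" if "N \<le> l" for l i
  proof -
    have "j < mu i \<or> T (i, j) \<le> l" if "j < lam i" for j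
      using entry(2)[of i j] that \<open>N \<le> l\<close> by (cases "j < mu i") (auto simp: in_diagram)
    then show ?thesis by (auto simp: row_part_def)
  qed
  have 2: "interlaces L (tableau_chain lam mu T l) (tableau_chain lam mu T (Suc l))" for l
    unfolding interlaces_def
  proof (intro conjI allI impI)
    fix i
    have "row_part lam mu T l i \<subseteq> row_part lam mu T (Suc l) i" by (auto simp: row_part_def)
    then have "card (row_part lam mu T l i) \<le> card (row_part lam mu T (Suc l) i)"
      by (intro card_mono finite_row_part)
    then show "tableau_chain lam mu T l i \<le> tableau_chain lam mu T (Suc l) i"
      by (simp add: tableau_chain_def)
    have "row_part lam mu T (Suc l) (Suc i) \<subseteq> row_part lam mu T l i"
    proof
      fix j assume j: "j \<in> row_part lam mu T (Suc l) (Suc i)"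
      then have jl: "j < lam i" using anti_lam[of i "Suc i"] by (auto simp: row_part_def)
      show "j \<in> row_part lam mu T l i"
      proof (cases "j < mu i")
        case False
        then have D: "(i, j) \<in> skew_diagram lam mu" "(Suc i, j) \<in> skew_diagram lam mu"
          using j jl anti_mu[of i "Suc i"] by (auto simp: row_part_def in_diagram)
        then have "T (i, j) < T (Suc i, j)" using T by (auto simp: SSYT_def)
        moreover have "T (Suc i, j) \<le> Suc l" using j D by (auto simp: row_part_def in_diagram)
        ultimately show ?thesis using jl by (simp add: row_part_def)
      qed (use jl in \<open>simp add: row_part_def\<close>)
    qed
    then have "card (row_part lam mu T (Suc l) (Suc i)) \<le> card (row_part lam mu T l i)"
      by (intro card_mono finite_row_part)
    then show "tableau_chain lam mu T (Suc l) (Suc i) < tableau_chain lam mu T l i"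
      by (simp add: tableau_chain_def)
    assume "L \<le> i"
    then show "tableau_chain lam mu T (Suc l) i = tableau_chain lam mu T l i"
      using L[of i] by (simp add: tableau_chain_def row_part_def)
  qed
  show ?thesis
    unfolding ichains_def using 0 1 2 by (auto simp: tableau_chain_def particles_def fun_eq_iff)
qed

lemma inj_tableau_chain: "inj_on (tableau_chain lam mu) (SSYT N lam mu)"
proof (rule inj_onI)
  fix T U assume T: "T \<in> SSYT N lam mu" and U: "U \<in> SSYT N lam mu"
    and eq: "tableau_chain lam mu T = tableau_chain lam mu U"
  have card: "card (row_part lam mu T l i) = card (row_part lam mu U l i)" for l i
    using fun_cong[OF fun_cong[OF eq, of l], of i] by (simp add: tableau_chain_def)
  show "T = U"
  proof (rule extensionalityI[of _ "skew_diagram lam mu"])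
    show "T \<in> extensional (skew_diagram lam mu)" "U \<in> extensional (skew_diagram lam mu)"
      using T U by (auto simp: SSYT_def PiE_def)
    fix c assume c: "c \<in> skew_diagram lam mu"
    obtain i j where ij: "c = (i, j)" by (cases c)
    have "T (i, j) \<le> l \<longleftrightarrow> U (i, j) \<le> l" for l
      using mem_row_part_iff[OF T, of i j l] mem_row_part_iff[OF U, of i j l] card c ij by simp
    then show "T c = U c" using ij by (metis order_antisym order_refl)
  qed
qed

text \<open>The tableau of a chain \<open>U\<close> has in cell \<open>(i, j)\<close> the first \<open>l\<close> such that the \<open>i\<close>-th row of the shape after
\<open>l\<close> steps, of length \<open>u l i\<close>, contains column \<open>j\<close>.\<close>

lemma surj_tableau_chain:
  assumes U: "U \<in> ichains L N (particles mu) (particles lam)"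
  shows "U \<in> tableau_chain lam mu ` SSYT N lam mu"
proof -
  let ?D = "skew_diagram lam mu"
  define u where "u l i = U l i + int i" for l i
  have u_mono: "u l i \<le> u l' i" if "l \<le> l'" for l l' i
    using ichains_mono[OF U that] by (simp add: u_def)
  have u_bounds: "int (mu i) \<le> u l i" "u l i \<le> int (lam i)" for l i
    using ichains_bounds[OF U, where i = i and l = l] by (auto simp: u_def particles_def)
  have u0: "u 0 i = int (mu i)" and uN: "u N i = int (lam i)" for i
    using U by (auto simp: u_def ichains_def particles_def)
  have u_step: "u (Suc l) i' \<le> u l i" if "l < N" "i < i'" "i' < L" for l i i'
  proof -
    have "decreasing L (particles mu)"
      by (rule decreasing_particles) (use skew in \<open>simp add: skew_partition_def partition_def\<close>)
    then have "decreasing L (U (Suc l))" using that by (intro ichains_decreasing[OF U]) auto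
    then have "U (Suc l) i' + int (i' - Suc i) \<le> U (Suc l) (Suc i)"
      using that by (intro decreasing_gap) auto
    moreover have "interlaces L (U l) (U (Suc l))" using U that by (auto simp: ichains_def)
    then have "U (Suc l) (Suc i) < U l i" using that by (auto simp: interlaces_def)
    ultimately show ?thesis using that by (simp add: u_def of_nat_diff)
  qed
  define T where "T = restrict (\<lambda>(i, j). LEAST l. int j < u l i) ?D"
  have T_le: "T (i, j) \<le> l \<longleftrightarrow> int j < u l i" if "(i, j) \<in> ?D" for i j l
  proof -
    have "int j < u N i" using that uN by (simp add: in_diagram)
    then have least: "int j < u (T (i, j)) i" unfolding T_def using that by (auto intro: LeastI)
    show ?thesis
    proof
      assume "T (i, j) \<le> l"
      then show "int j < u l i" using least u_mono order_less_le_trans by blast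
    next
      assume "int j < u l i"
      then show "T (i, j) \<le> l" unfolding T_def using that by (auto intro: Least_le)
    qed
  qed
  have TN: "1 \<le> T (i, j) \<and> T (i, j) \<le> N" if "(i, j) \<in> ?D" for i j
  proof
    have "\<not> T (i, j) \<le> 0" using T_le[OF that, of 0] u0[of i] that unfolding in_diagram by linarith
    then show "1 \<le> T (i, j)" by simp
    show "T (i, j) \<le> N" using T_le[OF that] uN that by (simp add: in_diagram)
  qed
  have "T \<in> SSYT N lam mu"
    unfolding SSYT_def
  proof (intro CollectI conjI allI impI)
    show "T \<in> ?D \<rightarrow>\<^sub>E {1..N}" using TN by (auto simp: T_def PiE_iff)
  next
    fix i j j' assume D: "(i, j) \<in> ?D" "(i, j') \<in> ?D" and "j < j'"
    then have "int j < u (T (i, j')) i" using T_le[OF D(2), of "T (i, j')"] by simp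
    then show "T (i, j) \<le> T (i, j')" using T_le[OF D(1)] by simp
  next
    fix i i' j assume D: "(i, j) \<in> ?D" "(i', j) \<in> ?D" and "i < i'"
    obtain l where l: "T (i', j) = Suc l" using TN[OF D(2)] by (metis One_nat_def Suc_le_D)
    have "i' < L" using L[of i'] D(2) by (auto simp: in_diagram not_less[symmetric])
    have "int j < u (Suc l) i'" using T_le[OF D(2), of "Suc l"] l by simp
    also have "\<dots> \<le> u l i" using TN[OF D(2)] l \<open>i < i'\<close> \<open>i' < L\<close> by (intro u_step) auto
    finally have "T (i, j) \<le> l" using T_le[OF D(1)] by simp
    then show "T (i, j) < T (i', j)" using l by simp
  qed
  moreover have "tableau_chain lam mu T = U"
  proof (intro ext)
    fix l i
    have "row_part lam mu T l i = {..<nat (u l i)}"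
    proof (rule Set.set_eqI)
      fix j
      show "j \<in> row_part lam mu T l i \<longleftrightarrow> j \<in> {..<nat (u l i)}"
        using T_le[of i j l] u_bounds(1)[of i l] u_bounds(2)[of l i]
        by (cases "j < mu i") (auto simp: row_part_def in_diagram)
    qed
    then show "tableau_chain lam mu T l i = U l i"
      using u_bounds(1)[of i l] by (simp add: tableau_chain_def u_def)
  qed
  ultimately show ?thesis by blast
qed

lemma increment_tableau_chain:
  assumes T: "T \<in> SSYT N lam mu"
  shows "increment L (tableau_chain lam mu T) l = card {c \<in> skew_diagram lam mu. T c = Suc l}"
proof -
  let ?S = "\<lambda>i. {j. (i, j) \<in> skew_diagram lam mu \<and> T (i, j) = Suc l}"
  have fin: "finite (?S i)" for i by (rule finite_subset[of _ "{..<lam i}"]) (auto simp: in_diagram)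
  have "row_part lam mu T (Suc l) i = row_part lam mu T l i \<union> ?S i" for i
    by (auto simp: row_part_def in_diagram)
  moreover have "row_part lam mu T l i \<inter> ?S i = {}" for i by (auto simp: row_part_def in_diagram)
  ultimately have "card (row_part lam mu T (Suc l) i) = card (row_part lam mu T l i) + card (?S i)" for i
    using finite_row_part fin by (simp add: card_Un_disjoint)
  then have "int (increment L (tableau_chain lam mu T) l) = int (\<Sum>i<L. card (?S i))"
    unfolding int_increment[OF tableau_chain_in[OF T]] by (simp add: tableau_chain_def)
  also have "(\<Sum>i<L. card (?S i)) = card (SIGMA i:{..<L}. ?S i)" using fin by (simp add: card_SigmaI)
  also have "(SIGMA i:{..<L}. ?S i) = {c \<in> skew_diagram lam mu. T c = Suc l}"
  proof -
    have "i < L" if "(i, j) \<in> skew_diagram lam mu" for i j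
      using L[of i] that by (auto simp: in_diagram not_less[symmetric])
    then show ?thesis by auto
  qed
  finally show ?thesis by simp
qed

lemma skew_schur_eq_chain_sum:
  "skew_schur N lam mu (\<lambda>i. x (i - 1)) = chain_sum L N (particles mu) (particles lam) x"
proof -
  have bij: "bij_betw (tableau_chain lam mu) (SSYT N lam mu) (ichains L N (particles mu) (particles lam))"
    unfolding bij_betw_def using inj_tableau_chain tableau_chain_in surj_tableau_chain by blast
  have "chain_sum L N (particles mu) (particles lam) x =
    (\<Sum>T\<in>SSYT N lam mu. \<Prod>l<N. x l ^ increment L (tableau_chain lam mu T) l)"
    unfolding chain_sum_def by (rule sum.reindex_bij_betw[OF bij, symmetric])
  also have "\<dots> = skew_schur N lam mu (\<lambda>i. x (i - 1))"
    unfolding skew_schur_def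
  proof (intro sum.cong refl)
    fix T assume T: "T \<in> SSYT N lam mu"
    show "(\<Prod>l<N. x l ^ increment L (tableau_chain lam mu T) l) =
      (\<Prod>i=1..N. x (i - 1) ^ card {c \<in> skew_diagram lam mu. T c = i})"
      by (rule prod.reindex_bij_witness[of _ "\<lambda>i. i - 1" Suc]) (auto simp: increment_tableau_chain[OF T])
  qed
  finally show ?thesis by simp
qed

lemma card_SSYT: "card (SSYT N lam mu) = card (ichains L N (particles mu) (particles lam))"
  by (rule bij_betw_same_card[of "tableau_chain lam mu"])
     (unfold bij_betw_def, use inj_tableau_chain tableau_chain_in surj_tableau_chain in blast)

end

section \<open>Evaluation of the principal specialization\<close>

definition evaluate :: "complex \<Rightarrow> nat poly \<Rightarrow> complex" where
  "evaluate w p = poly (map_poly of_nat p) w"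

lemma evaluate_pCons: "evaluate w (pCons c p) = of_nat c + w * evaluate w p"
  by (simp add: evaluate_def map_poly_pCons)

lemma evaluate_0: "evaluate w 0 = 0"
  by (simp add: evaluate_def)

lemma evaluate_add: "evaluate w (p + q) = evaluate w p + evaluate w q"
  by (induction p q rule: poly_induct2) (simp_all add: evaluate_pCons evaluate_0 algebra_simps)

lemma evaluate_smult: "evaluate w (smult c p) = of_nat c * evaluate w p"
  by (induction p) (simp_all add: evaluate_pCons evaluate_0 algebra_simps)

lemma evaluate_mult: "evaluate w (p * q) = evaluate w p * evaluate w q"
  by (induction p) (simp_all add: evaluate_pCons evaluate_0 evaluate_add evaluate_smult algebra_simps)

lemma evaluate_1: "evaluate w 1 = 1"
  by (simp add: one_pCons evaluate_pCons evaluate_0)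

lemma evaluate_power: "evaluate w (p ^ n) = evaluate w p ^ n"
  by (induction n) (simp_all add: evaluate_1 evaluate_mult)

lemma evaluate_monom: "evaluate w (Polynomial.monom 1 n) = w ^ n"
  by (simp add: evaluate_def map_poly_monom poly_monom)

lemma evaluate_sum: "evaluate w (sum f A) = (\<Sum>x\<in>A. evaluate w (f x))"
  by (induction A rule: infinite_finite_induct) (simp_all add: evaluate_0 evaluate_add)

lemma evaluate_prod: "evaluate w (prod f A) = (\<Prod>x\<in>A. evaluate w (f x))"
  by (induction A rule: infinite_finite_induct) (simp_all add: evaluate_1 evaluate_mult)

lemma evaluate_principal_specialization:
  "evaluate w (principal_specialization N lam mu) = skew_schur N lam mu (\<lambda>i. w ^ (i - 1))"
  unfolding principal_specialization_def skew_schur_def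
  by (simp only: evaluate_sum evaluate_prod evaluate_power evaluate_monom)

section \<open>Cyclic sieving\<close>

lemma dilate_dilate:
  assumes "d > 0" "e > 0"
  shows "dilate d (dilate e v) = dilate (d * e) v"
proof
  fix n
  have "e dvd n div d \<longleftrightarrow> d * e dvd n" if "d dvd n"
    using that assms by (auto simp: dvd_def)
  moreover have "d dvd n" if "d * e dvd n" using that by (rule dvd_mult_left)
  moreover have "n div d div e = n div (d * e)" using assms by (simp add: zdiv_zmult2_eq)
  ultimately show "dilate d (dilate e v) n = dilate (d * e) v n" by (auto simp: dilate_def)
qed

lemma dilate_neg: "d > 0 \<Longrightarrow> (\<And>n. n < 0 \<Longrightarrow> v n = 0) \<Longrightarrow> n < 0 \<Longrightarrow> dilate d v n = 0"
  by (simp add: dilate_def div_neg_pos_less0)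

lemma chain_sum_one: "chain_sum L N a b (\<lambda>_. 1) = of_nat (card (ichains L N a b))"
  by (simp add: chain_sum_def)

text \<open>A single chain contributes one power of \<open>w\<close>.\<close>

lemma norm_chain_sum_at_most_one:
  assumes "primitive_root_of_unity e w" "card (ichains L N a b) \<le> 1"
  shows "cmod (chain_sum L N a b (\<lambda>l. w ^ l)) = card (ichains L N a b)"
proof -
  have "w ^ e = 1" "e > 0" using assms(1) by (auto simp: primitive_root_of_unity_def)
  then have "cmod w ^ e = 1 ^ e" by (simp flip: norm_power)
  then have w: "cmod w = 1" using \<open>e > 0\<close> by (intro power_eq_imp_eq_base[of "cmod w" e 1]) auto
  have "card (ichains L N a b) = 0 \<or> card (ichains L N a b) = 1" using assms(2) by linarith
  then consider "ichains L N a b = {}" | T where "ichains L N a b = {T}"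
    using finite_ichains[of L N a b] by (auto simp: card_1_singleton_iff)
  then show ?thesis
  proof cases
    case 2
    then show ?thesis by (simp add: chain_sum_def norm_power w flip: prod_norm)
  qed (simp add: chain_sum_def)
qed

theorem theorem1p1:
  fixes k m :: nat and lam mu :: "nat \<Rightarrow> nat" and C :: "'c monoid"
  assumes "k > 0" and "m > 0"
    and "skew_partition lam mu"
    and "\<forall>i. m dvd (lam i - mu i)"
    and "group C" and "cyclic_group C" and "Coset.order C = m"
  shows "\<exists>act. cyclic_sieving (SSYT (k * m) lam mu) C act
                 (principal_specialization (k * m) lam mu)"
proof -
  have lam: "antimono lam" "finite {i. lam i \<noteq> 0}" and mu: "antimono mu" and mu_le: "mu i \<le> lam i" for i
    using assms(3) by (auto simp: skew_partition_def partition_def)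
  obtain L where L: "\<And>i. L \<le> i \<Longrightarrow> lam i = 0"
  proof -
    obtain L where "\<forall>i\<in>{i. lam i \<noteq> 0}. i < L" using lam(2) finite_nat_set_iff_bounded by blast
    then show ?thesis using that[of L] by (metis (mono_tags) mem_Collect_eq not_less)
  qed
  let ?a = "particles mu" and ?b = "particles lam"
  have a: "decreasing L ?a" and b: "decreasing L ?b" using lam mu decreasing_particles by auto
  have out: "?b i = ?a i" if "L \<le> i" for i using L[OF that] mu_le[of i] by (simp add: particles_def)
  have mdvd: "int m dvd ?b i - ?a i" for i
  proof -
    have "?b i - ?a i = int (lam i - mu i)" using mu_le[of i] by (simp add: particles_def of_nat_diff)
    then show ?thesis using assms(4) by simp
  qed
  let ?V = "\<lambda>j. complete_hom (k * j) (\<lambda>_. 1)"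
  define model where "model j \<alpha> \<beta> \<longleftrightarrow> decreasing L \<alpha> \<and> decreasing L \<beta> \<and> (\<forall>i\<ge>L. \<beta> i = \<alpha> i) \<and>
    (\<forall>v. (\<forall>n<0. v n = 0) \<longrightarrow>
      leibniz L (\<lambda>i i'. dilate (int (m div j)) v (?b i - ?a i')) = leibniz L (\<lambda>i i'. v (\<beta> i - \<alpha> i')))"
    for j \<alpha> \<beta>
  have ex: "\<exists>z. j dvd m \<longrightarrow> model j (fst z) (snd z)" for j
  proof (cases "j dvd m")
    case j: True
    have "int (m div j) > 0" using j assms(2) by (auto elim!: dvdE)
    moreover have "int (m div j) dvd ?b i - ?a i" for i
      using mdvd[of i] div_div_dvd(1)[OF j assms(2)] by (meson dvd_trans int_dvd_int_iff)
    ultimately obtain \<alpha> \<beta> where "decreasing L \<alpha>" "decreasing L \<beta>" "\<And>i. L \<le> i \<Longrightarrow> \<beta> i = \<alpha> i"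
      "\<And>v. (\<And>n. n < 0 \<Longrightarrow> v n = 0) \<Longrightarrow>
        leibniz L (\<lambda>i i'. dilate (int (m div j)) v (?b i - ?a i')) = leibniz L (\<lambda>i i'. v (\<beta> i - \<alpha> i'))"
      using quotient_leibniz[OF a b] by blast
    then show ?thesis by (intro exI[of _ "(\<alpha>, \<beta>)"]) (simp add: model_def)
  qed simp
  define \<alpha> where "\<alpha> j = fst (SOME z. j dvd m \<longrightarrow> model j (fst z) (snd z))" for j
  define \<beta> where "\<beta> j = snd (SOME z. j dvd m \<longrightarrow> model j (fst z) (snd z))" for j
  have model: "model j (\<alpha> j) (\<beta> j)" if "j dvd m" for j
    using someI_ex[OF ex[of j]] that unfolding \<alpha>_def \<beta>_def by blast
  have \<alpha>: "decreasing L (\<alpha> j)" and \<beta>: "decreasing L (\<beta> j)"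
    and out': "\<And>i. L \<le> i \<Longrightarrow> \<beta> j i = \<alpha> j i"
    and quot: "\<And>v. (\<And>n. n < 0 \<Longrightarrow> v n = 0) \<Longrightarrow>
      leibniz L (\<lambda>i i'. dilate (int (m div j)) v (?b i - ?a i')) = leibniz L (\<lambda>i i'. v (\<beta> j i - \<alpha> j i'))"
    if "j dvd m" for j
    using model[OF that] unfolding model_def by blast+
  \<comment> \<open>The value of the polynomial at a primitive root of order \<open>m div j\<close>.\<close>
  define g where "g j = card (ichains L (k * j) (\<alpha> j) (\<beta> j))" for j
  have g: "of_nat (g j) = leibniz L (\<lambda>i i'. dilate (int (m div j)) (?V j) (?b i - ?a i'))" if j: "j dvd m" for j
    using quot[OF j, of "?V j"] chain_sum_eq_leibniz[OF \<alpha>[OF j] \<beta>[OF j] out'[OF j], of "k * j" "\<lambda>_. 1"]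
    by (simp add: g_def chain_sum_one complete_hom_neg)
  have root: "chain_sum L (k * m) ?a ?b (\<lambda>l. w ^ l) = of_nat (g (m div d))"
    if d: "d dvd m" and w: "primitive_root_of_unity d w" for d w
  proof -
    have "complete_hom (k * m) (\<lambda>l. w ^ l) n = dilate (int d) (?V (m div d)) n" for n
      using complete_hom_root[OF w, of "k * m" n] d by (simp add: dilate_def div_mult_swap)
    then show ?thesis
      using chain_sum_eq_leibniz[OF a b out, of "k * m" "\<lambda>l. w ^ l"] g[OF div_div_dvd(1)[OF d assms(2)]]
        div_div_dvd(2)[OF d assms(2)] by simp
  qed
  \<comment> \<open>A further root of order \<open>e\<close> in the quotient by \<open>m div j\<close> amounts to one root of order \<open>(m div j) * e\<close> in the given problem.\<close>
  have sub: "chain_sum L (k * j) (\<alpha> j) (\<beta> j) (\<lambda>l. w ^ l) = of_nat (g (j div e))"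
    if j: "j dvd m" and e: "e dvd j" and w: "primitive_root_of_unity e w" for j e w
  proof -
    have pos: "e > 0" "j > 0" "m div j > 0"
      using w j e assms(2) by (auto simp: primitive_root_of_unity_def elim!: dvdE)
    have je: "j div e dvd m" using div_div_dvd(1)[OF e pos(2)] j by (rule dvd_trans)
    have "m div j * e = m div (j div e)"
    proof -
      obtain s where "j = e * s" using e by (rule dvdE)
      moreover obtain r where "m = j * r" using j by (rule dvdE)
      ultimately show ?thesis using pos assms(2) by (simp add: mult_ac)
    qed
    then have me: "int (m div j) * int e = int (m div (j div e))" by (simp flip: of_nat_mult)
    have "complete_hom (k * j) (\<lambda>l. w ^ l) n = dilate (int e) (?V (j div e)) n" for n
      using complete_hom_root[OF w, of "k * j" n] e by (simp add: dilate_def div_mult_swap)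
    then have "chain_sum L (k * j) (\<alpha> j) (\<beta> j) (\<lambda>l. w ^ l) =
      leibniz L (\<lambda>i i'. dilate (int e) (?V (j div e)) (\<beta> j i - \<alpha> j i'))"
      using chain_sum_eq_leibniz[OF \<alpha>[OF j] \<beta>[OF j] out'[OF j], of "k * j" "\<lambda>l. w ^ l"] by simp
    also have "\<dots> = leibniz L (\<lambda>i i'. dilate (int (m div j)) (dilate (int e) (?V (j div e))) (?b i - ?a i'))"
      using pos by (intro quot[OF j, symmetric] dilate_neg complete_hom_neg) auto
    also have "\<dots> = of_nat (g (j div e))"
      using g[OF je] pos by (subst dilate_dilate) (auto simp: me)
    finally show ?thesis .
  qed
  show ?thesis
  proof (rule cyclic_sieving_from_table[where g = g, OF assms(2,5,6,7) finite_SSYT[OF assms(3)]])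
    have "primitive_root_of_unity 1 1" by (auto simp: primitive_root_of_unity_def)
    from root[OF one_dvd this] show "card (SSYT (k * m) lam mu) = g m"
      by (simp add: chain_sum_one card_SSYT[OF assms(3) L])
  next
    fix d w assume d: "d dvd m" and w: "primitive_root_of_unity d w"
    show "poly (map_poly of_nat (principal_specialization (k * m) lam mu)) w = of_nat (g (m div d))"
      using evaluate_principal_specialization[of w "k * m" lam mu] root[OF d w]
        skew_schur_eq_chain_sum[OF assms(3) L, where N = "k * m" and x = "\<lambda>l. w ^ l"]
      by (simp add: evaluate_def)
  next
    fix j assume j: "j dvd m"
    then have jpos: "j > 0" using assms(2) by (auto intro: Nat.gr0I)
    let ?X = "ichains L (k * j) (\<alpha> j) (\<beta> j)"
    show "(\<forall>i. i dvd j \<longrightarrow> g i = g j) \<or> (\<Sum>p\<in>prime_factors j. g (j div p)) \<le> g j"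
    proof (cases "card ?X \<ge> 2")
      case False
      have "g i = g j" if i: "i dvd j" for i
      proof -
        have e: "j div i dvd j" "j div (j div i) = i" using div_div_dvd[OF i jpos] .
        have "j div i > 0" using e jpos by (auto intro: Nat.gr0I)
        then obtain w where w: "primitive_root_of_unity (j div i) w" by (rule primitive_root_exists)
        have "cmod (of_nat (g i)) = card ?X"
          using sub[OF j e(1) w] e(2) norm_chain_sum_at_most_one[OF w, of L "k * j" "\<alpha> j" "\<beta> j"] False by simp
        then show ?thesis by (simp add: g_def)
      qed
      then show ?thesis by blast
    next
      case True
      have "g (j div p) \<le> card (block_chains L p (k * j) (\<alpha> j) (\<beta> j))" if p: "p \<in> prime_factors j" for p
      proof -
        have "prime p" "p dvd j" using p by auto
        then have "p > 0" by (simp add: prime_gt_0_nat)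
        then obtain w where w: "primitive_root_of_unity p w" using primitive_root_exists by blast
        have "cmod (of_nat (g (j div p))) \<le> card (block_chains L p (k * j) (\<alpha> j) (\<beta> j))"
          unfolding sub[OF j \<open>p dvd j\<close> w, symmetric]
          using \<open>p dvd j\<close> by (intro norm_chain_sum_root[OF w _ \<alpha>[OF j] \<beta>[OF j] out'[OF j]]) auto
        then show ?thesis by simp
      qed
      then have "(\<Sum>p\<in>prime_factors j. g (j div p)) \<le>
        (\<Sum>p\<in>prime_factors j. card (block_chains L p (k * j) (\<alpha> j) (\<beta> j)))" by (rule sum_mono)
      also have "\<dots> \<le> card ?X"
        using assms(1) jpos True by (intro sum_block_chains_le) auto
      finally show ?thesis by (simp add: g_def)
    qed
  qed
qed

end
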